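(* Let $m\ge 1$ be an integer. For every $s\in\Delta$ the measure $\mu_s$ belongs to $\mathcal{P}_{\mathrm{erg}}(\mathcal{M})$, and the map $s\mapsto\mu_s$ is a homeomorphism from $\Delta$ onto $\mathcal{P}_{\mathrm{erg}}(\mathcal{M})$.
   Context: Let $\mathbb{N}=\{1,2,\dots\}$ and fix an integer $m\ge 1$. Let $\mathcal{M}=\mathrm{Mat}(\mathbb{N}\times m,\mathbb{R})=\{[X_{ij}]_{i\in\mathbb{N},1\le j\le m}: X_{ij}\in\mathbb{R}\}$, with the product topology (a Polish space). $O(\infty)$ is the inductive limit of the compact orthogonal groups $O(1)\subset O(2)\subset\cdots$, that is, the group of infinite orthogonal matrices $u=[u_{ij}]_{i,j\in\mathbb{N}}$ such that $u_{ij}=\delta_{ij}$ when $i+j$ is large enough. The group $O(\infty)\times O(m)$ acts on $\mathcal{M}$ by $((u,v),X)\mapsto uXv^{-1}$. An $O(\infty)\times O(m)$-invariant Borel probability measure $\mu$ on $\mathcal{M}$ is called ergodic if for every $O(\infty)\times O(m)$-invariant Borel subset $\mathcal{A}\subset\mathcal{M}$ either $\mu(\mathcal{A})=0$ or $\mu(\mathcal{M}\setminus\mathcal{A})=0$. $\mathcal{P}_{\mathrm{erg}}(\mathcal{M})$ is the set of ergodic $O(\infty)\times O(m)$-invariant Borel probability measures on $\mathcal{M}$, with the topology induced by the topology of weak convergence of probability measures (convergence of integrals of bounded continuous functions). $\Delta=\{s=(s_1,\dots,s_m)\in\mathbb{R}^m: s_1\ge\cdots\ge s_m\ge 0\}$,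 with the topology induced from $\mathbb{R}^m$. Let $G=[g_{ij}]_{i\in\mathbb{N},1\le j\le m}$ be a random matrix with independent standard real Gaussian entries, and let $\mathcal{O}$ be a Haar-distributed random matrix in $O(m)$, independent of $G$. For $s\in\Delta$, $\mu_s$ is the probability distribution on $\mathcal{M}$ of the random matrix $G\cdot\mathrm{diag}(s_1,\dots,s_m)\cdot\mathcal{O}$. *)

theory Defs
  imports "HOL-Probability.Probability"
begin

text \<open>
  The index set \<open>1, \<dots>, m\<close> of the columns is a type \<open>'m\<close> of class \<open>{finite, linorder}\<close>, so
  that \<open>m = CARD('m) \<ge> 1\<close>; the linear order is only used to order the entries of \<open>s\<close>.
  The rows are indexed by \<^typ>\<open>nat\<close>, i.e. from \<open>0\<close> instead of \<open>1\<close>. The topology of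
  \<open>imat\<close> supplied by the type classes is the product topology.
\<close>

type_synonym 'm imat = "nat \<Rightarrow> real ^ 'm"

text \<open>
  All sums below are finite for the matrices in question, since the rows and columns of a
  matrix that is eventually equal to the identity are finitely supported.
\<close>

definition O_inf :: "(nat \<Rightarrow> nat \<Rightarrow> real) set" where
  "O_inf = {u.
     (\<exists>N. \<forall>i j. N \<le> i + j \<longrightarrow> u i j = (if i = j then 1 else 0)) \<and>
     (\<forall>i j. (\<Sum>k | u i k \<noteq> 0. u i k * u j k) = (if i = j then 1 else 0)) \<and>
     (\<forall>i j. (\<Sum>k | u k i \<noteq> 0. u k i * u k j) = (if i = j then 1 else 0))}"

definition O_fin :: "(real ^ 'm ^ 'm) set" where
  "O_fin = {v. orthogonal_matrix v}"

text \<open>Row \<open>i\<close> of \<open>u X v\<^sup>-\<^sup>1\<close> is the row vector \<open>(\<Sum>k. u i k X k) v\<^sup>-\<^sup>1\<close>.\<close>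

definition act :: "(nat \<Rightarrow> nat \<Rightarrow> real) \<Rightarrow> real ^ 'm ^ 'm \<Rightarrow> 'm::finite imat \<Rightarrow> 'm imat" where
  "act u v X = (\<lambda>i. (\<Sum>k | u i k \<noteq> 0. u i k *\<^sub>R X k) v* matrix_inv v)"

definition invariant_set :: "'m::finite imat set \<Rightarrow> bool" where
  "invariant_set A \<longleftrightarrow> (\<forall>u\<in>O_inf. \<forall>v\<in>O_fin. act u v ` A = A)"

definition borel_probs :: "'a::topological_space measure set" where
  "borel_probs = {\<mu>. prob_space \<mu> \<and> sets \<mu> = sets borel}"

definition P_inv :: "'m::finite imat measure set" where
  "P_inv = {\<mu> \<in> borel_probs. \<forall>u\<in>O_inf. \<forall>v\<in>O_fin. distr \<mu> borel (act u v) = \<mu>}"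

definition P_erg :: "'m::finite imat measure set" where
  "P_erg = {\<mu> \<in> P_inv. \<forall>A\<in>sets borel. invariant_set A \<longrightarrow>
     emeasure \<mu> A = 0 \<or> emeasure \<mu> (- A) = 0}"

text \<open>
  The coarsest topology on the Borel probability measures for which \<open>\<mu> \<mapsto> \<integral>f d\<mu>\<close> is
  continuous for every bounded continuous real function \<open>f\<close>.
\<close>

definition weak_topology :: "'a::topological_space measure topology" where
  "weak_topology = topology_generated_by
     {{\<mu> \<in> borel_probs. integral\<^sup>L \<mu> f \<in> U} | (f :: 'a \<Rightarrow> real) U.
        continuous_on UNIV f \<and> bounded (range f) \<and> open U}"

lemma topspace_weak_topology: "topspace weak_topology = borel_probs"
proof -
  have "continuous_on UNIV (\<lambda>_::'a. 0::real)" "bounded (range (\<lambda>_::'a. 0::real))" "open (UNIV::real set)"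
    by auto
  then show ?thesis
    unfolding weak_topology_def topology_generated_by_topspace by blast
qed

definition Delta :: "(real ^ 'm::{finite,linorder}) set" where
  "Delta = {s. (\<forall>i j. i \<le> j \<longrightarrow> s $ j \<le> s $ i) \<and> (\<forall>i. 0 \<le> s $ i)}"

definition gaussian_imat :: "(nat \<times> 'm::finite \<Rightarrow> real) measure" where
  "gaussian_imat = PiM UNIV (\<lambda>_. std_normal_distribution)"

text \<open>
  The Haar probability measure of \<open>O(m)\<close>, the unique left-invariant probability measure,
  viewed as a measure on all \<open>m \<times> m\<close> matrices that is carried by \<open>O(m)\<close>.
\<close>

definition haar_O :: "(real ^ 'm::finite ^ 'm) measure" where
  "haar_O = (THE H. H \<in> borel_probs \<and> emeasure H O_fin = 1 \<and>
     (\<forall>v\<in>O_fin. distr H borel (\<lambda>w. v ** w) = H))"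

definition diag_mat :: "real ^ 'm \<Rightarrow> real ^ 'm ^ 'm" where
  "diag_mat s = (\<chi> i j. if i = j then s $ i else 0)"

text \<open>
  The law of \<open>G diag(s) Q\<close>; the product measure makes the Gaussian matrix \<open>G\<close> and the
  Haar-distributed matrix \<open>Q\<close> independent.
\<close>

definition mu :: "real ^ 'm \<Rightarrow> 'm::finite imat measure" where
  "mu s = distr (gaussian_imat \<Otimes>\<^sub>M haar_O) borel
     (\<lambda>(g, q). (\<lambda>i. (\<chi> j. g (i, j)) v* (diag_mat s ** q)))"

end

theory Submission
  imports Defs
begin

text \<open>
  An invariant measure \<open>\<mu>\<close> is determined by the real functions \<open>cf \<mu> 0 n T = \<integral>cos (\<Sum>i<n. T i \<bullet> X i) d\<mu>\<close>, and
  since any two families of columns with the same Gram matrix differ by an element of \<open>O(\<infinity>)\<close>, \<open>cf\<close> depends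
  on \<open>T\<close> only through \<open>T\<^sup>t T\<close>. Put \<open>L(N, t) = exp (- (\<Sum>j<N. (t \<bullet> X j)\<^sup>2) / 2N)\<close>. Writing such an
  exponential as a Gaussian average of cosines and applying the law of large numbers to the resulting
  Gram matrix gives \<open>\<integral>\<Prod>a<n. L(N, T a) d\<mu> \<longlonglongrightarrow> cf \<mu> 0 n T\<close>, and that \<open>L(N, t)\<close> is a Cauchy sequence
  in \<open>L\<^sup>1\<close>. The average \<open>R(N, T)\<close> of \<open>\<Prod>a<n. L(N, v (T a))\<close> over \<open>v\<close> in \<open>O(m)\<close> depends on \<open>X\<close> only through
  the eigenvalues of \<open>\<Sum>j<N. X j X j\<^sup>t / N\<close>; it equals \<open>cf (mu s) 0 n T\<close> when these are the squares of the
  entries of \<open>s\<close>. If \<open>\<mu>\<close> is ergodic, the limit of \<open>R(N, T)\<close> is an invariant function, hence the constant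
  \<open>cf \<mu> 0 n T\<close>, and a compactness argument yields \<open>s\<close> with \<open>\<mu> = mu s\<close>. Conversely \<open>R(N, T)\<close> converges to
  a constant under \<open>mu s\<close>, and therefore under \<open>mu s\<close> conditioned on any invariant event, which gives ergodicity.
  The asymptotics of \<open>cf (mu s)\<close> along suitable rays recover \<open>s\<close>, and the same compactness argument makes the
  inverse map continuous.
\<close>

section \<open>Haar measure on the orthogonal group\<close>

text \<open>An invariant \<mu> need not have moments, so the empirical Gram matrix of
  \<open>X\<close> cannot be controlled directly. Every statistic is therefore a bounded
  exponential, and the law of large numbers is applied only to auxiliary Gaussians, independent of
  \<open>X\<close>, with small weights. The Cauchy property rests on the algebra of exponentials:
  the product of two of them is a third one, with averaged weights and frequency sqrt 2 t, so the
  mean of a squared difference combines three means with one common limit. Real cosines suffice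
  because -1 lies in O(m), which makes \<mu> symmetric. \<open>Delta\<close> is not compact, and
  \<open>s\<close> could escape to infinity in the compactness argument. A frequency matrix whose
  Gram matrix is x times the identity prevents this: there the characteristic function of
  \<open>mu s\<close> is exp (- x |s|^2 / 2), and a positive target value confines \<open>s\<close>
  to a bounded set. Since \<open>T\<close> runs over an uncountable set, \<open>s\<close> is found
  by the finite intersection property and not by extracting a subsequence.\<close>

lemma norm_matrix_mult_le:
  fixes A :: "real^'n^'m" and B :: "real^'k^'n"
  shows "norm (A ** B) \<le> norm A * norm B"
proof -
  have row: "norm ((A ** B) $ i) \<le> norm (A $ i) * norm B" for i
  proof -
    have "(A ** B) $ i = (\<Sum>k\<in>UNIV. A $ i $ k *\<^sub>R B $ k)"
      by (simp add: vec_eq_iff matrix_matrix_mult_def)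
    then have "norm ((A ** B) $ i) \<le> (\<Sum>k\<in>UNIV. \<bar>A $ i $ k\<bar> * \<bar>norm (B $ k)\<bar>)"
      using norm_sum[of "\<lambda>k. A $ i $ k *\<^sub>R B $ k" UNIV] by simp
    \<comment> \<open>Cauchy-Schwarz in the inner index; the norm of a matrix is here the Frobenius
      norm.\<close>
    also have "\<dots> \<le> L2_set (\<lambda>k. A $ i $ k) UNIV * L2_set (\<lambda>k. norm (B $ k)) UNIV"
      by (rule L2_set_mult_ineq)
    also have "\<dots> = norm (A $ i) * norm B"
      by (simp add: norm_vec_def L2_set_def)
    finally show ?thesis .
  qed
  have "norm (A ** B) \<le> L2_set (\<lambda>i. norm (A $ i) * norm B) UNIV"
    unfolding norm_vec_def[of "A ** B"] by (intro L2_set_mono row) auto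
  also have "\<dots> = norm A * norm B"
    by (simp add: norm_vec_def[of A] L2_set_left_distrib)
  finally show ?thesis .
qed

lemma matrix_ring_simps:
  fixes A B :: "real^'n^'m" and C D :: "real^'k^'n" and F :: "real^'l^'k"
  shows "A ** (C + D) = A ** C + A ** D" "(A + B) ** C = A ** C + B ** C"
    "A ** (C - D) = A ** C - A ** D" "(A - B) ** C = A ** C - B ** C" "A ** C ** F = A ** (C ** F)"
  by (simp_all add: matrix_mul_assoc)
    (simp_all add: matrix_matrix_mult_def vec_eq_iff algebra_simps sum.distrib sum_subtractf)

lemma matrix_scaleR_mult:
  fixes A :: "real^'n^'m" and B :: "real^'k^'n"
  shows "(c *\<^sub>R A) ** B = c *\<^sub>R (A ** B)" "A ** (c *\<^sub>R B) = c *\<^sub>R (A ** B)"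
  by (simp_all add: matrix_matrix_mult_def vec_eq_iff sum_distrib_left mult.left_commute mult.assoc)

lemma continuous_matrix_mult [continuous_intros]:
  fixes f :: "'a::topological_space \<Rightarrow> real^'n^'m" and g :: "'a \<Rightarrow> real^'k^'n"
  assumes "continuous_on S f" "continuous_on S g"
  shows "continuous_on S (\<lambda>x. f x ** g x)"
  unfolding matrix_matrix_mult_def
  by (intro continuous_intros assms)

lemma continuous_transpose [continuous_intros]:
  fixes f :: "'a::topological_space \<Rightarrow> real^'n^'m"
  assumes "continuous_on S f"
  shows "continuous_on S (\<lambda>x. transpose (f x))"
  unfolding transpose_def by (intro continuous_intros assms)

text \<open>
  The Newton-Schulz iteration converges, near the orthogonal group, to the orthogonal polar factor and
  commutes with left multiplication by orthogonal matrices. It therefore carries Lebesgue measure on a left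
  invariant neighbourhood of the group to a Haar measure.
\<close>

definition defect :: "real^'m^'m \<Rightarrow> real^'m::finite^'m" where
  "defect A = mat 1 - transpose A ** A"

text \<open>With \<open>E = defect A\<close> the polar factor of an invertible \<open>A\<close> is A
  (1 - E)^(-1/2); the step keeps the first two terms of the binomial series.\<close>

definition newton_step :: "real^'m^'m \<Rightarrow> real^'m::finite^'m" where
  "newton_step A = A + (1/2) *\<^sub>R (A ** defect A)"

text \<open>All factors are polynomials in the symmetric matrix \<open>E\<close>, so this is the
  scalar identity (1 - e)(1 + e/2)^2 = 1 - 3e^2/4 - e^3/4. The missing linear term makes the
  iteration contract.\<close>

lemma defect_newton_step:
  "defect (newton_step A) = (3/4) *\<^sub>R (defect A ** defect A) + (1/4) *\<^sub>R (defect A ** defect A ** defect A)"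
proof -
  define E where "E = defect A"
  have tE: "transpose E = E"
    by (simp add: E_def defect_def transpose_def matrix_matrix_mult_def vec_eq_iff mat_def mult.commute)
  have B: "transpose A ** A = mat 1 - E"
    by (simp add: E_def defect_def)
  define C where "C = mat 1 + (1/2) *\<^sub>R E"
  have nA: "newton_step A = A ** C"
    by (simp add: newton_step_def C_def E_def matrix_ring_simps matrix_scaleR_mult)
  have tC: "transpose C = C"
    using tE by (simp add: C_def transpose_def vec_eq_iff mat_def)
  have "transpose (newton_step A) ** newton_step A = C ** (mat 1 - E) ** C"
    by (simp add: nA matrix_transpose_mul tC B[symmetric] matrix_mul_assoc)
  then show ?thesis
    unfolding E_def[symmetric]
    by (subst defect_def) (simp add: C_def matrix_ring_simps matrix_scaleR_mult scaleR_add_right scaleR_diff_right, simp add: algebra_simps flip: scaleR_left_distrib)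
qed

lemma defect_eq_0_iff: "defect A = 0 \<longleftrightarrow> A \<in> O_fin"
  by (auto simp: defect_def O_fin_def orthogonal_matrix)

lemma defect_mult_O:
  assumes "v \<in> O_fin" shows "defect (v ** A) = defect A"
proof -
  have "transpose v ** v = mat 1" using assms by (simp add: O_fin_def orthogonal_matrix)
  then have "transpose (v ** A) ** (v ** A) = transpose A ** A"
    by (metis matrix_transpose_mul matrix_mul_assoc matrix_mul_lid)
  then show ?thesis by (simp add: defect_def)
qed

text \<open>The squared Frobenius norm is the trace of \<open>transpose A ** A\<close>, and each
  diagonal entry of that matrix is at most 2.\<close>

lemma norm_sq_le_of_defect:
  fixes A :: "real^'m::finite^'m"
  assumes "norm (defect A) \<le> 1"
  shows "norm A ^ 2 \<le> 2 * real CARD('m)"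
proof -
  have "norm A ^ 2 = (\<Sum>i\<in>UNIV. \<Sum>j\<in>UNIV. (A $ i $ j)\<^sup>2)"
    by (simp add: norm_vec_def L2_set_def sum_nonneg)
  also have "\<dots> = (\<Sum>j\<in>UNIV. \<Sum>i\<in>UNIV. (A $ i $ j)\<^sup>2)" by (rule sum.swap)
  also have "\<dots> = (\<Sum>j\<in>UNIV. 1 - defect A $ j $ j)"
    by (simp add: defect_def matrix_matrix_mult_def transpose_def mat_def power2_eq_square)
  also have "\<dots> \<le> (\<Sum>j\<in>(UNIV::'m set). 2)"
  proof (rule sum_mono)
    fix j
    have "\<bar>defect A $ j $ j\<bar> \<le> norm (defect A)"
      by (meson Finite_Cartesian_Product.norm_nth_le component_le_norm_cart order_trans)
    then show "1 - defect A $ j $ j \<le> 2" using assms by linarith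
  qed
  finally show ?thesis by simp
qed

lemma norm_defect_step:
  assumes "norm (defect A) \<le> 1/2"
  shows "norm (defect (newton_step A)) \<le> norm (defect A) / 2"
proof -
  define e where "e = norm (defect A)"
  have e: "0 \<le> e" "e \<le> 1/2" using assms by (auto simp: e_def)
  have 2: "norm (defect A ** defect A) \<le> e * e"
    using norm_matrix_mult_le[of "defect A" "defect A"] by (simp add: e_def)
  have 3: "norm (defect A ** defect A ** defect A) \<le> e * e * e"
    using norm_matrix_mult_le[of "defect A ** defect A" "defect A"] mult_right_mono[OF 2 e(1)]
    by (simp add: e_def)
  have "norm (defect (newton_step A)) \<le> 3/4 * (e * e) + 1/4 * (e * e * e)"
    unfolding defect_newton_step
    by (rule order_trans[OF norm_triangle_ineq]) (use 2 3 in simp)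
  also have "\<dots> = e * (3/4 * e + 1/4 * e * e)" by (simp add: algebra_simps)
  \<comment> \<open>For \<open>e \<le> 1/2\<close> the bracket is at most 3/8 + 1/16 = 7/16.\<close>
  also have "\<dots> \<le> e * (1/2)"
  proof (rule mult_left_mono)
    have "e * e \<le> 1/2 * (1/2)" using e by (intro mult_mono) auto
    then show "3/4 * e + 1/4 * e * e \<le> 1/2" using e by (simp add: mult.assoc)
  qed (use e in auto)
  finally show ?thesis by (simp add: e_def)
qed

text \<open>A total function: where the iteration diverges \<open>lim\<close> has an unspecified
  value. Its properties are only claimed where the defect has norm at most 1/2.\<close>

definition polar :: "real^'m^'m \<Rightarrow> real^'m::finite^'m" where
  "polar A = lim (\<lambda>k. (newton_step ^^ k) A)"

lemma newton_iter_mult: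
  assumes "v \<in> O_fin" shows "(newton_step ^^ k) (v ** A) = v ** (newton_step ^^ k) A"
  by (induction k)
    (simp_all add: newton_step_def defect_mult_O[OF assms] matrix_ring_simps matrix_scaleR_mult)

text \<open>The defect at least halves in each step while the iterates stay bounded, so the
  increments are dominated by a geometric series, and in the limit the defect is 0.\<close>

lemma polar:
  fixes A :: "real^'m::finite^'m"
  assumes A: "norm (defect A) \<le> 1/2"
  shows "(\<lambda>k. (newton_step ^^ k) A) \<longlonglongrightarrow> polar A" "polar A \<in> O_fin"
proof -
  define X where "X k = (newton_step ^^ k) A" for k
  have d: "norm (defect (X k)) \<le> (1/2)^(Suc k)" for k
  proof (induction k)
    case (Suc k)
    have "(1/2::real)^(Suc k) \<le> 1/2" by (simp add: power_le_one)
    then have "norm (defect (newton_step (X k))) \<le> norm (defect (X k)) / 2"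
      using Suc.IH by (intro norm_defect_step) linarith
    then show ?case using Suc.IH by (simp add: X_def)
  qed (use A in \<open>simp add: X_def\<close>)
  define C where "C = sqrt (2 * real CARD('m))"
  have nX: "norm (X k) \<le> C" for k
  proof -
    have "norm (defect (X k)) \<le> 1" using d[of k] power_le_one[of "1/2::real" "Suc k"] by linarith
    then show ?thesis unfolding C_def by (intro real_le_rsqrt norm_sq_le_of_defect)
  qed
  have diff: "norm (X (Suc k) - X k) \<le> C * (1/2)^k" for k
  proof -
    have "norm (X (Suc k) - X k) = norm (X k ** defect (X k)) / 2"
      by (simp add: X_def newton_step_def)
    also have "\<dots> \<le> norm (X k) * norm (defect (X k))"
      using norm_matrix_mult_le[of "X k" "defect (X k)"] norm_ge_zero[of "X k ** defect (X k)"] by linarith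
    also have "\<dots> \<le> C * (1/2)^k"
    proof (rule mult_mono)
      show "norm (defect (X k)) \<le> (1/2)^k" using d[of k] norm_ge_zero[of "defect (X k)"] unfolding power_Suc by linarith
      show "0 \<le> C" unfolding C_def by simp
    qed (use nX in auto)
    finally show ?thesis .
  qed
  have "summable (\<lambda>k. X (Suc k) - X k)"
    by (rule summable_comparison_test'[where g = "\<lambda>k. C * (1/2)^k" and N = 0])
      (use diff in \<open>auto intro!: summable_mult summable_geometric\<close>)
  then have "convergent (\<lambda>n. \<Sum>k<n. X (Suc k) - X k)"
    by (simp add: summable_iff_convergent)
  then obtain l where "(\<lambda>n. \<Sum>k<n. X (Suc k) - X k) \<longlonglongrightarrow> l" by (auto simp: convergent_def)
  then have "(\<lambda>n. X n - X 0) \<longlonglongrightarrow> l" by (simp add: sum_lessThan_telescope)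
  from tendsto_add[OF this tendsto_const[of "X 0"]] have "X \<longlonglongrightarrow> l + X 0" by simp
  moreover have "lim X = polar A" by (simp add: polar_def X_def[abs_def])
  ultimately have "X \<longlonglongrightarrow> polar A" using limI by metis
  then show *: "(\<lambda>k. (newton_step ^^ k) A) \<longlonglongrightarrow> polar A" by (simp add: X_def[abs_def])
  have c: "continuous_on UNIV (defect :: real^'m^'m \<Rightarrow> _)"
    unfolding defect_def by (intro continuous_intros)
  have "(\<lambda>k. defect (X k)) \<longlonglongrightarrow> defect (polar A)"
    using \<open>X \<longlonglongrightarrow> polar A\<close> continuous_on_tendsto_compose[OF c] by auto
  moreover have "(\<lambda>k. defect (X k)) \<longlonglongrightarrow> 0"
  proof (rule Lim_null_comparison)
    show "\<forall>\<^sub>F k in sequentially. norm (defect (X k)) \<le> (1/2)^Suc k" using d by auto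
    show "(\<lambda>k. (1/2::real)^Suc k) \<longlonglongrightarrow> 0" by (intro LIMSEQ_Suc LIMSEQ_power_zero) auto
  qed
  ultimately have "defect (polar A) = 0" by (rule LIMSEQ_unique)
  then show "polar A \<in> O_fin" by (simp add: defect_eq_0_iff)
qed

lemma polar_mult:
  fixes A :: "real^'m::finite^'m"
  assumes "norm (defect A) \<le> 1/2" "v \<in> O_fin" shows "polar (v ** A) = v ** polar A"
proof -
  have "(\<lambda>k. v ** (newton_step ^^ k) A) \<longlonglongrightarrow> v ** polar A"
  proof -
    have "continuous_on UNIV (\<lambda>A::real^'m^'m. v ** A)" by (intro continuous_intros)
    then show ?thesis using continuous_on_tendsto_compose polar(1)[OF assms(1)] by fastforce
  qed
  then show ?thesis
    unfolding newton_iter_mult[OF assms(2), symmetric] by (simp add: limI polar_def)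
qed

lemma polar_measurable [measurable]: "polar \<in> borel_measurable borel"
proof -
  have "continuous_on UNIV ((newton_step :: real^'m::finite^'m \<Rightarrow> _) ^^ k)" for k
  proof (induction k)
    case (Suc k)
    have "continuous_on UNIV (newton_step :: real^'m::finite^'m \<Rightarrow> _)"
      unfolding newton_step_def defect_def by (intro continuous_intros)
    then show ?case using Suc by (auto intro: continuous_on_compose2)
  qed (simp add: id_def)
  then show ?thesis unfolding polar_def
    by (intro borel_measurable_lim_metric borel_measurable_continuous_onI) auto
qed

lemma orthogonal_transformation_matrix_mult:
  fixes v :: "real^'m::finite^'m"
  assumes "v \<in> O_fin"
  shows "orthogonal_transformation (\<lambda>A::real^'m^'m. v ** A)"
proof -
  have "norm (v ** A) = norm A" for A :: "real^'m^'m"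
  proof -
    have "norm B ^ 2 = (\<Sum>j\<in>UNIV. norm (column j B) ^ 2)" for B :: "real^'m^'m"
      by (simp add: norm_vec_def L2_set_def sum_nonneg column_def) (rule sum.swap)
    moreover have "column j (v ** A) = v *v column j A" for j
      by (simp add: vec_eq_iff column_def matrix_matrix_mult_def matrix_vector_mult_def)
    moreover have "norm (v *v x) = norm x" for x
      using assms orthogonal_transformation_matrix[of "\<lambda>x. v *v x"]
      by (simp add: O_fin_def orthogonal_transformation_norm)
    ultimately have "norm (v ** A) ^ 2 = norm A ^ 2" by simp
    then show ?thesis by simp
  qed
  moreover have "linear (\<lambda>A::real^'m^'m. v ** A)"
    by (intro linearI) (simp_all add: matrix_ring_simps matrix_scaleR_mult)
  ultimately show ?thesis by (simp add: orthogonal_transformation)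
qed

text \<open>
  For the unit ball \<open>B\<close>, the double integral of \<open>1\<^sub>A (x) 1\<^sub>B (x - f y)\<close> is \<open>\<lambda>(A) \<lambda>(B)\<close> in one order
  of integration and, by translation invariance, \<open>\<lambda>(f\<^sup>-\<^sup>1 A) \<lambda>(B)\<close> in the other.
\<close>

lemma lborel_distr_orthogonal:
  fixes f :: "'a::euclidean_space \<Rightarrow> 'a"
  assumes f: "orthogonal_transformation f"
  shows "distr lborel borel f = lborel"
proof (rule measure_eqI)
  obtain g where g: "linear g" "\<And>x. f (g x) = x" "\<And>x. g (f x) = x"
    using orthogonal_transformation_inv[OF f] orthogonal_transformation_bij[OF f]
    by (metis bij_inv_eq_iff orthogonal_transformation_linear)
  have lf: "linear f" using f by (rule orthogonal_transformation_linear)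
  have [measurable]: "f \<in> borel_measurable borel" "g \<in> borel_measurable borel"
    using lf g(1) by (auto intro!: borel_measurable_continuous_onI linear_continuous_on linear_conv_bounded_linear[THEN iffD1])
  have nf: "norm (f x) = norm x" for x using f by (simp add: orthogonal_transformation_norm)
  fix A :: "'a set" assume "A \<in> sets (distr lborel borel f)"
  then have [measurable]: "A \<in> sets borel" by simp
  define B where "B = ball (0::'a) 1"
  have [measurable]: "B \<in> sets borel" by (simp add: B_def)
  have shift: "(\<integral>\<^sup>+x. h (c + x) \<partial>lborel) = (\<integral>\<^sup>+x. h x \<partial>lborel)"
    if [measurable]: "h \<in> borel_measurable borel" for h and c :: 'a
  proof -
    have "(\<integral>\<^sup>+x. h x \<partial>lborel) = (\<integral>\<^sup>+x. h x \<partial>distr lborel borel ((+) c))"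
      by (simp add: lborel_distr_plus)
    then show ?thesis by (simp add: nn_integral_distr)
  qed
  have inner: "(\<integral>\<^sup>+y. indicator B (x - f y) \<partial>lborel) = emeasure lborel B" for x
  proof -
    \<comment> \<open>Translating \<open>y\<close> by \<open>g x\<close> removes \<open>x\<close>;
      the rest depends on \<open>y\<close> only through its norm, because \<open>B\<close> is a ball
      around 0 and \<open>f\<close> preserves norms.\<close>
    have "x - f (g x + y) = - f y" for y by (simp add: linear_add[OF lf] g)
    then have "(\<integral>\<^sup>+y. indicator B (x - f y) \<partial>lborel) = (\<integral>\<^sup>+y. indicator B (- f y) \<partial>lborel)"
      using shift[of "\<lambda>y. indicator B (x - f y)" "g x"] by simp
    also have "\<dots> = (\<integral>\<^sup>+y. indicator B y \<partial>lborel)"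
      by (simp add: B_def nf indicator_def)
    finally show ?thesis by simp
  qed
  have "emeasure lborel A * emeasure lborel B = (\<integral>\<^sup>+x. indicator A x * emeasure lborel B \<partial>lborel)"
    by (simp add: nn_integral_multc)
  also have "\<dots> = (\<integral>\<^sup>+x. \<integral>\<^sup>+y. indicator A x * indicator B (x - f y) \<partial>lborel \<partial>lborel)"
    by (simp add: nn_integral_cmult inner)
  also have "\<dots> = (\<integral>\<^sup>+y. \<integral>\<^sup>+x. indicator A x * indicator B (x - f y) \<partial>lborel \<partial>lborel)"
    by (rule lborel_pair.Fubini'[symmetric]) measurable
  also have "\<dots> = (\<integral>\<^sup>+y. \<integral>\<^sup>+x. indicator A (f y + x) * indicator B x \<partial>lborel \<partial>lborel)"
  proof (rule nn_integral_cong)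
    fix y
    show "(\<integral>\<^sup>+x. indicator A x * indicator B (x - f y) \<partial>lborel) = (\<integral>\<^sup>+x. indicator A (f y + x) * indicator B x \<partial>lborel)"
      using shift[of "\<lambda>x. indicator A x * indicator B (x - f y)" "f y"] by simp
  qed
  also have "\<dots> = (\<integral>\<^sup>+x. \<integral>\<^sup>+y. indicator A (f y + x) * indicator B x \<partial>lborel \<partial>lborel)"
    by (rule lborel_pair.Fubini') measurable
  also have "\<dots> = (\<integral>\<^sup>+x. emeasure lborel (f -` A) * indicator B x \<partial>lborel)"
  proof (rule nn_integral_cong)
    fix x
    have "f (g (- x) + y) + x = f y" for y by (simp add: linear_add[OF lf] g)
    then have "(\<integral>\<^sup>+y. indicator A (f y + x) \<partial>lborel) = (\<integral>\<^sup>+y. indicator A (f y) \<partial>lborel)"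
      using shift[of "\<lambda>y. indicator A (f y + x)" "g (- x)"] by simp
    also have "\<dots> = (\<integral>\<^sup>+y. indicator (f -` A) y \<partial>lborel)" by (simp add: indicator_vimage)
    also have "\<dots> = emeasure lborel (f -` A)"
      using measurable_sets[of f borel borel A] by (intro nn_integral_indicator) auto
    finally show "(\<integral>\<^sup>+y. indicator A (f y + x) * indicator B x \<partial>lborel) = emeasure lborel (f -` A) * indicator B x"
      by (simp add: nn_integral_multc)
  qed
  also have "\<dots> = emeasure lborel (f -` A) * emeasure lborel B"
    by (simp add: nn_integral_cmult)
  finally have *: "emeasure lborel A * emeasure lborel B = emeasure lborel (f -` A) * emeasure lborel B" .
  have "emeasure lborel B \<noteq> 0"
    using content_ball_pos[of 1 "0::'a"] by (auto simp: B_def measure_def)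
  moreover have "emeasure lborel B \<noteq> \<infinity>"
    using emeasure_bounded_finite[of B] by (simp add: B_def)
  ultimately have "emeasure lborel A = emeasure lborel (f -` A)"
    using * unfolding mult.commute[of _ "emeasure lborel B"] ennreal_mult_cancel_left by auto
  then show "emeasure (distr lborel borel f) A = emeasure lborel A" by (simp add: emeasure_distr)
qed simp

section \<open>Compactness of O(m), existence and uniqueness of its Haar measure\<close>

lemma O_fin_iff: "v \<in> O_fin \<longleftrightarrow> transpose v ** v = mat 1 \<and> v ** transpose v = mat 1"
  by (simp add: O_fin_def orthogonal_matrix_def)

lemma O_fin_transpose [simp]: "transpose v \<in> O_fin \<longleftrightarrow> v \<in> O_fin"
  by (auto simp: O_fin_iff)

lemma O_fin_id [simp]: "mat 1 \<in> O_fin"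
  by (simp add: O_fin_iff)

lemma compact_O_fin: "compact (O_fin :: (real^'m::finite^'m) set)"
proof -
  have "O_fin = {A::real^'m^'m. defect A = 0}" by (auto simp: defect_eq_0_iff)
  moreover have "closed {A::real^'m^'m. defect A = 0}"
    unfolding defect_def by (intro closed_Collect_eq continuous_intros)
  moreover have "bounded (O_fin :: (real^'m^'m) set)"
    unfolding bounded_iff
  proof (intro exI ballI)
    fix A :: "real^'m^'m" assume "A \<in> O_fin"
    then have "defect A = 0" by (simp add: defect_eq_0_iff)
    then show "norm A \<le> sqrt (2 * real CARD('m))"
      by (intro real_le_rsqrt norm_sq_le_of_defect) simp
  qed
  ultimately show ?thesis by (simp add: compact_eq_bounded_closed)
qed

lemma O_fin_borel [measurable]: "(O_fin :: (real^'m::finite^'m) set) \<in> sets borel"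
  by (intro borel_closed compact_imp_closed compact_O_fin)

lemma matrix_mult_measurable [measurable]:
  "(\<lambda>w :: real^'k^'n. v ** w) \<in> borel_measurable borel"
  "(\<lambda>w :: real^'n^'k. w ** u) \<in> borel_measurable borel"
  "transpose \<in> borel_measurable (borel :: (real^'k^'n) measure)"
  by (auto intro!: borel_measurable_continuous_onI continuous_intros)

lemma matrix_mult_pair_measurable [measurable (raw)]:
  fixes f :: "'a \<Rightarrow> real^'n^'m" and g :: "'a \<Rightarrow> real^'k^'n"
  assumes [measurable]: "f \<in> borel_measurable M" "g \<in> borel_measurable M"
  shows "(\<lambda>x. f x ** g x) \<in> borel_measurable M"
  using assms by (rule borel_measurable_continuous_Pair) (intro continuous_intros)

definition is_haar :: "(real^'m::finite^'m) measure \<Rightarrow> bool" where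
  "is_haar H \<longleftrightarrow> H \<in> borel_probs \<and> emeasure H O_fin = 1 \<and>
     (\<forall>v\<in>O_fin. distr H borel (\<lambda>w. v ** w) = H)"

lemma borel_probs_iff: "M \<in> borel_probs \<longleftrightarrow> prob_space M \<and> sets M = sets borel"
  by (simp add: borel_probs_def)

lemma prob_space_distr_borel:
  "prob_space M \<Longrightarrow> f \<in> borel_measurable M \<Longrightarrow> distr M borel f \<in> borel_probs"
  by (simp add: borel_probs_iff prob_space.prob_space_distr)

lemma is_haar_exists: "\<exists>H :: (real^'m::finite^'m) measure. is_haar H"
proof -
  define S where "S = {A :: real^'m^'m. norm (defect A) < 1/2}"
  have "open S" unfolding S_def defect_def by (intro open_Collect_less continuous_intros)
  have inS: "mat 1 \<in> S" by (simp add: S_def defect_def)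
  have bS: "bounded S"
    unfolding bounded_iff
  proof (intro exI ballI)
    fix A :: "real^'m^'m" assume "A \<in> S"
    then show "norm A \<le> sqrt (2 * real CARD('m))"
      by (intro real_le_rsqrt norm_sq_le_of_defect) (simp add: S_def)
  qed
  have [measurable]: "S \<in> sets borel" using \<open>open S\<close> by auto
  have S_pos: "emeasure lborel S \<noteq> 0"
    using open_not_negligible[OF \<open>open S\<close>] inS
    by (auto simp: negligible_iff_null_sets null_sets_def)
  have S_fin: "emeasure lborel S < \<infinity>" using emeasure_bounded_finite[OF bS] .
  define U where "U = uniform_measure lborel S"
  have U: "prob_space U" unfolding U_def
    using S_pos S_fin by (intro prob_space_uniform_measure) auto
  have sU [measurable_cong, simp]: "sets U = sets borel" by (simp add: U_def)
  have spU [simp]: "space U = UNIV" by (simp add: U_def)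
  have AE_S: "AE x in U. x \<in> S" unfolding U_def
    by (rule AE_uniform_measureI) auto
  have inv: "distr U borel (\<lambda>A. v ** A) = U" if v: "v \<in> O_fin" for v
  proof (rule measure_eqI)
    fix B assume "B \<in> sets (distr U borel (\<lambda>A. v ** A))"
    then have [measurable]: "B \<in> sets borel" by simp
    \<comment> \<open>\<open>S\<close> is stable under \<open>v\<close> because the defect is, so
      restricting Lebesgue measure to \<open>S\<close> commutes with the preimage under
      \<open>v\<close>.\<close>
    have "S \<inter> (\<lambda>A. v ** A) -` B = (\<lambda>A. v ** A) -` (S \<inter> B)"
      using v by (auto simp: S_def defect_mult_O)
    moreover have "emeasure lborel (S \<inter> B) = emeasure lborel ((\<lambda>A. v ** A) -` (S \<inter> B))"
      using emeasure_distr[of "\<lambda>A. v ** A" lborel borel "S \<inter> B"] v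
      by (simp add: lborel_distr_orthogonal orthogonal_transformation_matrix_mult)
    moreover have [measurable]: "(\<lambda>A. v ** A) -` B \<in> sets borel"
      using measurable_sets[OF matrix_mult_measurable(1)[of v] \<open>B \<in> sets borel\<close>] by simp
    ultimately have "emeasure lborel (S \<inter> (\<lambda>A. v ** A) -` B) = emeasure lborel (S \<inter> B)"
      by simp
    then show "emeasure (distr U borel (\<lambda>A. v ** A)) B = emeasure U B"
      by (simp add: emeasure_distr, simp add: U_def)
  qed simp
  define H where "H = distr U borel polar"
  have pol: "polar A \<in> O_fin" "polar (v ** A) = v ** polar A" if "A \<in> S" "v \<in> O_fin" for A v
    using that polar(2)[of A] polar_mult[of A v] by (auto simp: S_def)
  have "H \<in> borel_probs" unfolding H_def using U by (intro prob_space_distr_borel) auto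
  moreover have "emeasure H O_fin = 1"
  proof -
    have "AE x in U. polar x \<in> O_fin" using AE_S by eventually_elim (rule pol(1)[OF _ O_fin_id])
    then have "AE x in H. x \<in> O_fin" unfolding H_def by (simp add: AE_distr_iff)
    moreover interpret prob_space H using \<open>H \<in> borel_probs\<close> by (simp add: borel_probs_iff)
    have "sets H = sets borel" by (simp add: H_def)
    ultimately show ?thesis
      using emeasure_eq_1_AE[of O_fin] by simp
  qed
  moreover have "distr H borel (\<lambda>w. v ** w) = H" if v: "v \<in> O_fin" for v
  proof -
    have "distr H borel (\<lambda>w. v ** w) = distr U borel (\<lambda>A. v ** polar A)"
      unfolding H_def by (subst distr_distr) (auto simp: comp_def)
    \<comment> \<open>\<open>polar\<close> is known to commute with \<open>v\<close> only on
      \<open>S\<close>; this set carries \<open>U\<close>, so equality almost everywhere is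
      enough.\<close>
    also have "\<dots> = distr U borel (\<lambda>A. polar (v ** A))"
      using AE_S by (intro distr_cong_AE) (auto simp: pol(2)[OF _ v])
    also have "\<dots> = distr (distr U borel (\<lambda>A. v ** A)) borel polar"
      by (subst distr_distr) (auto simp: comp_def)
    also have "\<dots> = H" by (simp add: inv[OF v] H_def)
    finally show ?thesis .
  qed
  ultimately show ?thesis unfolding is_haar_def by blast
qed

text \<open>
  Integrating \<open>1\<^sub>A (v w)\<close> in both orders, with \<open>w\<close> left invariant and \<open>v\<close> the transpose of a
  left invariant matrix.
\<close>

lemma is_haar_transpose_unique:
  fixes H1 H2 :: "(real^'m::finite^'m) measure"
  assumes H1: "is_haar H1" and H2: "is_haar H2"
  shows "H1 = distr H2 borel transpose"
proof (rule measure_eqI)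
  interpret H1: prob_space H1 using H1 by (simp add: is_haar_def borel_probs_iff)
  interpret H2: prob_space H2 using H2 by (simp add: is_haar_def borel_probs_iff)
  interpret P: pair_sigma_finite H1 H2 ..
  have [measurable_cong, simp]: "sets H1 = sets borel" "sets H2 = sets borel"
    using H1 H2 by (simp_all add: is_haar_def borel_probs_iff)
  have AE1: "AE w in H1. w \<in> O_fin" and AE2: "AE w in H2. w \<in> O_fin"
    using H1 H2 H1.AE_in_set_eq_1[of O_fin] H2.AE_in_set_eq_1[of O_fin]
    by (auto simp: is_haar_def H1.emeasure_eq_measure H2.emeasure_eq_measure)
  show "sets H1 = sets (distr H2 borel transpose)" by simp
  fix A assume "A \<in> sets H1"
  then have [measurable]: "A \<in> sets borel" by simp
  have "emeasure H1 A = (\<integral>\<^sup>+x. emeasure H1 A \<partial>H2)" by (simp add: H2.emeasure_space_1)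
  also have "\<dots> = (\<integral>\<^sup>+x. \<integral>\<^sup>+w. indicator A (transpose x ** w) \<partial>H1 \<partial>H2)"
  proof (rule nn_integral_cong_AE, use AE2 in eventually_elim)
    fix x :: "real^'m^'m" assume "x \<in> O_fin"
    then have "emeasure H1 A = emeasure (distr H1 borel (\<lambda>w. transpose x ** w)) A"
      using H1 by (simp add: is_haar_def)
    also have "\<dots> = (\<integral>\<^sup>+w. indicator A w \<partial>distr H1 borel (\<lambda>w. transpose x ** w))" by simp
    also have "\<dots> = (\<integral>\<^sup>+w. indicator A (transpose x ** w) \<partial>H1)"
      by (subst nn_integral_distr) auto
    finally show "emeasure H1 A = (\<integral>\<^sup>+w. indicator A (transpose x ** w) \<partial>H1)" .
  qed
  also have "\<dots> = (\<integral>\<^sup>+w. \<integral>\<^sup>+x. indicator A (transpose x ** w) \<partial>H2 \<partial>H1)"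
    by (rule P.Fubini') measurable
  also have "\<dots> = (\<integral>\<^sup>+w. emeasure (distr H2 borel transpose) A \<partial>H1)"
  proof (rule nn_integral_cong_AE, use AE1 in eventually_elim)
    fix w :: "real^'m^'m" assume "w \<in> O_fin"
    have "emeasure (distr H2 borel transpose) A = (\<integral>\<^sup>+x. indicator A (transpose x) \<partial>H2)"
      by (simp add: nn_integral_distr flip: nn_integral_indicator)
    \<comment> \<open>Left invariance of \<open>H2\<close> under \<open>transpose w\<close> becomes
      right multiplication by \<open>w\<close> after transposition.\<close>
    also have "\<dots> = (\<integral>\<^sup>+x. indicator A (transpose x) \<partial>distr H2 borel (\<lambda>x. transpose w ** x))"
      using H2 \<open>w \<in> O_fin\<close> by (simp add: is_haar_def)
    also have "\<dots> = (\<integral>\<^sup>+x. indicator A (transpose x ** w) \<partial>H2)"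
      by (subst nn_integral_distr) (auto simp: matrix_transpose_mul)
    finally show "(\<integral>\<^sup>+x. indicator A (transpose x ** w) \<partial>H2) = emeasure (distr H2 borel transpose) A" ..
  qed
  also have "\<dots> = emeasure (distr H2 borel transpose) A" by (simp add: H1.emeasure_space_1)
  finally show "emeasure H1 A = emeasure (distr H2 borel transpose) A" .
qed

text \<open>Any two Haar measures are both the transpose of a third one, hence equal; so the
  definite description in \<open>haar_O\<close> is proper.\<close>

lemma is_haar_haar_O: "is_haar (haar_O :: (real^'m::finite^'m) measure)"
proof -
  have "\<exists>!H :: (real^'m::finite^'m) measure. is_haar H"
    using is_haar_exists is_haar_transpose_unique by (metis (no_types))
  from theI'[OF this] show ?thesis unfolding haar_O_def is_haar_def by blast
qed

lemma prob_space_haar_O: "prob_space haar_O"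
  and sets_haar_O [measurable_cong, simp]: "sets haar_O = sets borel"
  using is_haar_haar_O by (auto simp: is_haar_def borel_probs_iff)

interpretation haar: prob_space haar_O by (rule prob_space_haar_O)

lemma space_haar_O [simp]: "space haar_O = UNIV"
  using sets_eq_imp_space_eq[OF sets_haar_O] by simp

lemma prob_UNIV_haar_O [simp]: "measure haar_O UNIV = 1"
  using haar.prob_space by simp

lemma AE_haar_O: "AE w in haar_O. w \<in> O_fin"
  using is_haar_haar_O haar.AE_in_set_eq_1[of O_fin] by (auto simp: is_haar_def haar.emeasure_eq_measure)

lemma haar_left_invariant: "v \<in> O_fin \<Longrightarrow> distr haar_O borel (\<lambda>w. v ** w) = haar_O"
  using is_haar_haar_O by (auto simp: is_haar_def)

text \<open>The two measures in \<open>is_haar_transpose_unique\<close> may coincide. Right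
  invariance of Haar measure follows from this.\<close>

lemma haar_transpose: "distr haar_O borel transpose = (haar_O :: (real^'m::finite^'m) measure)"
  by (rule is_haar_transpose_unique[OF is_haar_haar_O is_haar_haar_O, symmetric])

lemma haar_right_invariant:
  fixes v :: "real^'m::finite^'m"
  assumes "v \<in> O_fin"
  shows "distr haar_O borel (\<lambda>w. w ** v) = haar_O"
proof -
  have "distr haar_O borel (\<lambda>w. w ** v) = distr (distr haar_O borel transpose) borel (\<lambda>w. w ** v)"
    by (simp add: haar_transpose)
  also have "\<dots> = distr haar_O borel (\<lambda>w. transpose (transpose v ** w))"
    by (subst distr_distr) (auto simp: comp_def matrix_transpose_mul)
  also have "\<dots> = distr (distr haar_O borel (\<lambda>w. transpose v ** w)) borel transpose"
    by (subst distr_distr) (auto simp: comp_def)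
  also have "\<dots> = haar_O" using assms by (simp add: haar_left_invariant haar_transpose)
  finally show ?thesis .
qed

lemma
  fixes f :: "real^'m::finite^'m \<Rightarrow> real"
  assumes "v \<in> O_fin" and [measurable]: "f \<in> borel_measurable borel"
  shows integral_haar_left: "(\<integral>w. f (v ** w) \<partial>haar_O) = (\<integral>w. f w \<partial>haar_O)"
    and integral_haar_right: "(\<integral>w. f (w ** v) \<partial>haar_O) = (\<integral>w. f w \<partial>haar_O)"
  using integral_distr[of "\<lambda>w. v ** w" haar_O borel f] integral_distr[of "\<lambda>w. w ** v" haar_O borel f]
  by (simp_all add: assms haar_left_invariant haar_right_invariant)

text \<open>Otherwise finitely many null translates of \<open>W\<close> would cover the compact
  group. The positivity gives the lower bound in Laplace's method below.\<close>

lemma haar_nhd_pos: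
  fixes W :: "(real^'m::finite^'m) set"
  assumes "open W" "mat 1 \<in> W"
  shows "0 < measure haar_O W"
proof (rule ccontr)
  have [measurable]: "W \<in> sets borel" using assms by auto
  assume "\<not> 0 < measure haar_O W"
  then have 0: "emeasure haar_O W = 0"
    by (simp add: haar.emeasure_eq_measure order.antisym not_less)
  have pre: "emeasure haar_O ((\<lambda>w. v ** w) -` W) = 0" if "v \<in> O_fin" for v
    using emeasure_distr[of "\<lambda>w. v ** w" haar_O borel W] 0 by (simp add: haar_left_invariant that)
  have op: "open ((\<lambda>w. v ** w) -` W)" for v :: "real^'m^'m"
    by (intro open_vimage assms continuous_intros)
  have "O_fin \<subseteq> (\<Union>v\<in>O_fin. (\<lambda>w. v ** w) -` W)"
  proof
    fix v :: "real^'m^'m" assume "v \<in> O_fin"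
    then have "transpose v \<in> O_fin" "v \<in> (\<lambda>w. transpose v ** w) -` W"
      using assms by (auto simp: O_fin_iff)
    then show "v \<in> (\<Union>v\<in>O_fin. (\<lambda>w. v ** w) -` W)" by blast
  qed
  from compactE_image[OF compact_O_fin op this] obtain C where
    C: "C \<subseteq> O_fin" "finite C" "O_fin \<subseteq> (\<Union>v\<in>C. (\<lambda>w. v ** w) -` W)" .
  have "emeasure haar_O (\<Union>v\<in>C. (\<lambda>w. v ** w) -` W) \<le> (\<Sum>v\<in>C. emeasure haar_O ((\<lambda>w. v ** w) -` W))"
    using C op by (intro emeasure_subadditive_finite) auto
  also have "\<dots> = 0" using C pre by (intro sum.neutral) auto
  finally have z: "emeasure haar_O (\<Union>v\<in>C. (\<lambda>w. v ** w) -` W) = 0" by simp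
  have "emeasure haar_O (O_fin :: (real^'m^'m) set) \<le> emeasure haar_O (\<Union>v\<in>C. (\<lambda>w. v ** w) -` W)"
    by (rule emeasure_mono) (use C op in \<open>auto intro!: borel_open open_UN\<close>)
  then show False using z is_haar_haar_O[where 'm='m] by (simp add: is_haar_def)
qed

section \<open>Uniqueness of characteristic functions\<close>

text \<open>The total masses agree (take \<open>t = 0\<close> and \<open>\<theta> = 0\<close>), so
  both measures can be normalised and Levy uniqueness applies; the phase - pi/2 turns the cosine
  into the sine needed for the imaginary part.\<close>

lemma finite_measure_cos_eqI:
  fixes M N :: "real measure"
  assumes "finite_measure M" "finite_measure N" and sets: "sets M = sets borel" "sets N = sets borel"
    and eq: "\<And>t \<theta>. (\<integral>x. cos (\<theta> + t * x) \<partial>M) = (\<integral>x. cos (\<theta> + t * x) \<partial>N)"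
  shows "M = N"
proof -
  interpret M: finite_measure M by fact
  interpret N: finite_measure N by fact
  note sets [measurable_cong, simp]
  have [simp]: "space M = UNIV" "space N = UNIV" using sets_eq_imp_space_eq[OF sets(1)] sets_eq_imp_space_eq[OF sets(2)] by auto
  define c where "c = measure M UNIV"
  have c': "c = measure N UNIV" using eq[of 0 0] by (simp add: c_def)
  show ?thesis
  proof (cases "c = 0")
    case True
    have "emeasure M A = 0" for A
      using M.bounded_measure[of A] True by (simp add: c_def M.emeasure_eq_measure measure_le_0_iff)
    moreover have "emeasure N A = 0" for A
      using N.bounded_measure[of A] True by (simp add: c' N.emeasure_eq_measure measure_le_0_iff)
    ultimately show ?thesis using sets by (intro measure_eqI) simp_all
  next
    case False
    then have c: "c > 0" by (simp add: c_def zero_less_measure_iff)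
    define D where "D K = density K (\<lambda>_. ennreal (1 / c))" for K :: "real measure"
    have D: "real_distribution (D K) \<and> char (D K) t = complex_of_real (1/c) * Complex (\<integral>x. cos (t * x) \<partial>K) (\<integral>x. sin (t * x) \<partial>K)"
      if K: "finite_measure K" "sets K = sets borel" "measure K UNIV = c" for K t
    proof -
      interpret K: finite_measure K by fact
      note K(2) [measurable_cong, simp]
      have [simp]: "space K = UNIV" using sets_eq_imp_space_eq[OF K(2)] by simp
      have "emeasure (D K) (space (D K)) = 1"
        using c K(3) by (simp add: D_def emeasure_density K.emeasure_eq_measure flip: ennreal_mult)
      then have "prob_space (D K)" by (rule prob_spaceI)
      then have "real_distribution (D K)"
        by (auto simp: real_distribution_def real_distribution_axioms_def D_def)
      moreover have "char (D K) t = complex_of_real (1/c) * (CLINT x|K. iexp (t * x))"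
        using c by (simp add: char_def D_def integral_density scaleR_conv_of_real)
      moreover have "(CLINT x|K. iexp (t * x)) = Complex (\<integral>x. cos (t * x) \<partial>K) (\<integral>x. sin (t * x) \<partial>K)"
      proof -
        have i: "integrable K (\<lambda>x. iexp (t * x))"
          by (intro K.integrable_const_bound[where B=1]) auto
        show ?thesis
          using integral_Re[OF i, symmetric] integral_Im[OF i, symmetric]
          by (intro complex_eqI) (simp_all add: Re_exp Im_exp)
      qed
      ultimately show ?thesis by simp
    qed
    have s: "(\<integral>x. sin (t * x) \<partial>M) = (\<integral>x. sin (t * x) \<partial>N)" for t
      using eq[of "- (pi/2)" t] by (simp add: cos_add cos_diff)
    have "char (D M) = char (D N)"
      using D[of M] D[of N] eq[of 0] s assms by (auto simp: fun_eq_iff c_def[symmetric] c'[symmetric])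
    then have DD: "D M = D N"
      using D[of M] D[of N] assms by (intro Levy_uniqueness) (auto simp: c_def[symmetric] c'[symmetric])
    show ?thesis
    proof (rule measure_eqI)
      fix A assume "A \<in> sets M"
      then have "emeasure (D M) A = ennreal (1/c) * emeasure M A" "emeasure (D N) A = ennreal (1/c) * emeasure N A"
        by (simp_all add: D_def emeasure_density nn_integral_cmult)
      then show "emeasure M A = emeasure N A"
        using c DD by (auto simp: ennreal_mult_cancel_left)
    qed (simp add: sets)
  qed
qed

text \<open>The one-dimensional theorem is applied to the images under \<open>X\<close> of the
  measures with density \<open>\<rho>\<close>: nonnegativity of \<open>\<rho>\<close> makes them
  measures and the bound \<open>B\<close> makes them finite.\<close>

lemma cos_marginal_density_eq:
  fixes \<mu> \<nu> :: "'a measure" and \<rho> X :: "'a \<Rightarrow> real"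
  assumes "finite_measure \<mu>" "finite_measure \<nu>" and sets: "sets \<mu> = sets \<nu>"
    and [measurable]: "\<rho> \<in> borel_measurable \<nu>" "X \<in> borel_measurable \<nu>"
    and \<rho>: "\<And>x. 0 \<le> \<rho> x" "\<And>x. \<rho> x \<le> B" and [measurable]: "E \<in> sets borel"
    and eq: "\<And>t \<theta>. (\<integral>x. \<rho> x * cos (\<theta> + t * X x) \<partial>\<mu>) = (\<integral>x. \<rho> x * cos (\<theta> + t * X x) \<partial>\<nu>)"
  shows "(\<integral>x. \<rho> x * indicator E (X x) \<partial>\<mu>) = (\<integral>x. \<rho> x * indicator E (X x) \<partial>\<nu>)"
proof -
  define D where "D K = distr (density K (\<lambda>x. ennreal (\<rho> x))) borel X" for K
  have D: "finite_measure (D K) \<and> sets (D K) = sets borel \<and>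
      (\<forall>f\<in>borel_measurable borel. (\<integral>x. f x \<partial>D K) = (\<integral>x. \<rho> x * f (X x) \<partial>K))"
    if K: "finite_measure K" "sets K = sets \<nu>" for K
  proof -
    interpret K: finite_measure K by fact
    note K(2)[measurable_cong]
    have "(\<integral>\<^sup>+x. ennreal (\<rho> x) \<partial>K) \<le> (\<integral>\<^sup>+x. ennreal B \<partial>K)"
      by (intro nn_integral_mono ennreal_leI \<rho>)
    also have "\<dots> < \<infinity>"
    proof -
      have "emeasure K (space K) < \<top>"
        using K.emeasure_finite[of "space K"] unfolding infinity_ennreal_def top.not_eq_extremum .
      then show ?thesis by (simp add: ennreal_mult_less_top)
    qed
    finally have "(\<integral>\<^sup>+x. ennreal (\<rho> x) \<partial>K) < \<infinity>" .
    then have "emeasure (density K (\<lambda>x. ennreal (\<rho> x))) (space K) < \<infinity>"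
      by (simp add: emeasure_density cong: nn_integral_cong)
    then have "finite_measure (D K)" unfolding D_def
      by (intro finite_measure.finite_measure_distr finite_measureI) auto
    moreover have "(\<integral>x. f x \<partial>D K) = (\<integral>x. \<rho> x * f (X x) \<partial>K)" if [measurable]: "f \<in> borel_measurable borel" for f :: "real \<Rightarrow> real"
      unfolding D_def by (simp add: integral_distr integral_density \<rho>)
    ultimately show ?thesis by (simp add: D_def)
  qed
  have "D \<mu> = D \<nu>"
    using D[of \<mu>] D[of \<nu>] assms(1,2) sets eq
    by (intro finite_measure_cos_eqI) auto
  then show ?thesis using D[of \<mu>] D[of \<nu>] assms(1,2) sets
    by (metis borel_measurable_indicator[OF \<open>E \<in> sets borel\<close>])
qed

lemma cos_product_sum:
  "cos a * cos b = (cos (a + b) + cos (a - b)) / (2::real)"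
  by (simp add: cos_add cos_diff)

text \<open>
  The coordinates are treated one at a time: \<open>1 + cos\<close> of a linear form is nonnegative, so it can serve as the
  density to which the one-dimensional uniqueness theorem is applied.
\<close>

proposition cos_transform_eqI:
  fixes \<mu> \<nu> :: "('i::countable \<Rightarrow> real) measure"
  assumes "prob_space \<mu>" "prob_space \<nu>" and sets: "sets \<mu> = sets borel" "sets \<nu> = sets borel"
    and eq: "\<And>J T \<theta>. finite J \<Longrightarrow> (\<integral>x. cos (\<theta> + (\<Sum>i\<in>J. T i * x i)) \<partial>\<mu>) = (\<integral>x. cos (\<theta> + (\<Sum>i\<in>J. T i * x i)) \<partial>\<nu>)"
  shows "\<mu> = \<nu>"
proof -
  interpret \<mu>: prob_space \<mu> by fact
  interpret \<nu>: prob_space \<nu> by fact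
  note sets [measurable_cong, simp]
  have [simp]: "space \<mu> = UNIV" "space \<nu> = UNIV" using sets_eq_imp_space_eq[OF sets(1)] sets_eq_imp_space_eq[OF sets(2)] by auto
  have coord [measurable]: "(\<lambda>x. x i) \<in> borel_measurable (borel :: ('i \<Rightarrow> real) measure)" for i
    by (rule measurable_product_coordinates)
  define I where "I K E x = (\<Prod>k\<in>K. indicator (E k) (x k) :: real)" for K E and x :: "'i \<Rightarrow> real"
  have I01: "0 \<le> I K E x" "I K E x \<le> 1" for K E x
    unfolding I_def by (auto intro!: prod_nonneg prod_le_1)
  have Im [measurable]: "I K E \<in> borel_measurable borel" if [measurable]: "\<And>k. E k \<in> sets borel" for K E
    unfolding I_def[abs_def] by (intro borel_measurable_prod) auto
  \<comment> \<open>By induction on \<open>K\<close>, coordinates pass one at a time from the cosine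
    into indicators. The cosine keeps an arbitrary \<open>J\<close>, since each step needs the
    previous case with \<open>p\<close> added to \<open>J\<close>.\<close>
  have main: "(\<integral>x. I K E x * cos (\<theta> + (\<Sum>i\<in>J. T i * x i)) \<partial>\<mu>) = (\<integral>x. I K E x * cos (\<theta> + (\<Sum>i\<in>J. T i * x i)) \<partial>\<nu>)"
    if "finite K" "finite J" "\<And>k. E k \<in> sets borel" for K E J T \<theta>
    using that
  proof (induction K arbitrary: J T \<theta> rule: finite_induct)
    case empty
    then show ?case by (simp add: I_def eq)
  next
    case (insert p K)
    note E[measurable] = insert.prems(2)
    define L where "L x = \<theta> + (\<Sum>i\<in>J. T i * x i)" for x
    have [measurable]: "L \<in> borel_measurable borel" unfolding L_def[abs_def] by measurable
    have IH: "(\<integral>x. I K E x * cos (\<theta>' + s * L x + t * x p) \<partial>\<mu>) = (\<integral>x. I K E x * cos (\<theta>' + s * L x + t * x p) \<partial>\<nu>)" for \<theta>' s t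
    proof -
      define T' where "T' i = (if i \<in> J then s * T i else 0) + (if i = p then t else 0)" for i
      have "\<theta>' + s * L x + t * x p = (\<theta>' + s * \<theta>) + (\<Sum>i\<in>insert p J. T' i * x i)" for x
      proof -
        have "(\<Sum>i\<in>insert p J. T' i * x i) = (\<Sum>i\<in>insert p J. (if i \<in> J then s * T i * x i else 0)) + (\<Sum>i\<in>insert p J. (if i = p then t * x i else 0))"
          unfolding T'_def by (subst sum.distrib[symmetric]) (auto intro!: sum.cong simp: algebra_simps)
        also have "(\<Sum>i\<in>insert p J. (if i \<in> J then s * T i * x i else 0)) = (\<Sum>i\<in>J. s * T i * x i)"
          using insert.prems(1) by (intro sum.mono_neutral_cong_right) auto
        also have "(\<Sum>i\<in>insert p J. (if i = p then t * x i else 0)) = t * x p"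
          using insert.prems(1) by (subst sum.delta) auto
        finally show ?thesis by (simp add: L_def algebra_simps sum_distrib_left)
      qed
      then show ?thesis using insert.IH[of "insert p J" "\<theta>' + s * \<theta>" T'] insert.prems by (simp only: finite_insert)
    qed
    have int [simp]: "integrable \<mu> (\<lambda>x. I K E x * cos (f x))" "integrable \<nu> (\<lambda>x. I K E x * cos (f x))"
      if [measurable]: "f \<in> borel_measurable borel" for f
    proof -
      have "norm (I K E x * cos (f x)) \<le> 1" for x
        using I01[of K E x] by (simp add: abs_mult mult_le_one)
      then show "integrable \<mu> (\<lambda>x. I K E x * cos (f x))" "integrable \<nu> (\<lambda>x. I K E x * cos (f x))"
        by (auto intro!: \<mu>.integrable_const_bound[where B=1] \<nu>.integrable_const_bound[where B=1])
    qed
    \<comment> \<open>\<open>c = 1\<close> gives the nonnegative density with 1 + cos,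
      \<open>c = 0\<close> the one without cosine; subtracting the two isolates the term with
      \<open>cos (L x)\<close>.\<close>
    have step: "(\<integral>x. (I K E x * (1 + c * cos (L x))) * indicator (E p) (x p) \<partial>\<mu>) =
        (\<integral>x. (I K E x * (1 + c * cos (L x))) * indicator (E p) (x p) \<partial>\<nu>)" if "c \<in> {0,1}" for c
    proof (rule cos_marginal_density_eq[where B = 2])
      show "0 \<le> I K E x * (1 + c * cos (L x))" "I K E x * (1 + c * cos (L x)) \<le> 2" for x
      proof -
        have b: "0 \<le> 1 + c * cos (L x)" "1 + c * cos (L x) \<le> 2"
          using that cos_ge_minus_one[of "L x"] cos_le_one[of "L x"]
          by (elim insertE emptyE; hypsubst; linarith)+
        show "0 \<le> I K E x * (1 + c * cos (L x))" using b I01 by simp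
        show "I K E x * (1 + c * cos (L x)) \<le> 2" using mult_mono[OF I01(2) b(2)] b I01 by simp
      qed
      fix t \<theta>'
      have e: "I K E x * (1 + c * cos (L x)) * cos (\<theta>' + t * x p) = I K E x * cos (\<theta>' + 0 * L x + t * x p)
          + c/2 * (I K E x * cos (\<theta>' + 1 * L x + t * x p)) + c/2 * (I K E x * cos (- \<theta>' + 1 * L x + (- t) * x p))" for x
      proof -
        have "I K E x * (1 + c * cos (L x)) * cos (\<theta>' + t * x p)
            = I K E x * cos (\<theta>' + t * x p) + c * I K E x * (cos (L x) * cos (\<theta>' + t * x p))"
          by (simp add: algebra_simps)
        also have "cos (L x) * cos (\<theta>' + t * x p) = (cos (\<theta>' + 1 * L x + t * x p) + cos (- \<theta>' + 1 * L x + (- t) * x p)) / 2"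
          by (subst cos_product_sum) (simp add: algebra_simps)
        finally show ?thesis by (simp add: field_simps)
      qed
      show "(\<integral>x. I K E x * (1 + c * cos (L x)) * cos (\<theta>' + t * x p) \<partial>\<mu>) = (\<integral>x. I K E x * (1 + c * cos (L x)) * cos (\<theta>' + t * x p) \<partial>\<nu>)"
        unfolding e using IH[of \<theta>' 0 t] IH[of \<theta>' 1 t] IH[of "- \<theta>'" 1 "- t"] by simp
    qed (use E in \<open>auto intro: \<mu>.finite_measure_axioms \<nu>.finite_measure_axioms\<close>)
    have i2 [simp]: "integrable \<mu> (\<lambda>x. I K E x * (1 + c * cos (L x)) * indicator (E p) (x p))"
       "integrable \<nu> (\<lambda>x. I K E x * (1 + c * cos (L x)) * indicator (E p) (x p))" for c
    proof -
      have [simp]: "integrable \<mu> (I K E)" "integrable \<nu> (I K E)" using int[of "\<lambda>_. 0"] by auto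
      have "integrable \<mu> (\<lambda>x. I K E x * (1 + c * cos (L x)))" "integrable \<nu> (\<lambda>x. I K E x * (1 + c * cos (L x)))"
        using int[of L] by (simp_all add: distrib_left mult.left_commute[of _ c])
      then show "integrable \<mu> (\<lambda>x. I K E x * (1 + c * cos (L x)) * indicator (E p) (x p))"
       "integrable \<nu> (\<lambda>x. I K E x * (1 + c * cos (L x)) * indicator (E p) (x p))"
        by (auto intro!: integrable_mult_indicator[where A = "(\<lambda>x. x p) -` E p", simplified indicator_vimage, simplified, unfolded scaleR_conv_of_real] Bochner_Integration.integrable_bound[of \<mu> "\<lambda>x. I K E x * (1 + c * cos (L x))"] Bochner_Integration.integrable_bound[of \<nu> "\<lambda>x. I K E x * (1 + c * cos (L x))"] simp: indicator_def)
    qed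
    have r: "I (insert p K) E x * cos (L x) = (I K E x * (1 + 1 * cos (L x))) * indicator (E p) (x p) - (I K E x * (1 + 0 * cos (L x))) * indicator (E p) (x p)" for x
      using insert.hyps by (simp add: I_def algebra_simps)
    show ?case unfolding L_def[symmetric] r
      using step[of 0] step[of 1] i2[of 1] i2[of 0] by (simp del: mult_1 mult_zero_left)
  qed
  show ?thesis
  proof (rule measure_eqI_PiM_infinite[where I = UNIV and M = "\<lambda>_. borel"])
    fix A and J :: "'i set"
    assume J: "finite J" and A: "\<And>i. i \<in> J \<Longrightarrow> A i \<in> sets (borel :: real measure)"
    define E where "E i = (if i \<in> J then A i else {})" for i
    have E[measurable]: "E i \<in> sets borel" for i using A by (simp add: E_def)
    define C where "C = prod_emb UNIV (\<lambda>_. borel) J (Pi\<^sub>E J A)"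
    have "C \<in> sets (Pi\<^sub>M UNIV (\<lambda>_. borel))" unfolding C_def using J A by (intro sets_PiM_I) auto
    then have [measurable]: "C \<in> sets borel" using sets_PiM_equal_borel by blast
    have IC: "I J E x = indicator C x" for x
      using J by (auto simp: I_def C_def prod_emb_def E_def indicator_def PiE_iff)
    have "measure \<mu> C = measure \<nu> C"
      using main[OF J, of "{}" E 0] E by (simp add: IC)
    then show "emeasure \<mu> (prod_emb UNIV (\<lambda>_. borel) J (Pi\<^sub>E J A)) = emeasure \<nu> (prod_emb UNIV (\<lambda>_. borel) J (Pi\<^sub>E J A))"
      by (simp add: \<mu>.emeasure_eq_measure \<nu>.emeasure_eq_measure C_def)
  qed (auto simp: sets_PiM_equal_borel intro: \<mu>.finite_measure_axioms)
qed

text \<open>The characteristic function of the first \<open>n\<close> rows in real form: letting the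
  phase \<open>\<theta>\<close> vary recovers both its real and its imaginary part.\<close>

definition cf :: "'m::finite imat measure \<Rightarrow> real \<Rightarrow> nat \<Rightarrow> 'm imat \<Rightarrow> real" where
  "cf \<mu> \<theta> n T = (\<integral>X. cos (\<theta> + (\<Sum>i<n. T i \<bullet> X i)) \<partial>\<mu>)"

text \<open>A matrix is read as a family of reals indexed by pairs, and \<open>\<phi>\<close>,
  \<open>\<psi>\<close> are the mutually inverse conversions; a linear form in finitely many entries
  involves finitely many rows.\<close>

lemma cf_eqI:
  fixes \<mu> \<nu> :: "'m::finite imat measure"
  assumes "\<mu> \<in> borel_probs" "\<nu> \<in> borel_probs" and eq: "\<And>\<theta> n T. cf \<mu> \<theta> n T = cf \<nu> \<theta> n T"
  shows "\<mu> = \<nu>"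
proof -
  define \<phi> where "\<phi> X = (\<lambda>(i, j). X i $ j)" for X :: "'m imat"
  define \<psi> :: "_ \<Rightarrow> 'm imat" where "\<psi> x = (\<lambda>i. \<chi> j. x (i, j))" for x
  have [measurable]: "\<phi> \<in> borel_measurable borel" "\<psi> \<in> borel_measurable borel"
    unfolding \<phi>_def \<psi>_def
    by (auto intro!: measurable_coordinatewise_then_product borel_measurable_continuous_onI continuous_intros
        simp: case_prod_beta)
  have K: "K = distr (distr K borel \<phi>) borel \<psi> \<and> prob_space (distr K borel \<phi>) \<and>
     (\<integral>x. cos (\<theta> + (\<Sum>i\<in>J. T i * x i)) \<partial>distr K borel \<phi>) = cf K \<theta> (Suc (Max (fst ` J))) (\<lambda>i. \<chi> j. if (i,j) \<in> J then T (i,j) else 0)"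
    if "K \<in> borel_probs" "finite J" for K :: "'m imat measure" and J T \<theta>
  proof -
    from that interpret K: prob_space K by (simp add: borel_probs_def)
    have [measurable_cong, simp]: "sets K = sets borel" using that by (simp add: borel_probs_def)
    have "distr (distr K borel \<phi>) borel \<psi> = K"
      by (subst distr_distr) (auto simp: comp_def \<phi>_def \<psi>_def intro!: distr_id2)
    moreover have [measurable]: "(\<lambda>x. \<Sum>i\<in>J. T i * x i) \<in> borel_measurable (borel :: (nat \<times> 'm \<Rightarrow> real) measure)"
      by (intro borel_measurable_sum borel_measurable_times measurable_product_coordinates) auto
    have "(\<integral>x. cos (\<theta> + (\<Sum>i\<in>J. T i * x i)) \<partial>distr K borel \<phi>) = cf K \<theta> (Suc (Max (fst ` J))) (\<lambda>i. \<chi> j. if (i,j) \<in> J then T (i,j) else 0)"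
    proof -
      \<comment> \<open>For \<open>J = {}\<close> the maximum is an unspecified number, but then all
        rows of the frequency matrix vanish and both sides are 0.\<close>
      have "(\<Sum>i\<in>J. T i * \<phi> X i) = (\<Sum>i<Suc (Max (fst ` J)). (\<chi> j. if (i,j) \<in> J then T (i,j) else 0) \<bullet> X i)" for X
      proof -
        have sub: "J \<subseteq> {..<Suc (Max (fst ` J))} \<times> UNIV"
          using \<open>finite J\<close> by (force simp: less_Suc_eq_le intro!: Max_ge)
        have "(\<Sum>i\<in>J. T i * \<phi> X i) = (\<Sum>i\<in>{..<Suc (Max (fst ` J))} \<times> UNIV. if i \<in> J then T i * \<phi> X i else 0)"
          using sub by (intro sum.mono_neutral_cong_left) auto
        also have "\<dots> = (\<Sum>i<Suc (Max (fst ` J)). \<Sum>j\<in>UNIV. if (i,j) \<in> J then T (i,j) * X i $ j else 0)"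
          by (auto simp: sum.cartesian_product \<phi>_def case_prod_beta intro!: sum.cong)
        finally show ?thesis by (simp add: inner_vec_def if_distrib[of "\<lambda>x. x * _"] cong: if_cong)
      qed
      then show ?thesis by (simp add: integral_distr cf_def)
    qed
    ultimately show ?thesis using K.prob_space_distr[of \<phi> borel] by simp
  qed
  note K1 = K[OF assms(1)] and K2 = K[OF assms(2)]
  have "prob_space (distr \<mu> borel \<phi>)" "prob_space (distr \<nu> borel \<phi>)"
    using K1[OF finite.emptyI] K2[OF finite.emptyI] by blast+
  then have "distr \<mu> borel \<phi> = distr \<nu> borel \<phi>"
    by (rule cos_transform_eqI) (use K1 K2 eq in auto)
  then show ?thesis using K1[OF finite.emptyI] K2[OF finite.emptyI] by metis
qed

section \<open>Gaussian vectors\<close>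

text \<open>The index type is left free: pairs give the matrix \<open>G\<close> in the definition of
  \<open>mu\<close>, natural numbers give the auxiliary Gaussians of the randomisation.\<close>

definition gauss :: "('i \<Rightarrow> real) measure" where
  "gauss = PiM UNIV (\<lambda>_. std_normal_distribution)"

lemma prob_space_std_normal: "prob_space std_normal_distribution"
  by (intro prob_space_normal_density) simp

lemma sets_gauss: "sets gauss = sets (PiM UNIV (\<lambda>_. borel))"
  unfolding gauss_def by (intro sets_PiM_cong) auto

lemma space_gauss [simp]: "space gauss = UNIV"
  by (simp add: gauss_def space_PiM)

lemma prob_space_gauss: "prob_space gauss"
  unfolding gauss_def by (intro prob_space_PiM prob_space_std_normal)

interpretation gauss: prob_space gauss by (rule prob_space_gauss)

lemma gauss_component_measurable [measurable]: "(\<lambda>g. g i) \<in> borel_measurable gauss"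
  unfolding measurable_cong_sets[OF sets_gauss refl] by measurable

lemma distr_gauss_component: "distr gauss borel (\<lambda>g. g i) = std_normal_distribution"
proof -
  have "distr gauss borel (\<lambda>g. g i) = distr gauss std_normal_distribution (\<lambda>g. g i)"
    by (intro distr_cong) auto
  also have "\<dots> = std_normal_distribution"
    unfolding gauss_def by (intro distr_PiM_component prob_space_std_normal) auto
  finally show ?thesis .
qed

lemma indep_vars_gauss: "gauss.indep_vars (\<lambda>_. borel) (\<lambda>i g. g i) UNIV"
proof -
  have "distr gauss (PiM UNIV (\<lambda>_. borel)) (\<lambda>g. \<lambda>i\<in>UNIV. g i) = gauss"
    by (simp add: restrict_def distr_id2 sets_gauss)
  then show ?thesis
    by (subst gauss.indep_vars_iff_distr_eq_PiM)
       (auto simp: distr_gauss_component, simp add: gauss_def)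
qed

text \<open>The characteristic function of an independent sum factorises and is real, so the sine
  part integrates to 0. The identity is used both ways: to write exponentials of squares as averaged
  cosines, and to compute \<open>cf (mu s)\<close>.\<close>

lemma gauss_cos:
  assumes "finite J"
  shows "(\<integral>g. cos (\<theta> + (\<Sum>i\<in>J. y i * g i)) \<partial>gauss) = cos \<theta> * exp (- (\<Sum>i\<in>J. (y i)\<^sup>2) / 2)"
proof -
  define S where "S g = (\<Sum>i\<in>J. y i * g i)" for g
  have S [measurable]: "S \<in> borel_measurable gauss" unfolding S_def by measurable
  have factor: "char (distr gauss borel (\<lambda>g. y i * g i)) 1 = complex_of_real (exp (- (y i)\<^sup>2 / 2))" for i
  proof -
    have "char (distr gauss borel (\<lambda>g. y i * g i)) 1 = (CLINT g|gauss. iexp (y i * g i))"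
      by (simp add: char_def integral_distr)
    also have "\<dots> = char (distr gauss borel (\<lambda>g. g i)) (y i)"
      by (simp add: char_def integral_distr)
    finally show ?thesis by (simp add: distr_gauss_component char_std_normal_distribution)
  qed
  have "gauss.indep_vars (\<lambda>_. borel) (\<lambda>i g. y i * g i) J"
    using gauss.indep_vars_compose2[OF gauss.indep_vars_subset[OF indep_vars_gauss subset_UNIV[of J]], of "\<lambda>i x. y i * x" "\<lambda>_. borel"]
    by simp
  from gauss.char_distr_sum[OF this, of 1]
  have "char (distr gauss borel S) 1 = (\<Prod>i\<in>J. char (distr gauss borel (\<lambda>g. y i * g i)) 1)"
    by (simp add: S_def[abs_def])
  also have "\<dots> = (\<Prod>i\<in>J. complex_of_real (exp (- (y i)\<^sup>2 / 2)))"
    by (simp only: factor)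
  also have "\<dots> = complex_of_real (exp (- (\<Sum>i\<in>J. (y i)\<^sup>2) / 2))"
    using assms by (simp add: exp_sum[symmetric] sum_negf sum_divide_distrib flip: of_real_prod)
  finally have c: "(CLINT g|gauss. iexp (S g)) = complex_of_real (exp (- (\<Sum>i\<in>J. (y i)\<^sup>2) / 2))"
    by (simp add: char_def integral_distr)
  have i: "integrable gauss (\<lambda>g. iexp (S g))"
    by (intro gauss.integrable_const_bound[where B=1]) auto
  have "(\<integral>g. cos (S g) \<partial>gauss) = exp (- (\<Sum>i\<in>J. (y i)\<^sup>2) / 2)" "(\<integral>g. sin (S g) \<partial>gauss) = 0"
    using integral_Re[OF i] integral_Im[OF i] unfolding c by (simp_all add: Re_exp Im_exp)
  moreover have "integrable gauss (\<lambda>g. cos (S g))" "integrable gauss (\<lambda>g. sin (S g))"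
    by (auto intro!: gauss.integrable_const_bound[where B=1])
  ultimately show ?thesis unfolding S_def[symmetric] by (simp add: cos_add)
qed

lemma gauss_moments:
  shows "integrable gauss (\<lambda>g. (g i) ^ k)"
    and "(\<integral>g. (g i)^2 \<partial>gauss) = 1" "(\<integral>g. (g i)^4 \<partial>gauss) = 3"
proof -
  have "integrable std_normal_distribution (\<lambda>x. x ^ k)" for k
    using integrable_std_normal_moment[of k] by (subst integrable_density) auto
  then show i: "integrable gauss (\<lambda>g. (g i) ^ k)" for k
    using integrable_distr_eq[of "\<lambda>g. g i" gauss borel "\<lambda>x. x ^ k"] by (simp add: distr_gauss_component)
  have e: "(\<integral>g. (g i) ^ (2*k) \<partial>gauss) = fact (2 * k) / (2^k * fact k)" for k
    using integral_distr[of "\<lambda>g. g i" gauss borel "\<lambda>x. x ^ (2*k)"] integral_std_normal_moment_even[of k]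
    by (simp add: distr_gauss_component integral_density)
  show "(\<integral>g. (g i)^2 \<partial>gauss) = 1" "(\<integral>g. (g i)^4 \<partial>gauss) = 3"
    using e[of 1] e[of 2] by (simp_all add: fact_numeral)
qed

text \<open>The centred squares are orthogonal with variance 3 - 1 = 2, so the second moment is
  twice the sum of the squared weights, which is at most 2 \<delta> times their sum.\<close>

lemma gauss_chi_square:
  assumes J: "finite J" and w: "\<And>j. j \<in> J \<Longrightarrow> 0 \<le> w j \<and> w j \<le> \<delta>" and W: "(\<Sum>j\<in>J. w j) = 1"
  shows "integrable gauss (\<lambda>g. ((\<Sum>j\<in>J. w j * (g j)\<^sup>2) - 1)\<^sup>2)"
    and "(\<integral>g. ((\<Sum>j\<in>J. w j * (g j)\<^sup>2) - 1)\<^sup>2 \<partial>gauss) \<le> 2 * \<delta>"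
proof -
  define z where "z j g = (g j)\<^sup>2 - 1" for j and g :: "'a \<Rightarrow> real"
  have zi: "integrable gauss (z j)" for j
    unfolding z_def by (simp add: gauss_moments)
  have z0: "(\<integral>g. z j g \<partial>gauss) = 0" for j
    unfolding z_def by (simp add: gauss_moments gauss.prob_space[unfolded space_gauss])
  have zz: "integrable gauss (\<lambda>g. z j g * z k g) \<and> (\<integral>g. z j g * z k g \<partial>gauss) = (if j = k then 2 else 0)" for j k
  proof (cases "j = k")
    case True
    have "z j g * z j g = (g j)^4 - 2 * (g j)^2 + 1" for g
      by (simp add: z_def power2_eq_square algebra_simps numeral_eq_Suc)
    then show ?thesis
      using True by (simp add: gauss_moments gauss.prob_space[unfolded space_gauss])
  next
    case False
    have "gauss.indep_vars (\<lambda>_. borel) z UNIV"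
      using gauss.indep_vars_compose2[OF indep_vars_gauss, of "\<lambda>i x. x\<^sup>2 - 1" "\<lambda>_. borel"]
      by (simp add: z_def[abs_def])
    from gauss.indep_vars_subset[OF this, of "{j,k}"]
    have "gauss.indep_vars (\<lambda>_. borel) z {j,k}" by simp
    from gauss.indep_vars_lebesgue_integral[OF _ this] gauss.indep_vars_integrable[OF _ this]
    show ?thesis using False zi z0 by simp
  qed
  have e: "((\<Sum>j\<in>J. w j * (g j)\<^sup>2) - 1)\<^sup>2 = (\<Sum>j\<in>J. \<Sum>k\<in>J. w j * w k * (z j g * z k g))" for g
  proof -
    have "(\<Sum>j\<in>J. w j * (g j)\<^sup>2) - 1 = (\<Sum>j\<in>J. w j * z j g)"
      by (simp add: z_def right_diff_distrib sum_subtractf W)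
    then show ?thesis by (simp add: power2_eq_square sum_product mult_ac)
  qed
  show "integrable gauss (\<lambda>g. ((\<Sum>j\<in>J. w j * (g j)\<^sup>2) - 1)\<^sup>2)"
    unfolding e using zz by (intro Bochner_Integration.integrable_sum integrable_mult_right) auto
  have "(\<integral>g. ((\<Sum>j\<in>J. w j * (g j)\<^sup>2) - 1)\<^sup>2 \<partial>gauss) = (\<Sum>j\<in>J. \<Sum>k\<in>J. w j * w k * (if j = k then 2 else 0))"
    unfolding e using zz
    by (subst Bochner_Integration.integral_sum, simp) (subst Bochner_Integration.integral_sum, simp_all)
  also have "\<dots> = (\<Sum>j\<in>J. 2 * (w j * w j))"
    using J by (simp add: if_distrib sum.delta mult_ac cong: if_cong)
  also have "\<dots> \<le> (\<Sum>j\<in>J. 2 * (w j * \<delta>))"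
    using w by (intro sum_mono) (simp add: mult_left_mono)
  also have "\<dots> = 2 * \<delta>" by (simp add: W sum_distrib_left[symmetric] sum_distrib_right[symmetric])
  finally show "(\<integral>g. ((\<Sum>j\<in>J. w j * (g j)\<^sup>2) - 1)\<^sup>2 \<partial>gauss) \<le> 2 * \<delta>" .
qed

section \<open>Reflections and Gram matrices\<close>

lemma matrix_inv_O_fin:
  fixes v :: "real^'m::finite^'m"
  assumes "v \<in> O_fin" shows "matrix_inv v = transpose v"
proof -
  have 1: "v ** transpose v = mat 1" "transpose v ** v = mat 1" using assms by (auto simp: O_fin_iff)
  have "v ** matrix_inv v = mat 1 \<and> matrix_inv v ** v = mat 1"
    unfolding matrix_inv_def by (rule someI[of _ "transpose v"]) (use 1 in simp)
  then show ?thesis using 1 by (metis matrix_mul_assoc matrix_mul_lid matrix_mul_rid)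
qed

lemma act_eq:
  assumes "v \<in> O_fin"
  shows "act u v X = (\<lambda>i. v *v (\<Sum>k | u i k \<noteq> 0. u i k *\<^sub>R X k))"
  by (simp add: act_def matrix_inv_O_fin[OF assms])

lemma act_measurable [measurable]: "act u v \<in> borel_measurable borel"
  unfolding act_def
proof (intro measurable_coordinatewise_then_product)
  fix i
  have "continuous_on UNIV (\<lambda>x::real^'a. x v* matrix_inv v)"
    unfolding vector_matrix_mult_def by (intro continuous_intros)
  then show "(\<lambda>X. (\<Sum>k | u i k \<noteq> 0. u i k *\<^sub>R X k) v* matrix_inv v) \<in> borel_measurable borel"
    by (intro borel_measurable_continuous_on[where f = "\<lambda>x. x v* matrix_inv v"] borel_measurable_sum
       borel_measurable_scaleR borel_measurable_const measurable_product_coordinates)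
qed

definition id_mat :: "nat \<Rightarrow> nat \<Rightarrow> real" where
  "id_mat i j = (if i = j then 1 else 0)"

lemma id_mat_row: "{k. id_mat i k \<noteq> 0} = {i}" "{k. id_mat k i \<noteq> 0} = {i}"
  by (auto simp: id_mat_def)

lemma id_mat_O_inf: "id_mat \<in> O_inf"
  unfolding O_inf_def by (auto simp: id_mat_row) (auto simp: id_mat_def)

lemma act_id_mat: "v \<in> O_fin \<Longrightarrow> act id_mat v X = (\<lambda>i. v *v X i)"
  by (simp add: act_eq id_mat_row) (simp add: id_mat_def)

text \<open>The Householder reflection in the hyperplane orthogonal to \<open>w\<close>, acting on
  the first \<open>n\<close> coordinates and extended by the identity.\<close>

definition reflect_mat :: "nat \<Rightarrow> (nat \<Rightarrow> real) \<Rightarrow> nat \<Rightarrow> nat \<Rightarrow> real" where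
  "reflect_mat n w i j = id_mat i j -
     (if i < n \<and> j < n then 2 * w i * w j / (\<Sum>k<n. (w k)\<^sup>2) else 0)"

lemma reflect_mat_row:
  fixes f :: "nat \<Rightarrow> 'a::real_vector"
  assumes "i < N" "n \<le> N"
  shows "(\<Sum>k | reflect_mat n w i k \<noteq> 0. reflect_mat n w i k *\<^sub>R f k) = (\<Sum>k<N. reflect_mat n w i k *\<^sub>R f k)"
  using assms by (intro sum.mono_neutral_left) (auto simp: reflect_mat_def id_mat_def split: if_splits)

lemma reflect_mat_sym: "reflect_mat n w i j = reflect_mat n w j i"
  by (simp add: reflect_mat_def id_mat_def mult_ac)

lemma reflect_mat_apply:
  fixes f :: "nat \<Rightarrow> 'a::real_vector"
  assumes "i < N" "n \<le> N"
  shows "(\<Sum>k<N. reflect_mat n w i k *\<^sub>R f k) =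
    f i - (if i < n then (2 * w i / (\<Sum>k<n. (w k)\<^sup>2)) *\<^sub>R (\<Sum>k<n. w k *\<^sub>R f k) else 0)"
proof -
  have "(\<Sum>k<N. reflect_mat n w i k *\<^sub>R f k) = (\<Sum>k<N. id_mat i k *\<^sub>R f k) -
      (\<Sum>k<N. (if i < n \<and> k < n then 2 * w i * w k / (\<Sum>k<n. (w k)\<^sup>2) else 0) *\<^sub>R f k)"
    by (simp add: reflect_mat_def scaleR_diff_left sum_subtractf)
  also have "(\<Sum>k<N. id_mat i k *\<^sub>R f k) = f i"
    using assms by (simp add: id_mat_def if_distrib[of "\<lambda>x. x *\<^sub>R _"] cong: if_cong)
  also have "(\<Sum>k<N. (if i < n \<and> k < n then 2 * w i * w k / (\<Sum>k<n. (w k)\<^sup>2) else 0) *\<^sub>R f k) =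
      (\<Sum>k<n. (if i < n then 2 * w i * w k / (\<Sum>k<n. (w k)\<^sup>2) else 0) *\<^sub>R f k)"
    using assms by (intro sum.mono_neutral_cong_right) auto
  also have "\<dots> = (if i < n then (2 * w i / (\<Sum>k<n. (w k)\<^sup>2)) *\<^sub>R (\<Sum>k<n. w k *\<^sub>R f k) else 0)"
    by (simp add: scaleR_right.sum)
  finally show ?thesis .
qed

lemma reflect_mat_O_inf:
  assumes q: "(\<Sum>k<n. (w k)\<^sup>2) \<noteq> 0"
  shows "reflect_mat n w \<in> O_inf"
proof -
  define q where "q = (\<Sum>k<n. (w k)\<^sup>2)"
  have orth: "(\<Sum>k | reflect_mat n w i k \<noteq> 0. reflect_mat n w i k * reflect_mat n w j k) = (if i = j then 1 else 0)" for i j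
  proof -
    define N where "N = Suc (max n (max i j))"
    have N: "i < N" "j < N" "n \<le> N" by (auto simp: N_def)
    \<comment> \<open>The reflection sends \<open>w\<close> to its negative.\<close>
    have s: "(\<Sum>k<n. w k * reflect_mat n w j k) = (if j < n then - w j else 0)"
    proof -
      have "(\<Sum>k<n. w k * reflect_mat n w j k) = (\<Sum>k<N. reflect_mat n w j k *\<^sub>R (if k < n then w k else 0))"
        using N by (intro sum.mono_neutral_cong_left) auto
      also have "\<dots> = (if j < n then w j else 0) - (if j < n then 2 * w j / q * (\<Sum>k<n. w k * w k) else 0)"
        using N by (subst reflect_mat_apply) (auto simp: q_def)
      also have "\<dots> = (if j < n then - w j else 0)"
        using q by (simp add: q_def power2_eq_square)
      finally show ?thesis .
    qed
    have "(\<Sum>k | reflect_mat n w i k \<noteq> 0. reflect_mat n w i k * reflect_mat n w j k) =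
       (\<Sum>k<N. reflect_mat n w i k *\<^sub>R reflect_mat n w j k)"
      using reflect_mat_row[OF N(1,3), of w "reflect_mat n w j"] by simp
    also have "\<dots> = (if i = j then 1 else 0)"
      using N by (subst reflect_mat_apply) (auto simp: s, auto simp: reflect_mat_def id_mat_def)
    finally show ?thesis .
  qed
  \<comment> \<open>Indices with sum at least \<open>2 * n\<close> cannot both lie below
    \<open>n\<close>, where the reflected block is.\<close>
  have "\<forall>i j. 2 * n \<le> i + j \<longrightarrow> reflect_mat n w i j = (if i = j then 1 else 0)"
    by (auto simp: reflect_mat_def id_mat_def)
  moreover have "(\<Sum>k | reflect_mat n w k i \<noteq> 0. reflect_mat n w k i * reflect_mat n w k j) =
      (\<Sum>k | reflect_mat n w i k \<noteq> 0. reflect_mat n w i k * reflect_mat n w j k)" for i j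
    by (intro sum.cong Collect_cong) (metis reflect_mat_sym)+
  ultimately show ?thesis
    unfolding O_inf_def mem_Collect_eq using orth by (intro conjI exI[of _ "2 * n"]) simp_all
qed

section \<open>Characteristic functions of invariant measures\<close>

lemma P_inv_probs: "\<mu> \<in> P_inv \<Longrightarrow> \<mu> \<in> borel_probs"
  by (simp add: P_inv_def)

lemma P_inv_prob_space: "\<mu> \<in> P_inv \<Longrightarrow> prob_space \<mu>"
  and P_inv_sets: "\<mu> \<in> P_inv \<Longrightarrow> sets \<mu> = sets borel"
  by (simp_all add: P_inv_def borel_probs_def)

lemma P_inv_integral:
  fixes f :: "'m::finite imat \<Rightarrow> real"
  assumes "\<mu> \<in> P_inv" "u \<in> O_inf" "v \<in> O_fin" and [measurable]: "f \<in> borel_measurable borel"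
  shows "(\<integral>X. f (act u v X) \<partial>\<mu>) = (\<integral>X. f X \<partial>\<mu>)"
proof -
  note [measurable_cong] = P_inv_sets[OF assms(1)]
  have "(\<integral>X. f X \<partial>\<mu>) = (\<integral>X. f X \<partial>distr \<mu> borel (act u v))"
    using assms by (simp add: P_inv_def)
  then show ?thesis by (simp add: integral_distr)
qed

text \<open>A reflection is self-adjoint, so applying it to the rows of \<open>X\<close> has the
  same effect on the linear form as applying it to the rows of \<open>T\<close>.\<close>

lemma cf_reflect:
  assumes \<mu>: "\<mu> \<in> P_inv" and q: "(\<Sum>k<n. (w k)\<^sup>2) \<noteq> 0"
  shows "cf \<mu> \<theta> n (\<lambda>i. T i - (2 * w i / (\<Sum>k<n. (w k)\<^sup>2)) *\<^sub>R (\<Sum>k<n. w k *\<^sub>R T k)) = cf \<mu> \<theta> n T"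
proof -
  define q where "q = (\<Sum>k<n. (w k)\<^sup>2)"
  have row: "act (reflect_mat n w) (mat 1) X i = X i - (2 * w i / q) *\<^sub>R (\<Sum>k<n. w k *\<^sub>R X k)" if "i < n" for X i
    using that by (simp add: act_eq reflect_mat_row[of i n] reflect_mat_apply q_def)
  have "(\<Sum>i<n. T i \<bullet> act (reflect_mat n w) (mat 1) X i) = (\<Sum>i<n. T i \<bullet> X i) - 2 / q * (\<Sum>i<n. w i * (T i \<bullet> (\<Sum>k<n. w k *\<^sub>R X k)))" for X
    by (simp add: row inner_diff_right sum_subtractf sum_distrib_left mult.assoc)
  moreover have "(\<Sum>i<n. (T i - (2 * w i / q) *\<^sub>R (\<Sum>k<n. w k *\<^sub>R T k)) \<bullet> X i) = (\<Sum>i<n. T i \<bullet> X i) - 2 / q * (\<Sum>i<n. w i * ((\<Sum>k<n. w k *\<^sub>R T k) \<bullet> X i))" for X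
    by (simp add: inner_diff_left sum_subtractf sum_distrib_left mult.assoc)
  moreover have "(\<Sum>i<n. w i * (T i \<bullet> (\<Sum>k<n. w k *\<^sub>R X k))) = (\<Sum>i<n. w i * ((\<Sum>k<n. w k *\<^sub>R T k) \<bullet> X i))" for X
    unfolding inner_sum_left inner_sum_right sum_distrib_left
    by (subst sum.swap) (simp add: mult_ac)
  ultimately have "(\<Sum>i<n. (T i - (2 * w i / q) *\<^sub>R (\<Sum>k<n. w k *\<^sub>R T k)) \<bullet> X i) = (\<Sum>i<n. T i \<bullet> act (reflect_mat n w) (mat 1) X i)" for X
    by simp
  then show ?thesis unfolding q_def[symmetric] cf_def
    using P_inv_integral[OF \<mu> reflect_mat_O_inf[OF q] O_fin_id, of "\<lambda>X. cos (\<theta> + (\<Sum>i<n. T i \<bullet> X i))"]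
    by simp
qed

lemma cf_rotate:
  assumes \<mu>: "\<mu> \<in> P_inv" and v: "v \<in> O_fin"
  shows "cf \<mu> \<theta> n (\<lambda>i. v *v T i) = cf \<mu> \<theta> n T"
proof -
  have "(v *v x) \<bullet> y = x \<bullet> (transpose v *v y)" for x y
    by (metis dot_lmul_matrix transpose_matrix_vector inner_commute)
  then show ?thesis unfolding cf_def
    using P_inv_integral[OF \<mu> id_mat_O_inf, of "transpose v" "\<lambda>X. cos (\<theta> + (\<Sum>i<n. T i \<bullet> X i))"] v
    by (simp add: act_id_mat)
qed

text \<open>Since -1 is in O(m), \<open>T\<close> and - \<open>T\<close> give the same value, and
  averaging the two cancels the sine term. From here on phase 0 carries all the information.\<close>

lemma P_inv_cf_phase:
  assumes \<mu>: "\<mu> \<in> P_inv" shows "cf \<mu> \<theta> n T = cos \<theta> * cf \<mu> 0 n T"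
proof -
  interpret prob_space \<mu> using \<mu> by (rule P_inv_prob_space)
  note [measurable_cong] = P_inv_sets[OF \<mu>]
  have m: "(-1) *\<^sub>R mat 1 \<in> (O_fin :: (real^'a^'a) set)"
    by (simp only: O_fin_iff transpose_scalar matrix_scaleR_mult transpose_mat) simp
  have "cf \<mu> \<theta> n (\<lambda>i. - T i) = cf \<mu> \<theta> n T"
    using cf_rotate[OF \<mu> m, of \<theta> n T] by (simp only: scaleR_matrix_vector_assoc[symmetric] matrix_vector_mul_lid) simp
  moreover have "integrable \<mu> (\<lambda>X. cos (\<theta> + (\<Sum>i<n. S i \<bullet> X i)))" for S
    by (intro integrable_const_bound[where B=1]) auto
  from Bochner_Integration.integral_add[OF this[of T] this[of "\<lambda>i. - T i"]]
  have "cf \<mu> \<theta> n T + cf \<mu> \<theta> n (\<lambda>i. - T i) = (\<integral>X. 2 * cos \<theta> * cos (\<Sum>i<n. T i \<bullet> X i) \<partial>\<mu>)"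
    by (simp add: cf_def sum_negf cos_add cos_diff)
  ultimately show ?thesis by (simp add: cf_def)
qed

lemma cf_extend:
  assumes "n \<le> N" shows "cf \<mu> \<theta> N (\<lambda>i. if i < n then T i else 0) = cf \<mu> \<theta> n T"
proof -
  have "(\<Sum>i<N. (if i < n then T i else 0) \<bullet> X i) = (\<Sum>i<n. T i \<bullet> X i)" for X
    using assms by (intro sum.mono_neutral_cong_right) auto
  then show ?thesis by (simp add: cf_def)
qed

definition gram :: "nat \<Rightarrow> 'm::finite imat \<Rightarrow> 'm \<Rightarrow> 'm \<Rightarrow> real" where
  "gram n T a b = (\<Sum>i<n. T i $ a * T i $ b)"

text \<open>
  Reflecting in the difference of two columns of equal norm carries one to the other and fixes the
  columns having equal inner products with both; so the columns of \<open>T\<close> are matched one by one.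
\<close>

lemma cf_gram:
  fixes T T' :: "'m::finite imat"
  assumes \<mu>: "\<mu> \<in> P_inv" and g: "gram n T = gram n T'"
  shows "cf \<mu> \<theta> n T = cf \<mu> \<theta> n T'"
proof -
  have "\<exists>S. cf \<mu> \<theta> n S = cf \<mu> \<theta> n T \<and> gram n S = gram n T' \<and> (\<forall>i<n. \<forall>a\<in>A. S i $ a = T' i $ a)" for A
    using finite[of A]
  proof (induction A rule: finite_induct)
    case empty
    then show ?case using g by auto
  next
    case (insert b A)
    then obtain S where S: "cf \<mu> \<theta> n S = cf \<mu> \<theta> n T" "gram n S = gram n T'" "\<And>i a. i < n \<Longrightarrow> a \<in> A \<Longrightarrow> S i $ a = T' i $ a"
      by blast
    define w where "w i = S i $ b - T' i $ b" for i
    define q where "q = (\<Sum>k<n. (w k)\<^sup>2)"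
    show ?case
    proof (cases "q = 0")
      case True
      then have "w i = 0" if "i < n" for i using that by (simp add: q_def sum_nonneg_eq_0_iff)
      then show ?thesis using S by (intro exI[of _ S]) (auto simp: w_def)
    next
      case False
      define p where "p a = (\<Sum>k<n. w k * S k $ a)" for a
      define R where "R i = S i - (2 * w i / q) *\<^sub>R (\<Sum>k<n. w k *\<^sub>R S k)" for i
      have R: "R i $ a = S i $ a - 2 * w i / q * p a" for i a
        by (simp add: R_def p_def)
      have "gram n R a c = gram n S a c" for a c
      proof -
        have "gram n R a c = (\<Sum>i<n. S i $ a * S i $ c - 2 * p c / q * (w i * S i $ a) - 2 * p a / q * (w i * S i $ c) + 4 * p a * p c / q\<^sup>2 * (w i)\<^sup>2)"
          unfolding gram_def R by (intro sum.cong refl) (simp add: algebra_simps power2_eq_square)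
        also have "\<dots> = gram n S a c - 2 * p c / q * p a - 2 * p a / q * p c + 4 * p a * p c / q\<^sup>2 * q"
          by (simp add: sum.distrib sum_subtractf gram_def p_def q_def sum_distrib_left)
        also have "\<dots> = gram n S a c" using False by (simp add: field_simps power2_eq_square)
        finally show ?thesis .
      qed
      moreover have "cf \<mu> \<theta> n R = cf \<mu> \<theta> n S"
        using cf_reflect[OF \<mu>, of w n \<theta> S] False by (simp add: R_def[abs_def] q_def)
      moreover have "R i $ a = T' i $ a" if i: "i < n" and a: "a \<in> A" for i a
      proof -
        have "p a = gram n S b a - gram n T' b a"
          unfolding p_def gram_def w_def sum_subtractf[symmetric]
          by (intro sum.cong refl) (simp add: S(3) a algebra_simps)
        then show ?thesis using S i a by (simp add: R)
      qed
      moreover have "R i $ b = T' i $ b" for i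
      proof -
        \<comment> \<open>Equal norms of the two columns make the squared length of \<open>w\<close>
          twice its inner product with column \<open>b\<close>, so the reflection subtracts exactly
          \<open>w\<close> from that column.\<close>
        have "q = gram n S b b - 2 * (\<Sum>k<n. S k $ b * T' k $ b) + gram n T' b b"
          unfolding q_def w_def gram_def sum_distrib_left sum_subtractf[symmetric] sum.distrib[symmetric]
          by (intro sum.cong refl) (simp add: algebra_simps power2_eq_square)
        moreover have "p b = gram n S b b - (\<Sum>k<n. S k $ b * T' k $ b)"
          unfolding p_def gram_def w_def sum_subtractf[symmetric]
          by (intro sum.cong refl) (simp add: algebra_simps)
        ultimately have "q = 2 * p b" using S by simp
        then show ?thesis using False by (simp add: R w_def field_simps)
      qed
      ultimately show ?thesis using S by (intro exI[of _ R]) (auto simp: fun_eq_iff)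
    qed
  qed
  from this[of UNIV] obtain S where S: "cf \<mu> \<theta> n S = cf \<mu> \<theta> n T" "\<forall>i<n. S i = T' i"
    by (auto simp: vec_eq_iff)
  then have "cf \<mu> \<theta> n S = cf \<mu> \<theta> n T'" by (simp add: cf_def)
  then show ?thesis using S by simp
qed

section \<open>Gaussian randomisation\<close>

lemma cf_bound: "prob_space \<mu> \<Longrightarrow> \<bar>cf \<mu> \<theta> n T\<bar> \<le> 1"
  unfolding cf_def
proof -
  assume "prob_space \<mu>"
  then interpret prob_space \<mu> .
  define f where "f X = cos (\<theta> + (\<Sum>i<n. T i \<bullet> X i))" for X
  show "\<bar>\<integral>X. cos (\<theta> + (\<Sum>i<n. T i \<bullet> X i)) \<partial>\<mu>\<bar> \<le> 1"
  \<comment> \<open>Nothing is assumed about the sigma-algebra of \<mu>, so \<open>f\<close> may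
    fail to be integrable; its integral is then 0 by convention.\<close>
  proof (cases "integrable \<mu> f")
    case True
    have "\<bar>\<integral>X. f X \<partial>\<mu>\<bar> \<le> (\<integral>X. \<bar>f X\<bar> \<partial>\<mu>)" by (rule integral_abs_bound)
    also have "\<dots> \<le> (\<integral>X. 1 \<partial>\<mu>)" by (intro integral_mono integrable_abs True) (auto simp: f_def)
    finally show ?thesis by (simp add: prob_space f_def)
  qed (simp add: not_integrable_integral_eq f_def[abs_def])
qed

lemma imat_coordinate_measurable [measurable (raw)]:
  fixes f :: "'a \<Rightarrow> 'm::finite imat"
  assumes "f \<in> borel_measurable M"
  shows "(\<lambda>x. f x i) \<in> borel_measurable M"
  using assms by (rule measurable_product_then_coordinatewise)

lemma cf_tendsto:
  assumes \<mu>: "\<mu> \<in> borel_probs" and lim: "\<And>i. i < n \<Longrightarrow> (\<lambda>k. T k i) \<longlonglongrightarrow> S i"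
  shows "(\<lambda>k. cf \<mu> \<theta> n (T k)) \<longlonglongrightarrow> cf \<mu> \<theta> n S"
  unfolding cf_def
proof (rule integral_dominated_convergence[where w = "\<lambda>_. 1"])
  interpret prob_space \<mu> using \<mu> by (simp add: borel_probs_def)
  have [measurable_cong]: "sets \<mu> = sets borel" using \<mu> by (simp add: borel_probs_def)
  show "(\<lambda>X. cos (\<theta> + (\<Sum>i<n. S i \<bullet> X i))) \<in> borel_measurable \<mu>"
    "\<And>k. (\<lambda>X. cos (\<theta> + (\<Sum>i<n. T k i \<bullet> X i))) \<in> borel_measurable \<mu>"
    by measurable
  show "AE X in \<mu>. (\<lambda>k. cos (\<theta> + (\<Sum>i<n. T k i \<bullet> X i))) \<longlonglongrightarrow> cos (\<theta> + (\<Sum>i<n. S i \<bullet> X i))"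
    using lim by (auto intro!: tendsto_intros)
  show "integrable \<mu> (\<lambda>_. 1::real)" by simp
qed auto

text \<open>Fubini applied to \<open>gauss_cos\<close>: a mean of Gaussian exponentials under \<mu>
  becomes an average of \<open>cf \<mu>\<close> over random frequencies, and there
  \<open>cf_gram\<close> can be used.\<close>

lemma gaussian_linearization:
  fixes \<tau> :: "'m::finite imat"
  assumes \<mu>: "\<mu> \<in> borel_probs" and J: "J \<subseteq> {..<N}" and w: "\<And>j. j \<in> J \<Longrightarrow> 0 \<le> w j"
  shows "(\<integral>X. exp (- (\<Sum>j\<in>J. w j * (\<tau> j \<bullet> X j)\<^sup>2) / 2) \<partial>\<mu>) =
     (\<integral>g. cf \<mu> 0 N (\<lambda>j. if j \<in> J then (sqrt (w j) * g j) *\<^sub>R \<tau> j else 0) \<partial>gauss)"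
    and "(\<lambda>g. cf \<mu> 0 N (\<lambda>j. if j \<in> J then (sqrt (w j) * g j) *\<^sub>R \<tau> j else 0)) \<in> borel_measurable gauss"
proof -
  interpret prob_space \<mu> using \<mu> by (simp add: borel_probs_def)
  interpret P: pair_prob_space \<mu> "gauss :: (nat \<Rightarrow> real) measure" ..
  have [measurable_cong]: "sets \<mu> = sets borel" using \<mu> by (simp add: borel_probs_def)
  have fin: "finite J" using J finite_subset by blast
  define f where "f X g = cos (\<Sum>j\<in>J. (sqrt (w j) * (\<tau> j \<bullet> X j)) * g j)" for X :: "'m imat" and g :: "nat \<Rightarrow> real"
  have fm [measurable]: "(\<lambda>(X, g). f X g) \<in> borel_measurable (\<mu> \<Otimes>\<^sub>M gauss)"
    unfolding f_def by measurable
  have fe: "f X g = cos (0 + (\<Sum>j<N. (if j \<in> J then (sqrt (w j) * g j) *\<^sub>R \<tau> j else 0) \<bullet> X j))" for X g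
  proof -
    have "(\<Sum>j<N. (if j \<in> J then (sqrt (w j) * g j) *\<^sub>R \<tau> j else 0) \<bullet> X j) = (\<Sum>j\<in>J. (sqrt (w j) * (\<tau> j \<bullet> X j)) * g j)"
      using J by (intro sum.mono_neutral_cong_right) auto
    then show ?thesis by (simp add: f_def)
  qed
  have "exp (- (\<Sum>j\<in>J. w j * (\<tau> j \<bullet> X j)\<^sup>2) / 2) = (\<integral>g. f X g \<partial>gauss)" for X
  proof -
    have "(\<Sum>j\<in>J. w j * (\<tau> j \<bullet> X j)\<^sup>2) = (\<Sum>j\<in>J. (sqrt (w j) * (\<tau> j \<bullet> X j))\<^sup>2)"
      using w by (intro sum.cong) (auto simp: power_mult_distrib)
    then show ?thesis using gauss_cos[OF fin, of 0] by (simp add: f_def)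
  qed
  then have "(\<integral>X. exp (- (\<Sum>j\<in>J. w j * (\<tau> j \<bullet> X j)\<^sup>2) / 2) \<partial>\<mu>) = (\<integral>X. \<integral>g. f X g \<partial>gauss \<partial>\<mu>)"
    by simp
  also have "\<dots> = (\<integral>g. \<integral>X. f X g \<partial>\<mu> \<partial>gauss)"
    by (rule P.Fubini_integral[symmetric], rule P.integrable_const_bound[where B = 1]) (auto simp: f_def)
  also have "\<dots> = (\<integral>g. cf \<mu> 0 N (\<lambda>j. if j \<in> J then (sqrt (w j) * g j) *\<^sub>R \<tau> j else 0) \<partial>gauss)"
    unfolding cf_def fe ..
  finally show "(\<integral>X. exp (- (\<Sum>j\<in>J. w j * (\<tau> j \<bullet> X j)\<^sup>2) / 2) \<partial>\<mu>) =
     (\<integral>g. cf \<mu> 0 N (\<lambda>j. if j \<in> J then (sqrt (w j) * g j) *\<^sub>R \<tau> j else 0) \<partial>gauss)" .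
  show "(\<lambda>g. cf \<mu> 0 N (\<lambda>j. if j \<in> J then (sqrt (w j) * g j) *\<^sub>R \<tau> j else 0)) \<in> borel_measurable gauss"
    unfolding cf_def fe[symmetric] by measurable
qed

text \<open>Continuity of \<open>cf\<close> at \<open>t\<close> in the form needed for random
  scalings: \<open>ch\<close> stands for factors in the Gram matrix, hence the square root. A
  failing sequence of scalings converging to 1 would contradict \<open>cf_tendsto\<close>.\<close>

lemma cf_scale_continuous:
  fixes t :: "'m::finite imat"
  assumes \<mu>: "\<mu> \<in> borel_probs" and "0 < \<epsilon>"
  obtains \<eta> where "0 < \<eta>"
    "\<And>ch. (\<And>b. b < n \<Longrightarrow> \<bar>ch b - 1\<bar> \<le> \<eta>) \<Longrightarrow> \<bar>cf \<mu> 0 n (\<lambda>b. sqrt (ch b) *\<^sub>R t b) - cf \<mu> 0 n t\<bar> \<le> \<epsilon>"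
proof (rule ccontr)
  assume no: "\<not> thesis"
  have "\<exists>ch. (\<forall>b<n. \<bar>ch b - 1\<bar> \<le> 1 / Suc k) \<and> \<not> \<bar>cf \<mu> 0 n (\<lambda>b. sqrt (ch b) *\<^sub>R t b) - cf \<mu> 0 n t\<bar> \<le> \<epsilon>" for k :: nat
    by (rule ccontr) (use that[of "1 / Suc k"] no in auto)
  then obtain ch where ch: "\<And>k b. b < n \<Longrightarrow> \<bar>ch k b - 1\<bar> \<le> 1 / Suc k"
      "\<And>k. \<not> \<bar>cf \<mu> 0 n (\<lambda>b. sqrt (ch k b) *\<^sub>R t b) - cf \<mu> 0 n t\<bar> \<le> \<epsilon>" by metis
  have "(\<lambda>k. cf \<mu> 0 n (\<lambda>b. sqrt (ch k b) *\<^sub>R t b)) \<longlonglongrightarrow> cf \<mu> 0 n (\<lambda>b. sqrt 1 *\<^sub>R t b)"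
  proof (intro cf_tendsto \<mu> tendsto_intros)
    fix b assume "b < n"
    have "(\<lambda>k. ch k b - 1) \<longlonglongrightarrow> 0"
      by (rule Lim_null_comparison[OF _ LIMSEQ_inverse_real_of_nat])
        (use ch(1)[OF \<open>b < n\<close>] in \<open>auto simp: inverse_eq_divide\<close>)
    then show "(\<lambda>k. ch k b) \<longlonglongrightarrow> 1" by (simp add: LIM_zero_iff)
  qed
  then have "\<forall>\<^sub>F k in sequentially. dist (cf \<mu> 0 n (\<lambda>b. sqrt (ch k b) *\<^sub>R t b)) (cf \<mu> 0 n t) < \<epsilon>"
    using tendstoD[OF _ \<open>0 < \<epsilon>\<close>] by auto
  then show False using ch(2) by (auto simp: dist_real_def eventually_sequentially) (meson less_imp_le order_refl)
qed

text \<open>The map \<open>a\<close> sorts the indices into \<open>n\<close> blocks of total weight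
  1. The random frequency matrix has Gram matrix \<Sum> ch(b) t(b) t(b)^t, with ch(b) the weighted
  chi-square sum of block b. Small weights concentrate each ch(b) at 1, so \<open>cf\<close> stays
  close to its value at \<open>t\<close>.\<close>

proposition block_average:
  fixes t :: "'m::finite imat"
  assumes \<mu>: "\<mu> \<in> P_inv" and "0 < \<epsilon>"
  shows "\<exists>\<delta>>0. \<forall>J a w. finite J \<longrightarrow> (\<forall>j\<in>J. a j < n \<and> 0 \<le> w j \<and> w j \<le> \<delta>) \<longrightarrow>
       (\<forall>b<n. (\<Sum>j\<in>{j\<in>J. a j = b}. w j) = 1) \<longrightarrow>
       \<bar>(\<integral>X. exp (- (\<Sum>j\<in>J. w j * (t (a j) \<bullet> X j)\<^sup>2) / 2) \<partial>\<mu>) - cf \<mu> 0 n t\<bar> < \<epsilon>"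
proof -
  note \<mu>b = P_inv_probs[OF \<mu>]
  have ps: "prob_space \<mu>" using \<mu>b by (simp add: borel_probs_def)
  obtain \<eta> where \<eta>: "0 < \<eta>"
    "\<And>ch. (\<And>b. b < n \<Longrightarrow> \<bar>ch b - 1\<bar> \<le> \<eta>) \<Longrightarrow> \<bar>cf \<mu> 0 n (\<lambda>b. sqrt (ch b) *\<^sub>R t b) - cf \<mu> 0 n t\<bar> \<le> \<epsilon> / 2"
    using cf_scale_continuous[OF \<mu>b, of "\<epsilon>/2" n t] \<open>0 < \<epsilon>\<close> by auto
  \<comment> \<open>Chosen so that each block contributes at most (2 / \<eta>^2) (2 \<delta>) =
    \<epsilon> / (4 (n + 1)) to the expected error.\<close>
  define \<delta> where "\<delta> = \<epsilon> * \<eta>\<^sup>2 / (16 * Suc n)"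
  have "0 < \<delta>" using \<eta> \<open>0 < \<epsilon>\<close> by (simp add: \<delta>_def)
  show ?thesis
  proof (intro exI[of _ \<delta>] conjI allI impI \<open>0 < \<delta>\<close>)
    fix J :: "nat set" and a w
    assume fin: "finite J" and "\<forall>j\<in>J. a j < n \<and> 0 \<le> w j \<and> w j \<le> \<delta>"
      and "\<forall>b<n. (\<Sum>j\<in>{j\<in>J. a j = b}. w j) = 1"
    then have aw: "\<And>j. j \<in> J \<Longrightarrow> a j < n \<and> 0 \<le> w j \<and> w j \<le> \<delta>"
      and W: "\<And>b. b < n \<Longrightarrow> (\<Sum>j\<in>{j\<in>J. a j = b}. w j) = 1" by blast+
    obtain N0 where N0: "J \<subseteq> {..<N0}" using fin by (meson finite_nat_bounded)
    define N where "N = max n N0"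
    have N: "J \<subseteq> {..<N}" "n \<le> N" using N0 by (auto simp: N_def)
    define ch where "ch g b = (\<Sum>j\<in>{j\<in>J. a j = b}. w j * (g j)\<^sup>2)" for g :: "nat \<Rightarrow> real" and b
    have ch0: "0 \<le> ch g b" for g b unfolding ch_def using aw by (intro sum_nonneg) auto
    define h where "h g = cf \<mu> 0 n (\<lambda>b. sqrt (ch g b) *\<^sub>R t b)" for g
    have h: "cf \<mu> 0 N (\<lambda>j. if j \<in> J then (sqrt (w j) * g j) *\<^sub>R t (a j) else 0) = h g" for g
    proof -
      have "h g = cf \<mu> 0 N (\<lambda>b. if b < n then sqrt (ch g b) *\<^sub>R t b else 0)"
        unfolding h_def using N by (simp add: cf_extend)
      also have "\<dots> = cf \<mu> 0 N (\<lambda>j. if j \<in> J then (sqrt (w j) * g j) *\<^sub>R t (a j) else 0)"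
      \<comment> \<open>Grouping the random rows by block shows that they have the Gram matrix of
        just \<open>n\<close> rows, the \<open>t b\<close> scaled by
        \<open>sqrt (ch g b)\<close>.\<close>
      proof (rule cf_gram[OF \<mu>], intro ext)
        fix x y
        have "gram N (\<lambda>j. if j \<in> J then (sqrt (w j) * g j) *\<^sub>R t (a j) else 0) x y
           = (\<Sum>j\<in>J. w j * (g j)\<^sup>2 * (t (a j) $ x * t (a j) $ y))"
          unfolding gram_def using N aw
          by (intro sum.mono_neutral_cong_right) (auto simp: algebra_simps power2_eq_square)
        also have "\<dots> = (\<Sum>b<n. \<Sum>j\<in>{j\<in>J. a j = b}. w j * (g j)\<^sup>2 * (t (a j) $ x * t (a j) $ y))"
          using fin aw by (intro sum.group[symmetric]) auto
        also have "\<dots> = (\<Sum>b<n. ch g b * (t b $ x * t b $ y))"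
          unfolding ch_def sum_distrib_right by (intro sum.cong) auto
        also have "\<dots> = gram N (\<lambda>b. if b < n then sqrt (ch g b) *\<^sub>R t b else 0) x y"
          unfolding gram_def using N ch0
          by (intro sum.mono_neutral_cong_left) (auto simp: algebra_simps)
        finally show "gram N (\<lambda>b. if b < n then sqrt (ch g b) *\<^sub>R t b else 0) x y =
           gram N (\<lambda>j. if j \<in> J then (sqrt (w j) * g j) *\<^sub>R t (a j) else 0) x y" ..
      qed
      finally show ?thesis ..
    qed
    have E: "(\<integral>X. exp (- (\<Sum>j\<in>J. w j * (t (a j) \<bullet> X j)\<^sup>2) / 2) \<partial>\<mu>) = (\<integral>g. h g \<partial>gauss)"
      and hm [measurable]: "h \<in> borel_measurable gauss"
      using gaussian_linearization[OF \<mu>b N(1), of w "\<lambda>j. t (a j)"] aw unfolding h by auto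
    \<comment> \<open>A Chebyshev bound: if some \<open>ch g b\<close> is farther than
      \<open>\<eta>\<close> from 1, its term is at least 2, which is the largest possible difference
      of two values of \<open>cf\<close>.\<close>
    define bd where "bd g = \<epsilon> / 2 + (\<Sum>b<n. 2 / \<eta>\<^sup>2 * (ch g b - 1)\<^sup>2)" for g
    have pw: "\<bar>h g - cf \<mu> 0 n t\<bar> \<le> bd g" for g
    proof (cases "\<forall>b<n. \<bar>ch g b - 1\<bar> \<le> \<eta>")
      case True
      then have "\<bar>h g - cf \<mu> 0 n t\<bar> \<le> \<epsilon> / 2" unfolding h_def by (intro \<eta>(2)) auto
      also have "\<dots> \<le> bd g" unfolding bd_def by (auto intro!: sum_nonneg)
      finally show ?thesis .
    next
      case False
      then obtain b where b: "b < n" "\<eta> < \<bar>ch g b - 1\<bar>" by force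
      have "\<eta>\<^sup>2 \<le> (ch g b - 1)\<^sup>2" using b \<eta>(1) abs_le_square_iff[of \<eta> "ch g b - 1"] by simp
      then have "2 \<le> 2 / \<eta>\<^sup>2 * (ch g b - 1)\<^sup>2" using \<eta>(1) by (simp add: field_simps)
      also have "\<dots> \<le> (\<Sum>b<n. 2 / \<eta>\<^sup>2 * (ch g b - 1)\<^sup>2)"
        using b by (intro member_le_sum) auto
      also have "\<dots> \<le> bd g" unfolding bd_def using \<open>0 < \<epsilon>\<close> by simp
      finally have "2 \<le> bd g" .
      moreover have "\<bar>h g\<bar> \<le> 1" "\<bar>cf \<mu> 0 n t\<bar> \<le> 1" unfolding h_def by (rule cf_bound[OF ps])+
      ultimately show ?thesis by linarith
    qed
    have chi: "integrable gauss (\<lambda>g. (ch g b - 1)\<^sup>2)" "(\<integral>g. (ch g b - 1)\<^sup>2 \<partial>gauss) \<le> 2 * \<delta>" if "b < n" for b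
      unfolding ch_def using gauss_chi_square[of "{j\<in>J. a j = b}" w \<delta>] fin aw W[OF that] by auto
    have hi: "integrable gauss h"
      by (intro gauss.integrable_const_bound[where B=1]) (auto simp: h_def cf_bound[OF ps])
    have si: "integrable gauss (\<lambda>g. \<Sum>b<n. 2 / \<eta>\<^sup>2 * (ch g b - 1)\<^sup>2)"
      using chi by (intro Bochner_Integration.integrable_sum integrable_mult_right) auto
    then have bdi: "integrable gauss bd" unfolding bd_def
      by (intro Bochner_Integration.integrable_add) auto
    have "(\<integral>g. bd g \<partial>gauss) = \<epsilon> / 2 + (\<integral>g. (\<Sum>b<n. 2 / \<eta>\<^sup>2 * (ch g b - 1)\<^sup>2) \<partial>gauss)"
      unfolding bd_def by (subst Bochner_Integration.integral_add[OF _ si])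
        (auto simp: gauss.prob_space[unfolded space_gauss])
    also have "(\<integral>g. (\<Sum>b<n. 2 / \<eta>\<^sup>2 * (ch g b - 1)\<^sup>2) \<partial>gauss) = (\<Sum>b<n. (\<integral>g. 2 / \<eta>\<^sup>2 * (ch g b - 1)\<^sup>2 \<partial>gauss))"
      using chi by (intro Bochner_Integration.integral_sum integrable_mult_right) auto
    also have "\<dots> = (\<Sum>b<n. 2 / \<eta>\<^sup>2 * (\<integral>g. (ch g b - 1)\<^sup>2 \<partial>gauss))"
      by (simp only: integral_mult_right_zero)
    finally have Ebd: "(\<integral>g. bd g \<partial>gauss) = \<epsilon> / 2 + (\<Sum>b<n. 2 / \<eta>\<^sup>2 * (\<integral>g. (ch g b - 1)\<^sup>2 \<partial>gauss))" .
    have "\<bar>(\<integral>g. h g \<partial>gauss) - cf \<mu> 0 n t\<bar> = \<bar>\<integral>g. h g - cf \<mu> 0 n t \<partial>gauss\<bar>"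
      using hi by (simp add: gauss.prob_space[unfolded space_gauss])
    also have "\<dots> \<le> (\<integral>g. \<bar>h g - cf \<mu> 0 n t\<bar> \<partial>gauss)" by (rule integral_abs_bound)
    also have "\<dots> \<le> (\<integral>g. bd g \<partial>gauss)" using hi bdi pw by (intro integral_mono) auto
    also have "\<dots> = \<epsilon> / 2 + (\<Sum>b<n. 2 / \<eta>\<^sup>2 * (\<integral>g. (ch g b - 1)\<^sup>2 \<partial>gauss))"
      by (rule Ebd)
    also have "\<dots> \<le> \<epsilon> / 2 + (\<Sum>b<n. 2 / \<eta>\<^sup>2 * (2 * \<delta>))"
      using chi by (intro add_left_mono sum_mono mult_left_mono) auto
    also have "\<dots> = \<epsilon> / 2 + \<epsilon> / 4 * (n / Suc n)" using \<eta>(1) by (simp add: \<delta>_def field_simps)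
    also have "\<dots> \<le> \<epsilon> / 2 + \<epsilon> / 4 * 1"
      using \<open>0 < \<epsilon>\<close> by (intro add_left_mono mult_left_mono) auto
    also have "\<dots> < \<epsilon>" using \<open>0 < \<epsilon>\<close> by simp
    finally show "\<bar>(\<integral>X. exp (- (\<Sum>j\<in>J. w j * (t (a j) \<bullet> X j)\<^sup>2) / 2) \<partial>\<mu>) - cf \<mu> 0 n t\<bar> < \<epsilon>"
      unfolding E .
  qed
qed

text \<open>For \<open>K = {..<N}\<close> this is the L(N, t) of the overview. General index sets
  are allowed so that the factors of a product can be moved to disjoint blocks.\<close>

definition gauss_stat :: "nat set \<Rightarrow> real^'m \<Rightarrow> 'm::finite imat \<Rightarrow> real" where
  "gauss_stat K t X = exp (- (\<Sum>j\<in>K. 1 / card K * (t \<bullet> X j)\<^sup>2) / 2)"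

lemma gauss_stat_bounds: "0 < gauss_stat K t X" "gauss_stat K t X \<le> 1"
  unfolding gauss_stat_def by (auto intro!: sum_nonneg)

lemma abs_gauss_stat [simp]: "\<bar>gauss_stat K t X\<bar> = gauss_stat K t X"
  using gauss_stat_bounds(1)[of K t X] by simp

lemma gauss_stat_measurable [measurable]: "gauss_stat K t \<in> borel_measurable borel"
  unfolding gauss_stat_def by measurable

text \<open>Two exponentials at \<open>t\<close> multiply to one at
  \<open>sqrt 2 *\<^sub>R t\<close> with the averaged weights. So the squared difference is F(c) +
  F(d) - 2 F((c + d)/2), and \<open>block_average\<close> with a single block gives all three means
  the same limit.\<close>

lemma weighted_stat_L1:
  fixes t :: "real^'m::finite"
  assumes \<mu>: "\<mu> \<in> P_inv" and "0 < \<epsilon>"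
  obtains \<delta> where "0 < \<delta>"
    "\<And>J c d. finite J \<Longrightarrow> (\<And>j. j \<in> J \<Longrightarrow> 0 \<le> c j \<and> c j \<le> \<delta> \<and> 0 \<le> d j \<and> d j \<le> \<delta>) \<Longrightarrow>
       (\<Sum>j\<in>J. c j) = 1 \<Longrightarrow> (\<Sum>j\<in>J. d j) = 1 \<Longrightarrow>
       (\<integral>X. \<bar>exp (- (\<Sum>j\<in>J. c j * (t \<bullet> X j)\<^sup>2) / 2) - exp (- (\<Sum>j\<in>J. d j * (t \<bullet> X j)\<^sup>2) / 2)\<bar> \<partial>\<mu>) < \<epsilon>"
proof -
  interpret prob_space \<mu> using \<mu> by (rule P_inv_prob_space)
  note [measurable_cong] = P_inv_sets[OF \<mu>]
  define s where "s = sqrt 2 *\<^sub>R t"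
  \<comment> \<open>The coefficients 1, 1, -2 below multiply an error of \<epsilon>^2 / 8 by at most
    4, which stays under \<epsilon>^2.\<close>
  obtain \<delta> where \<delta>: "0 < \<delta>"
    "\<forall>J a w. finite J \<longrightarrow> (\<forall>j\<in>J. a j < (1::nat) \<and> 0 \<le> w j \<and> w j \<le> \<delta>) \<longrightarrow>
       (\<forall>b<1. (\<Sum>j\<in>{j\<in>J. a j = b}. w j) = 1) \<longrightarrow>
       \<bar>(\<integral>X. exp (- (\<Sum>j\<in>J. w j * (s \<bullet> X j)\<^sup>2) / 2) \<partial>\<mu>) - cf \<mu> 0 1 (\<lambda>_. s)\<bar> < \<epsilon>\<^sup>2 / 8"
    using block_average[OF \<mu>, of "\<epsilon>\<^sup>2 / 8" 1 "\<lambda>_. s"] \<open>0 < \<epsilon>\<close> by auto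
  show thesis
  proof (rule that[OF \<delta>(1)])
    fix J :: "nat set" and c d
    assume J: "finite J" "\<And>j. j \<in> J \<Longrightarrow> 0 \<le> c j \<and> c j \<le> \<delta> \<and> 0 \<le> d j \<and> d j \<le> \<delta>"
      and 1: "(\<Sum>j\<in>J. c j) = 1" "(\<Sum>j\<in>J. d j) = 1"
    define E where "E w X = exp (- (\<Sum>j\<in>J. w j * (t \<bullet> X j)\<^sup>2) / 2)" for w and X :: "'m imat"
    define F where "F w X = exp (- (\<Sum>j\<in>J. w j * (s \<bullet> X j)\<^sup>2) / 2)" for w and X :: "'m imat"
    have [measurable]: "E w \<in> borel_measurable borel" "F w \<in> borel_measurable borel" for w
      unfolding E_def F_def by measurable
    have bd: "0 \<le> E w X" "E w X \<le> 1" "0 \<le> F w X" "F w X \<le> 1" if "\<And>j. j \<in> J \<Longrightarrow> 0 \<le> w j" for w X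
      unfolding E_def F_def using that by (auto intro!: sum_nonneg)
    have Fw: "\<bar>(\<integral>X. F w X \<partial>\<mu>) - cf \<mu> 0 1 (\<lambda>_. s)\<bar> < \<epsilon>\<^sup>2 / 8"
      if "\<And>j. j \<in> J \<Longrightarrow> 0 \<le> w j \<and> w j \<le> \<delta>" "(\<Sum>j\<in>J. w j) = 1" for w
      unfolding F_def using that J(1) by (intro \<delta>(2)[rule_format, of J "\<lambda>_. 0" w]) auto
    have EE: "E v X * E w X = F (\<lambda>j. (v j + w j) / 2) X" for v w X
    proof -
      have "(s \<bullet> X j)\<^sup>2 = 2 * (t \<bullet> X j)\<^sup>2" for j by (simp add: s_def power_mult_distrib)
      then show ?thesis
        by (simp add: E_def F_def exp_add[symmetric] add_divide_distrib sum.distrib distrib_right)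
    qed
    define a where "a j = (c j + d j) / 2" for j
    have c': "0 \<le> c j \<and> c j \<le> \<delta>" and d': "0 \<le> d j \<and> d j \<le> \<delta>"
      and a': "0 \<le> a j \<and> a j \<le> \<delta>" if "j \<in> J" for j
      using J(2)[OF that] by (simp_all add: a_def)
    have a1: "(\<Sum>j\<in>J. a j) = 1"
      by (simp add: a_def sum_divide_distrib[symmetric] sum.distrib 1)
    have int: "integrable \<mu> (F w)" if "\<And>j. j \<in> J \<Longrightarrow> 0 \<le> w j" for w
      using bd[OF that] by (intro integrable_const_bound[where B=1]) auto
    have sq: "(E c X - E d X)\<^sup>2 = F c X + F d X - 2 * F a X" for X
      using EE[of c X c] EE[of d X d] EE[of c X d]
      by (simp add: power2_eq_square algebra_simps a_def[abs_def])
    \<comment> \<open>The elementary bound |x| \<le> \<epsilon>/2 + x^2 / (2 \<epsilon>) passes from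
      the mean square to the mean absolute value.\<close>
    have "(\<integral>X. \<bar>E c X - E d X\<bar> \<partial>\<mu>) \<le> (\<integral>X. \<epsilon> / 2 + (F c X + F d X - 2 * F a X) / (2 * \<epsilon>) \<partial>\<mu>)"
    proof (rule integral_mono)
      have "\<bar>E c X - E d X\<bar> \<le> 1" for X
        using bd(1,2)[of c X] bd(1,2)[of d X] c' d' unfolding abs_le_iff by fastforce
      then show "integrable \<mu> (\<lambda>X. \<bar>E c X - E d X\<bar>)"
        by (intro integrable_const_bound[where B=1]) auto
      show "integrable \<mu> (\<lambda>X. \<epsilon> / 2 + (F c X + F d X - 2 * F a X) / (2 * \<epsilon>))"
        using int[of c] int[of d] int[of a] a' c' d' by auto
      fix X
      have "0 \<le> (\<bar>E c X - E d X\<bar> - \<epsilon>)\<^sup>2" by simp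
      then have "2 * \<epsilon> * \<bar>E c X - E d X\<bar> \<le> \<epsilon>\<^sup>2 + (E c X - E d X)\<^sup>2"
        by (simp add: power2_diff algebra_simps)
      then show "\<bar>E c X - E d X\<bar> \<le> \<epsilon> / 2 + (F c X + F d X - 2 * F a X) / (2 * \<epsilon>)"
        using \<open>0 < \<epsilon>\<close> unfolding sq by (simp add: field_simps power2_eq_square)
    qed
    also have "\<dots> = \<epsilon> / 2 + ((\<integral>X. F c X \<partial>\<mu>) + (\<integral>X. F d X \<partial>\<mu>) - 2 * (\<integral>X. F a X \<partial>\<mu>)) / (2 * \<epsilon>)"
      using int[of c] int[of d] int[of a] a' c' d' by (simp add: prob_space)
    also have "\<dots> < \<epsilon> / 2 + \<epsilon>\<^sup>2 / (2 * \<epsilon>)"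
    proof -
      have "(\<integral>X. F c X \<partial>\<mu>) + (\<integral>X. F d X \<partial>\<mu>) - 2 * (\<integral>X. F a X \<partial>\<mu>) < \<epsilon>\<^sup>2"
        using Fw[OF c' 1(1)] Fw[OF d' 1(2)] Fw[OF a' a1] unfolding abs_less_iff by linarith
      then show ?thesis using \<open>0 < \<epsilon>\<close> by (intro add_strict_left_mono divide_strict_right_mono) auto
    qed
    also have "\<dots> = \<epsilon>" using \<open>0 < \<epsilon>\<close> by (simp add: power2_eq_square)
    finally show "(\<integral>X. \<bar>exp (- (\<Sum>j\<in>J. c j * (t \<bullet> X j)\<^sup>2) / 2) - exp (- (\<Sum>j\<in>J. d j * (t \<bullet> X j)\<^sup>2) / 2)\<bar> \<partial>\<mu>) < \<epsilon>"
      by (simp add: E_def)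
  qed
qed

text \<open>Uniform weights on \<open>K\<close> and on \<open>L\<close>, extended by 0 to the union,
  are two systems of weights at most 1 / \<open>N0\<close>. The sets may overlap, so both long
  initial segments and distant blocks are covered.\<close>

lemma gauss_stat_close:
  fixes t :: "real^'m::finite"
  assumes \<mu>: "\<mu> \<in> P_inv" and "0 < \<epsilon>"
  shows "\<exists>N0>0. \<forall>K L. finite K \<longrightarrow> finite L \<longrightarrow> N0 \<le> card K \<longrightarrow> N0 \<le> card L \<longrightarrow>
    (\<integral>X. \<bar>gauss_stat K t X - gauss_stat L t X\<bar> \<partial>\<mu>) < \<epsilon>"
proof -
  from weighted_stat_L1[OF assms, of t] obtain \<delta> where \<delta>: "0 < \<delta>"
    "\<And>J c d. finite J \<Longrightarrow> (\<And>j. j \<in> J \<Longrightarrow> 0 \<le> c j \<and> c j \<le> \<delta> \<and> 0 \<le> d j \<and> d j \<le> \<delta>) \<Longrightarrow>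
       (\<Sum>j\<in>J. c j) = 1 \<Longrightarrow> (\<Sum>j\<in>J. d j) = 1 \<Longrightarrow>
       (\<integral>X. \<bar>exp (- (\<Sum>j\<in>J. c j * (t \<bullet> X j)\<^sup>2) / 2) - exp (- (\<Sum>j\<in>J. d j * (t \<bullet> X j)\<^sup>2) / 2)\<bar> \<partial>\<mu>) < \<epsilon>"
    by blast
  obtain k where k: "inverse (real (Suc k)) < \<delta>" using reals_Archimedean[OF \<delta>(1)] by blast
  define N0 where "N0 = Suc k"
  have N0: "N0 > 0" "1 / N0 < \<delta>" using k by (simp_all add: N0_def inverse_eq_divide)
  define c where "c K j = (if j \<in> K then 1 / real (card K) else 0)" for K and j :: nat
  have c: "0 \<le> c K j \<and> c K j \<le> \<delta>" if "N0 \<le> card K" for K j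
    using N0 that frac_le[of 1 1 "real N0" "real (card K)"] \<delta>(1) by (simp add: c_def)
  have c1: "(\<Sum>j\<in>J. c K j) = 1" if "N0 \<le> card K" "K \<subseteq> J" "finite J" for K J
  proof -
    have "(\<Sum>j\<in>J. c K j) = (\<Sum>j\<in>K. 1 / real (card K))"
      unfolding c_def using that by (intro sum.mono_neutral_cong_right) auto
    then show ?thesis using N0 that by simp
  qed
  have cs: "exp (- (\<Sum>j\<in>J. c K j * (t \<bullet> X j)\<^sup>2) / 2) = gauss_stat K t X" if "K \<subseteq> J" "finite J" for K J X
  proof -
    have "(\<Sum>j\<in>J. c K j * (t \<bullet> X j)\<^sup>2) = (\<Sum>j\<in>K. 1 / real (card K) * (t \<bullet> X j)\<^sup>2)"
      unfolding c_def using that by (intro sum.mono_neutral_cong_right) auto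
    then show ?thesis by (simp add: gauss_stat_def)
  qed
  have "(\<integral>X. \<bar>gauss_stat K t X - gauss_stat L t X\<bar> \<partial>\<mu>) < \<epsilon>"
    if K: "finite K" "finite L" "N0 \<le> card K" "N0 \<le> card L" for K L
  proof -
    have J: "finite (K \<union> L)" "K \<subseteq> K \<union> L" "L \<subseteq> K \<union> L" using K by auto
    have "(\<integral>X. \<bar>exp (- (\<Sum>j\<in>K \<union> L. c K j * (t \<bullet> X j)\<^sup>2) / 2) - exp (- (\<Sum>j\<in>K \<union> L. c L j * (t \<bullet> X j)\<^sup>2) / 2)\<bar> \<partial>\<mu>) < \<epsilon>"
      using c[OF K(3)] c[OF K(4)] by (intro \<delta>(2) J(1) c1 J K) auto
    then show ?thesis by (simp only: cs[OF J(2,1)] cs[OF J(3,1)])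
  qed
  then show ?thesis using N0(1) by blast
qed

lemma gauss_stat_close_family:
  fixes t :: "'m::finite imat"
  assumes \<mu>: "\<mu> \<in> P_inv" and "0 < \<epsilon>"
  shows "\<exists>N0. \<forall>b<n. \<forall>K L. finite K \<longrightarrow> finite L \<longrightarrow> N0 \<le> card K \<longrightarrow> N0 \<le> card L \<longrightarrow>
    (\<integral>X. \<bar>gauss_stat K (t b) X - gauss_stat L (t b) X\<bar> \<partial>\<mu>) < \<epsilon>"
proof -
  have "\<forall>b. \<exists>N0>0. \<forall>K L. finite K \<longrightarrow> finite L \<longrightarrow> N0 \<le> card K \<longrightarrow> N0 \<le> card L \<longrightarrow>
    (\<integral>X. \<bar>gauss_stat K (t b) X - gauss_stat L (t b) X\<bar> \<partial>\<mu>) < \<epsilon>"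
    by (intro allI gauss_stat_close assms)
  from choice[OF this] obtain M where M: "\<forall>b. 0 < M b \<and> (\<forall>K L. finite K \<longrightarrow> finite L \<longrightarrow> M b \<le> card K \<longrightarrow> M b \<le> card L \<longrightarrow>
    (\<integral>X. \<bar>gauss_stat K (t b) X - gauss_stat L (t b) X\<bar> \<partial>\<mu>) < \<epsilon>)" ..
  define m where "m = Max (M ` {..<n})"
  have m: "M b \<le> m" if "b < n" for b unfolding m_def using that by (intro Max_ge) auto
  show ?thesis
  proof (intro exI[of _ m] allI impI)
    fix b and K L :: "nat set" assume b: "b < n" and "finite K" "finite L" "m \<le> card K" "m \<le> card L"
    then show "(\<integral>X. \<bar>gauss_stat K (t b) X - gauss_stat L (t b) X\<bar> \<partial>\<mu>) < \<epsilon>"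
      using m[OF b] by (intro M[rule_format, THEN conjunct2, rule_format]) (assumption | linarith)+
  qed
qed

lemma gauss_stat_prod_diff:
  "\<bar>(\<Prod>a<n. gauss_stat (K a) (t a) X) - (\<Prod>a<n. gauss_stat (L a) (t a) X)\<bar> \<le> (\<Sum>a<n. \<bar>gauss_stat (K a) (t a) X - gauss_stat (L a) (t a) X\<bar>)"
  by (rule norm_prod_diff[of "{..<n}" "\<lambda>a. gauss_stat (K a) (t a) X" "\<lambda>a. gauss_stat (L a) (t a) X", unfolded real_norm_def])
    (simp_all add: gauss_stat_bounds(2))

lemma gauss_stat_integrable:
  fixes M :: "'m::finite imat measure"
  assumes M: "M \<in> borel_probs"
  shows "integrable M (\<lambda>X. \<Prod>a<n. gauss_stat (K a) (t a) X)"
    and "integrable M (\<lambda>X. \<bar>gauss_stat I s X - gauss_stat L s X\<bar>)"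
proof -
  interpret prob_space M using M by (simp add: borel_probs_def)
  have [measurable_cong]: "sets M = sets borel" using M by (simp add: borel_probs_def)
  show "integrable M (\<lambda>X. \<Prod>a<n. gauss_stat (K a) (t a) X)"
    by (intro integrable_const_bound[where B=1])
      (auto intro!: prod_le_1 less_imp_le[OF gauss_stat_bounds(1)] gauss_stat_bounds(2) simp: abs_prod)
  have "\<bar>gauss_stat I s X - gauss_stat L s X\<bar> \<le> 1" for X
    using gauss_stat_bounds[of I s X] gauss_stat_bounds[of L s X] by (simp add: abs_le_iff)
  then show "integrable M (\<lambda>X. \<bar>gauss_stat I s X - gauss_stat L s X\<bar>)"
    by (intro integrable_const_bound[where B=1]) auto
qed

text \<open>All factors use the same rows, so the product is not of the form in
  \<open>block_average\<close>. Moving factor \<open>a\<close> to the \<open>a\<close>-th of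
  \<open>n\<close> disjoint blocks costs little in mean, and then the product is a single
  exponential with block weights 1 / \<open>N\<close>.\<close>

lemma gauss_stat_prod_tendsto:
  fixes t :: "'m::finite imat"
  assumes \<mu>: "\<mu> \<in> P_inv"
  shows "(\<lambda>N. \<integral>X. (\<Prod>a<n. gauss_stat {..<N} (t a) X) \<partial>\<mu>) \<longlonglongrightarrow> cf \<mu> 0 n t"
proof (rule LIMSEQ_I)
  interpret prob_space \<mu> using \<mu> by (rule P_inv_prob_space)
  note sets [measurable_cong] = P_inv_sets[OF \<mu>]
  fix \<epsilon> :: real assume "0 < \<epsilon>"
  \<comment> \<open>\<open>n\<close> factors are moved at cost below \<open>e\<close> each, in total
    less than half of \<epsilon>; \<open>Suc n\<close> also covers \<open>n = 0\<close>.\<close>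
  define e where "e = \<epsilon> / (2 * Suc n)"
  have e: "0 < e" using \<open>0 < \<epsilon>\<close> by (simp add: e_def)
  have e2: "0 < \<epsilon> / 2" using \<open>0 < \<epsilon>\<close> by simp
  from block_average[OF \<mu> e2, of n t] obtain \<delta> where \<delta>: "0 < \<delta>"
    "\<forall>J a w. finite J \<longrightarrow> (\<forall>j\<in>J. a j < n \<and> 0 \<le> w j \<and> w j \<le> \<delta>) \<longrightarrow>
       (\<forall>b<n. (\<Sum>j\<in>{j\<in>J. a j = b}. w j) = 1) \<longrightarrow>
       \<bar>(\<integral>X. exp (- (\<Sum>j\<in>J. w j * (t (a j) \<bullet> X j)\<^sup>2) / 2) \<partial>\<mu>) - cf \<mu> 0 n t\<bar> < \<epsilon> / 2"
    by (elim exE conjE)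
  from gauss_stat_close_family[OF \<mu> e, of n t]
  obtain M where M: "\<forall>b<n. \<forall>K L. finite K \<longrightarrow> finite L \<longrightarrow> M \<le> card K \<longrightarrow> M \<le> card L \<longrightarrow>
    (\<integral>X. \<bar>gauss_stat K (t b) X - gauss_stat L (t b) X\<bar> \<partial>\<mu>) < e" ..
  obtain k where k: "inverse (real (Suc k)) < \<delta>" using reals_Archimedean[OF \<delta>(1)] by blast
  define N0 where "N0 = max (Suc k) M"
  show "\<exists>N0. \<forall>N\<ge>N0. norm ((\<integral>X. (\<Prod>a<n. gauss_stat {..<N} (t a) X) \<partial>\<mu>) - cf \<mu> 0 n t) < \<epsilon>"
  proof (intro exI allI impI)
    fix N assume N: "N0 \<le> N"
    have Nk: "Suc k \<le> N" using N by (simp add: N0_def)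
    then have Npos: "0 < N" by simp
    have small: "1 / N \<le> \<delta>"
    proof -
      have "1 / real N \<le> 1 / real (Suc k)" using Nk by (intro frac_le) auto
      then show ?thesis using k by (simp add: inverse_eq_divide)
    qed
    \<comment> \<open>Consecutive blocks of \<open>N\<close> indices, with \<open>j div N\<close> as
      the block label of \<open>j\<close>.\<close>
    define K where "K b = {j. j div N = b}" for b
    have K: "K b = {b * N..<Suc b * N}" for b
    proof -
      have "j div N = b \<longleftrightarrow> b * N \<le> j \<and> j < Suc b * N" for j
      proof
        assume "j div N = b"
        then show "b * N \<le> j \<and> j < Suc b * N"
          using div_mult_mod_eq[of j N] mod_less_divisor[OF Npos, of j] by auto
      next
        assume "b * N \<le> j \<and> j < Suc b * N"
        then show "j div N = b" by (intro div_nat_eqI) (auto simp: mult.commute)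
      qed
      then show ?thesis unfolding K_def by (intro set_eqI) (simp only: mem_Collect_eq atLeastLessThan_iff)
    qed
    have Kc: "card (K b) = N" "finite (K b)" for b unfolding K by simp_all
    have "\<bar>(\<integral>X. (\<Prod>a<n. gauss_stat {..<N} (t a) X) \<partial>\<mu>) - (\<integral>X. (\<Prod>a<n. gauss_stat (K a) (t a) X) \<partial>\<mu>)\<bar>
       = \<bar>\<integral>X. (\<Prod>a<n. gauss_stat {..<N} (t a) X) - (\<Prod>a<n. gauss_stat (K a) (t a) X) \<partial>\<mu>\<bar>"
      by (subst Bochner_Integration.integral_diff[OF gauss_stat_integrable(1)[OF P_inv_probs[OF \<mu>]] gauss_stat_integrable(1)[OF P_inv_probs[OF \<mu>]]]) (rule refl)
    also have "\<dots> \<le> (\<integral>X. \<bar>(\<Prod>a<n. gauss_stat {..<N} (t a) X) - (\<Prod>a<n. gauss_stat (K a) (t a) X)\<bar> \<partial>\<mu>)" by (rule integral_abs_bound)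
    also have "\<dots> \<le> (\<integral>X. (\<Sum>a<n. \<bar>gauss_stat {..<N} (t a) X - gauss_stat (K a) (t a) X\<bar>) \<partial>\<mu>)"
      by (intro integral_mono Bochner_Integration.integrable_sum integrable_abs Bochner_Integration.integrable_diff
        gauss_stat_integrable[OF P_inv_probs[OF \<mu>]] gauss_stat_prod_diff)
    also have "\<dots> = (\<Sum>a<n. (\<integral>X. \<bar>gauss_stat {..<N} (t a) X - gauss_stat (K a) (t a) X\<bar> \<partial>\<mu>))"
      by (intro Bochner_Integration.integral_sum gauss_stat_integrable[OF P_inv_probs[OF \<mu>]])
    also have "\<dots> \<le> (\<Sum>a<n. e)"
    proof (intro sum_mono less_imp_le)
      fix a assume "a \<in> {..<n}"
      then show "(\<integral>X. \<bar>gauss_stat {..<N} (t a) X - gauss_stat (K a) (t a) X\<bar> \<partial>\<mu>) < e"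
        using N Kc by (intro M[rule_format]) (auto simp: N0_def)
    qed
    also have "\<dots> < \<epsilon> / 2" using \<open>0 < \<epsilon>\<close> by (simp add: e_def field_simps)
    finally have 1: "\<bar>(\<integral>X. (\<Prod>a<n. gauss_stat {..<N} (t a) X) \<partial>\<mu>) - (\<integral>X. (\<Prod>a<n. gauss_stat (K a) (t a) X) \<partial>\<mu>)\<bar> < \<epsilon> / 2" .
    have fibre: "{j\<in>{..<n*N}. j div N = b} = K b" if "b < n" for b
      using Npos that by (auto simp: K_def div_less_iff_less_mult)
    have prodB: "(\<Prod>a<n. gauss_stat (K a) (t a) X) = exp (- (\<Sum>j<n*N. 1 / N * (t (j div N) \<bullet> X j)\<^sup>2) / 2)" for X
    proof -
      have "(\<Sum>j<n*N. 1 / N * (t (j div N) \<bullet> X j)\<^sup>2) = (\<Sum>b<n. \<Sum>j\<in>{j\<in>{..<n*N}. j div N = b}. 1 / N * (t (j div N) \<bullet> X j)\<^sup>2)"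
        using Npos by (intro sum.group[symmetric]) (auto simp: div_less_iff_less_mult)
      also have "\<dots> = (\<Sum>b<n. \<Sum>j\<in>K b. 1 / N * (t b \<bullet> X j)\<^sup>2)"
        by (intro sum.cong fibre) (auto simp: fibre K_def)
      finally show ?thesis
        by (simp only: gauss_stat_def Kc exp_sum[OF finite_lessThan, symmetric]) (simp add: sum_negf sum_divide_distrib)
    qed
    have 2: "\<bar>(\<integral>X. (\<Prod>a<n. gauss_stat (K a) (t a) X) \<partial>\<mu>) - cf \<mu> 0 n t\<bar> < \<epsilon> / 2"
      unfolding prodB
    proof (rule \<delta>(2)[rule_format])
      fix b assume "b < n"
      then show "(\<Sum>j\<in>{j\<in>{..<n*N}. j div N = b}. 1 / real N) = 1" unfolding fibre[OF \<open>b < n\<close>] using Kc[of b] Npos by simp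
    qed (use Npos small in \<open>auto simp: div_less_iff_less_mult\<close>)
    show "norm ((\<integral>X. (\<Prod>a<n. gauss_stat {..<N} (t a) X) \<partial>\<mu>) - cf \<mu> 0 n t) < \<epsilon>"
      using 1 2 unfolding real_norm_def by linarith
  qed
qed

section \<open>The measures \<open>mu s\<close>\<close>

lemma gaussian_imat_eq: "gaussian_imat = gauss"
  by (simp add: gaussian_imat_def gauss_def)

lemma vec_lambda_measurable [measurable (raw)]:
  fixes f :: "'a \<Rightarrow> 'm::finite \<Rightarrow> real"
  assumes [measurable]: "\<And>j. (\<lambda>x. f x j) \<in> borel_measurable M"
  shows "(\<lambda>x. \<chi> j. f x j) \<in> borel_measurable M"
  by (subst borel_measurable_euclidean_space) (auto simp: Basis_vec_def inner_axis)

lemma vec_component_measurable [measurable (raw)]: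
  fixes f :: "'a \<Rightarrow> real^'m::finite"
  assumes "f \<in> borel_measurable M"
  shows "(\<lambda>x. f x $ j) \<in> borel_measurable M"
  using assms by (rule borel_measurable_continuous_on[rotated]) (intro continuous_intros)

lemma matrix_vector_measurable [measurable (raw)]:
  fixes f :: "'a \<Rightarrow> real^'n^'m" and g :: "'a \<Rightarrow> real^'n"
  assumes "f \<in> borel_measurable M" "g \<in> borel_measurable M"
  shows "(\<lambda>x. f x *v g x) \<in> borel_measurable M"
  using assms unfolding matrix_vector_mult_def
  by (rule borel_measurable_continuous_Pair) (intro continuous_intros)

lemma vector_matrix_measurable [measurable (raw)]:
  fixes f :: "'a \<Rightarrow> real^'n^'m" and g :: "'a \<Rightarrow> real^'m"
  assumes "f \<in> borel_measurable M" "g \<in> borel_measurable M"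
  shows "(\<lambda>x. g x v* f x) \<in> borel_measurable M"
  using assms(2,1) unfolding vector_matrix_mult_def
  by (rule borel_measurable_continuous_Pair) (intro continuous_intros)

definition sample :: "real ^ 'm \<Rightarrow> (nat \<times> 'm \<Rightarrow> real) \<times> (real ^ 'm ^ 'm) \<Rightarrow> 'm::finite imat" where
  "sample s = (\<lambda>(g, q). (\<lambda>i. (\<chi> j. g (i, j)) v* (diag_mat s ** q)))"

lemma sample_measurable [measurable]: "sample s \<in> borel_measurable (gauss \<Otimes>\<^sub>M haar_O)"
  unfolding sample_def case_prod_beta
  by (intro measurable_coordinatewise_then_product) measurable

lemma mu_eq: "mu s = distr (gauss \<Otimes>\<^sub>M haar_O) borel (sample s)"
  by (simp add: mu_def sample_def gaussian_imat_eq)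

interpretation GH: pair_prob_space gauss haar_O ..

lemma mu_probs: "mu s \<in> borel_probs"
  unfolding mu_eq by (rule prob_space_distr_borel[OF GH.prob_space_axioms]) measurable

lemma diag_mat_mult: "(diag_mat s *v x) $ j = s $ j * x $ j"
  by (simp add: diag_mat_def matrix_vector_mult_def if_distrib[of "\<lambda>a. a * _"] cong: if_cong)

lemma inner_sample_row: "t \<bullet> sample s (g, q) i = (\<Sum>j\<in>UNIV. (s $ j * (q *v t) $ j) * g (i, j))"
proof -
  have "t \<bullet> sample s (g, q) i = (\<chi> j. g (i, j)) \<bullet> ((diag_mat s ** q) *v t)"
    by (simp add: sample_def inner_commute[of t] dot_lmul_matrix)
  then show ?thesis
    by (simp add: matrix_vector_mul_assoc[symmetric] inner_vec_def diag_mat_mult mult_ac)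
qed

text \<open>The variance of the linear form \<open>T\<close> in the rows of the sample,
  conditionally on the Haar matrix \<open>q\<close>.\<close>

definition energy :: "real ^ 'm \<Rightarrow> nat \<Rightarrow> 'm::finite imat \<Rightarrow> real ^ 'm ^ 'm \<Rightarrow> real" where
  "energy s n T q = (\<Sum>i<n. \<Sum>j\<in>UNIV. (s $ j * (q *v T i) $ j)\<^sup>2)"

definition Phi :: "real ^ 'm \<Rightarrow> nat \<Rightarrow> 'm::finite imat \<Rightarrow> real" where
  "Phi s n T = (\<integral>q. exp (- energy s n T q / 2) \<partial>haar_O)"

lemma energy_nonneg: "0 \<le> energy s n T q"
  by (simp add: energy_def sum_nonneg)

lemma energy_measurable [measurable]: "energy s n T \<in> borel_measurable borel"
  unfolding energy_def by measurable

lemma integrable_exp_energy: "integrable haar_O (\<lambda>q. exp (- energy s n T q / 2))"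
  by (intro haar.integrable_const_bound[where B=1]) (auto simp: energy_nonneg)

text \<open>For fixed \<open>q\<close> the linear form is a combination of independent Gaussians
  with variance \<open>energy s n T q\<close>, so the inner integral is an instance of
  \<open>gauss_cos\<close>.\<close>

lemma cf_mu: "cf (mu s) \<theta> n T = cos \<theta> * Phi s n T"
proof -
  have "cf (mu s) \<theta> n T = (\<integral>z. cos (\<theta> + (\<Sum>i<n. T i \<bullet> sample s z i)) \<partial>(gauss \<Otimes>\<^sub>M haar_O))"
    unfolding cf_def mu_eq by (subst integral_distr) auto
  also have "\<dots> = (\<integral>q. \<integral>g. cos (\<theta> + (\<Sum>i<n. T i \<bullet> sample s (g, q) i)) \<partial>gauss \<partial>haar_O)"
  proof -
    define f where "f g q = cos (\<theta> + (\<Sum>i<n. T i \<bullet> sample s (g, q) i))" for g q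
    have "(\<lambda>z. cos (\<theta> + (\<Sum>i<n. T i \<bullet> sample s z i))) = case_prod f"
      by (auto simp: f_def fun_eq_iff)
    moreover have "(\<lambda>z. cos (\<theta> + (\<Sum>i<n. T i \<bullet> sample s z i))) \<in> borel_measurable (gauss \<Otimes>\<^sub>M haar_O)"
      by measurable
    ultimately have "case_prod f \<in> borel_measurable (gauss \<Otimes>\<^sub>M haar_O)" by simp
    then have "integrable (gauss \<Otimes>\<^sub>M haar_O) (case_prod f)"
      by (rule GH.integrable_const_bound[where B = 1, rotated]) (auto simp: f_def)
    then show ?thesis
      using GH.integral_snd[of f] \<open>_ = case_prod f\<close> by (simp add: f_def[abs_def])
  qed
  also have "\<dots> = (\<integral>q. cos \<theta> * exp (- energy s n T q / 2) \<partial>haar_O)"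
  proof (rule Bochner_Integration.integral_cong[OF refl])
    fix q
    have "(\<Sum>i<n. T i \<bullet> sample s (g, q) i) = (\<Sum>p\<in>{..<n} \<times> UNIV. (s $ snd p * (q *v T (fst p)) $ snd p) * g p)" for g
      by (simp add: inner_sample_row sum.cartesian_product case_prod_beta)
    moreover have "energy s n T q = (\<Sum>p\<in>{..<n} \<times> UNIV. (s $ snd p * (q *v T (fst p)) $ snd p)\<^sup>2)"
      by (simp add: energy_def sum.cartesian_product case_prod_beta)
    ultimately show "(\<integral>g. cos (\<theta> + (\<Sum>i<n. T i \<bullet> sample s (g, q) i)) \<partial>gauss) = cos \<theta> * exp (- energy s n T q / 2)"
      by (simp add: gauss_cos)
  qed
  also have "\<dots> = cos \<theta> * Phi s n T" by (simp add: Phi_def)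
  finally show ?thesis .
qed

text \<open>On characteristic functions, \<open>u\<close> mixes the rows of \<open>T\<close> by an
  isometry, which leaves the energy unchanged, and \<open>v\<close> is absorbed by right invariance
  of Haar measure.\<close>

lemma mu_P_inv: "mu s \<in> (P_inv :: 'm::finite imat measure set)"
  unfolding P_inv_def
proof (intro CollectI conjI ballI mu_probs)
  fix u and v :: "real^'m^'m"
  assume u: "u \<in> O_inf" and v: "v \<in> O_fin"
  have sm [measurable_cong]: "sets (mu s) = sets (borel :: 'm imat measure)" using mu_probs[of s] by (simp add: borel_probs_def)
  show "distr (mu s) borel (act u v) = mu s"
  proof (rule cf_eqI[OF _ mu_probs])
    show "distr (mu s) borel (act u v) \<in> borel_probs"
      using mu_probs[of s] by (intro prob_space_distr_borel) (auto simp: borel_probs_def)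
    fix \<theta> n and T :: "'m imat"
    from u obtain N where N: "\<And>i j. N \<le> i + j \<Longrightarrow> u i j = (if i = j then 1 else 0)"
      and orth: "\<And>i j. (\<Sum>k | u i k \<noteq> 0. u i k * u j k) = (if i = j then 1 else 0)"
      by (auto simp: O_inf_def)
    \<comment> \<open>For \<open>i < n\<close> a nonzero \<open>u i k\<close> has
      \<open>k < N\<close> or \<open>k = i\<close>, so the first \<open>n\<close> rows of
      \<open>u\<close> are supported below \<open>M\<close>.\<close>
    define M where "M = max N n"
    have sub: "{k. u i k \<noteq> 0} \<subseteq> {..<M}" if "i < n" for i
    proof
      fix k assume "k \<in> {k. u i k \<noteq> 0}"
      then show "k \<in> {..<M}"
        using N[of i k] that by (cases "N \<le> i + k") (auto simp: M_def split: if_splits)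
    qed
    have row: "(\<Sum>k | u i k \<noteq> 0. u i k *\<^sub>R X k) = (\<Sum>k<M. u i k *\<^sub>R X k)" if "i < n" for i and X :: "'m imat"
      using sub[OF that] by (intro sum.mono_neutral_left) auto
    have orth': "(\<Sum>k<M. u i k * u j k) = (if i = j then 1 else 0)" if "i < n" for i j
      using orth[of i j] sub[OF that] by (subst sum.mono_neutral_right[of "{..<M}" "{k. u i k \<noteq> 0}"]) auto
    \<comment> \<open>The adjoint action on frequencies, u^t T v; it may have more nonzero rows than
      \<open>T\<close>, hence the passage from \<open>n\<close> to \<open>M\<close>.\<close>
    define T' where "T' k = (\<Sum>i<n. u i k *\<^sub>R (transpose v *v T i))" for k
    have adj: "T i \<bullet> (v *v x) = (transpose v *v T i) \<bullet> x" for i x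
      by (simp add: dot_lmul_matrix)
    have "(\<Sum>i<n. T i \<bullet> act u v X i) = (\<Sum>k<M. T' k \<bullet> X k)" for X
    proof -
      have "(\<Sum>i<n. T i \<bullet> act u v X i) = (\<Sum>i<n. \<Sum>k<M. u i k * ((transpose v *v T i) \<bullet> X k))"
        unfolding act_eq[OF v] by (intro sum.cong refl) (simp only: row lessThan_iff adj inner_sum_right inner_scaleR_right)
      also have "\<dots> = (\<Sum>k<M. T' k \<bullet> X k)"
        unfolding T'_def inner_sum_left inner_scaleR_left by (rule sum.swap)
      finally show ?thesis .
    qed
    then have "cf (distr (mu s) borel (act u v)) \<theta> n T = cf (mu s) \<theta> M T'"
      unfolding cf_def by (subst integral_distr) auto
    also have "\<dots> = cos \<theta> * Phi s M T'" by (rule cf_mu)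
    also have "Phi s M T' = Phi s n (\<lambda>i. transpose v *v T i)"
    proof -
      have "energy s M T' q = energy s n (\<lambda>i. transpose v *v T i) q" for q
      proof -
        define z where "z i j = s $ j * (q *v (transpose v *v T i)) $ j" for i j
        have "s $ j * (q *v T' k) $ j = (\<Sum>i<n. u i k * z i j)" for j k
          by (simp add: T'_def z_def matrix_vector_mult_scaleR sum_distrib_left mult_ac
              linear_sum[OF matrix_vector_mul_linear])
        then have "energy s M T' q = (\<Sum>j\<in>UNIV. \<Sum>k<M. (\<Sum>i<n. u i k * z i j)\<^sup>2)"
          unfolding energy_def by (subst sum.swap) simp
        \<comment> \<open>Parseval: the first \<open>n\<close> rows of \<open>u\<close> are
          orthonormal.\<close>
        also have "\<dots> = (\<Sum>j\<in>UNIV. \<Sum>i<n. (z i j)\<^sup>2)"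
        proof (rule sum.cong[OF refl])
          fix j
          have "(\<Sum>k<M. (\<Sum>i<n. u i k * z i j)\<^sup>2) = (\<Sum>k<M. \<Sum>i<n. \<Sum>i'<n. z i j * z i' j * (u i k * u i' k))"
            by (simp add: power2_eq_square sum_product mult_ac)
          also have "\<dots> = (\<Sum>i<n. \<Sum>i'<n. z i j * z i' j * (\<Sum>k<M. u i k * u i' k))"
            unfolding sum_distrib_left by (subst sum.swap) (subst sum.swap[of _ "{..<n}" "{..<M}"], rule refl)
          also have "\<dots> = (\<Sum>i<n. \<Sum>i'<n. z i j * z i' j * (if i = i' then 1 else 0))"
            by (intro sum.cong refl) (simp only: orth' lessThan_iff)
          also have "\<dots> = (\<Sum>i<n. (z i j)\<^sup>2)"
            by (simp add: if_distrib power2_eq_square cong: if_cong)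
          finally show "(\<Sum>k<M. (\<Sum>i<n. u i k * z i j)\<^sup>2) = (\<Sum>i<n. (z i j)\<^sup>2)" .
        qed
        also have "\<dots> = energy s n (\<lambda>i. transpose v *v T i) q"
          unfolding energy_def z_def by (rule sum.swap)
        finally show ?thesis .
      qed
      then show ?thesis by (simp add: Phi_def)
    qed
    also have "\<dots> = (\<integral>q. exp (- energy s n T (q ** transpose v) / 2) \<partial>haar_O)"
      by (simp only: Phi_def energy_def matrix_vector_mul_assoc)
    also have "\<dots> = Phi s n T"
      unfolding Phi_def using v by (intro integral_haar_right) auto
    finally show "cf (distr (mu s) borel (act u v)) \<theta> n T = cf (mu s) \<theta> n T"
      by (simp add: cf_mu)
  qed
qed

section \<open>Principal axes and the averages over O(m)\<close>

lemma O_fin_iff_rows: "v \<in> O_fin \<longleftrightarrow> (\<forall>i j. v $ i \<bullet> v $ j = (if i = j then 1 else 0))"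
proof -
  have "(v ** transpose v) $ i $ j = v $ i \<bullet> v $ j" for i j
    by (simp add: matrix_matrix_mult_def transpose_def inner_vec_def)
  then have "v ** transpose v = mat 1 \<longleftrightarrow> (\<forall>i j. v $ i \<bullet> v $ j = (if i = j then 1 else 0))"
    by (simp add: vec_eq_iff mat_def)
  then show ?thesis
    unfolding O_fin_iff using matrix_left_right_inverse[of v "transpose v"] by auto
qed

text \<open>
  The maximiser \<open>v\<close> of \<open>\<Sum>i. d i * B (v $ i) (v $ i)\<close> over the orthogonal matrices, for strictly decreasing weights
  \<open>d\<close>, diagonalises \<open>B\<close> and sorts its eigenvalues: compare with \<open>v\<close> rotated in the plane of two rows.
\<close>

lemma sorted_principal_axes:
  fixes X :: "nat \<Rightarrow> (real, 'm::{finite,linorder}) vec"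
  assumes w: "0 \<le> w"
  shows "\<exists>v\<in>O_fin. \<exists>s\<in>Delta. \<forall>x. (\<Sum>k<N. w * (x \<bullet> X k)\<^sup>2) = (\<Sum>i\<in>UNIV. (s $ i * (v *v x) $ i)\<^sup>2)"
proof -
  define B where "B x y = (\<Sum>k<N. w * (x \<bullet> X k) * (y \<bullet> X k))" for x y
  have B_comb: "B (a *\<^sub>R x + b *\<^sub>R y) (a *\<^sub>R x + b *\<^sub>R y) = a\<^sup>2 * B x x + 2 * a * b * B x y + b\<^sup>2 * B y y" for a b x y
    unfolding B_def sum_distrib_left sum.distrib[symmetric]
    by (intro sum.cong refl) (simp add: inner_add_left power2_eq_square algebra_simps)
  \<comment> \<open>Any strictly decreasing weights would do; counting the larger indices gives such
    weights on an abstract linear order.\<close>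
  define d :: "'m \<Rightarrow> real" where "d i = real (card {k. i < k})" for i
  have d: "d j < d i" if "i < j" for i j
  proof -
    have "{k. j < k} \<subset> {k. i < k}" using that by (auto simp: psubset_eq)
    then show ?thesis unfolding d_def by (simp add: psubset_card_mono)
  qed
  define f where "f v = (\<Sum>i\<in>UNIV. d i * B (v $ i) (v $ i))" for v :: "((real, 'm) vec, 'm) vec"
  have "continuous_on O_fin f" unfolding f_def B_def by (intro continuous_intros)
  moreover have "(O_fin :: (((real, 'm) vec, 'm) vec) set) \<noteq> {}" using O_fin_id by blast
  ultimately obtain v where v: "v \<in> O_fin" "\<And>v'. v' \<in> O_fin \<Longrightarrow> f v' \<le> f v"
    using continuous_attains_sup[OF compact_O_fin] by blast
  have rows: "v $ i \<bullet> v $ j = (if i = j then 1 else 0)" for i j using v(1) by (simp add: O_fin_iff_rows)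
  have rot: "c\<^sup>2 * B (v $ i) (v $ i) + 2 * c * \<sigma> * B (v $ i) (v $ j) + \<sigma>\<^sup>2 * B (v $ j) (v $ j) \<le> B (v $ i) (v $ i)"
    if ij: "i < j" and c: "c\<^sup>2 + \<sigma>\<^sup>2 = 1" for i j c \<sigma>
  proof -
    define v' where "v' = (\<chi> k. if k = i then c *\<^sub>R v $ i + \<sigma> *\<^sub>R v $ j else if k = j then (- \<sigma>) *\<^sub>R v $ i + c *\<^sub>R v $ j else v $ k)"
    have v'i: "v' $ i = c *\<^sub>R v $ i + \<sigma> *\<^sub>R v $ j" and v'j: "v' $ j = (- \<sigma>) *\<^sub>R v $ i + c *\<^sub>R v $ j"
      and v'k: "\<And>k. k \<noteq> i \<Longrightarrow> k \<noteq> j \<Longrightarrow> v' $ k = v $ k"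
      using ij by (auto simp: v'_def)
    have "v' \<in> O_fin" unfolding O_fin_iff_rows
    proof (intro allI)
      fix a b
      consider "a = i" | "a = j" | "a \<noteq> i" "a \<noteq> j" by blast
      then show "v' $ a \<bullet> v' $ b = (if a = b then 1 else 0)"
      proof cases
        case 1
        then show ?thesis using ij c
          by (cases "b = i"; cases "b = j") (auto simp: v'i v'j v'k inner_add_left inner_add_right rows power2_eq_square algebra_simps)
      next
        case 2
        then show ?thesis using ij c
          by (cases "b = i"; cases "b = j") (auto simp: v'i v'j v'k inner_add_left inner_add_right rows power2_eq_square algebra_simps)
      next
        case 3
        then show ?thesis using ij c
          by (cases "b = i"; cases "b = j") (auto simp: v'i v'j v'k inner_add_left inner_add_right rows power2_eq_square algebra_simps)
      qed
    qed
    then have "f v' \<le> f v" by (rule v(2))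
    moreover have split: "f x = d i * B (x $ i) (x $ i) + d j * B (x $ j) (x $ j) + (\<Sum>k\<in>UNIV - {i,j}. d k * B (x $ k) (x $ k))" for x
    proof -
      have "UNIV = insert i (insert j (UNIV - {i,j}))" by auto
      then have "f x = (\<Sum>k\<in>insert i (insert j (UNIV - {i,j})). d k * B (x $ k) (x $ k))" by (simp add: f_def)
      also have "\<dots> = d i * B (x $ i) (x $ i) + (d j * B (x $ j) (x $ j) + (\<Sum>k\<in>UNIV - {i,j}. d k * B (x $ k) (x $ k)))"
        using ij by (subst sum.insert, simp, simp) (subst sum.insert, auto)
      finally show ?thesis by simp
    qed
    moreover have "(\<Sum>k\<in>UNIV - {i,j}. d k * B (v' $ k) (v' $ k)) = (\<Sum>k\<in>UNIV - {i,j}. d k * B (v $ k) (v $ k))"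
      by (intro sum.cong) (auto simp: v'k)
    ultimately have le: "d i * B (v' $ i) (v' $ i) + d j * B (v' $ j) (v' $ j) \<le> d i * B (v $ i) (v $ i) + d j * B (v $ j) (v $ j)"
      by simp
    have Bi: "B (v' $ i) (v' $ i) = c\<^sup>2 * B (v $ i) (v $ i) + 2 * c * \<sigma> * B (v $ i) (v $ j) + \<sigma>\<^sup>2 * B (v $ j) (v $ j)"
      unfolding v'i by (rule B_comb)
    have Bj: "B (v' $ j) (v' $ j) = \<sigma>\<^sup>2 * B (v $ i) (v $ i) - 2 * c * \<sigma> * B (v $ i) (v $ j) + c\<^sup>2 * B (v $ j) (v $ j)"
      unfolding v'j B_comb by simp
    \<comment> \<open>The rotation preserves the trace of \<open>B\<close> on the plane, so a gain
      in row \<open>i\<close> is a loss in row \<open>j\<close>; as \<open>d j < d i\<close>,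
      maximality rules out a gain in row \<open>i\<close>.\<close>
    have "B (v' $ i) (v' $ i) + B (v' $ j) (v' $ j) = (c\<^sup>2 + \<sigma>\<^sup>2) * (B (v $ i) (v $ i) + B (v $ j) (v $ j))"
      unfolding Bi Bj by (simp add: algebra_simps)
    then have "B (v' $ j) (v' $ j) - B (v $ j) (v $ j) = - (B (v' $ i) (v' $ i) - B (v $ i) (v $ i))"
      using c by simp
    then have "(d i - d j) * (B (v' $ i) (v' $ i) - B (v $ i) (v $ i)) \<le> 0"
      using le by (smt (verit, ccfv_SIG) left_diff_distrib right_diff_distrib mult_minus_right)
    then show ?thesis using d[OF ij] unfolding Bi by (simp add: mult_le_0_iff)
  qed
  \<comment> \<open>A quarter turn moves row \<open>j\<close> into position
    \<open>i\<close>.\<close>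
  have sorted: "B (v $ j) (v $ j) \<le> B (v $ i) (v $ i)" if "i < j" for i j
    using rot[OF that, of 0 1] by simp
  have offdiag: "B (v $ i) (v $ j) = 0" if ij: "i < j" for i j
  proof (rule ccontr)
    define \<alpha> \<beta> \<gamma> where "\<alpha> = B (v $ i) (v $ i)" and "\<beta> = B (v $ i) (v $ j)" and "\<gamma> = B (v $ j) (v $ j)"
    assume "B (v $ i) (v $ j) \<noteq> 0"
    then have \<beta>: "\<beta> \<noteq> 0" by (simp add: \<beta>_def)
    \<comment> \<open>\<open>x = \<beta> / m\<close> will be the tangent of the angle: the gain 2 x
      \<beta> of first order then exceeds the loss x^2 (\<alpha> - \<gamma>). The summand 1 keeps
      \<open>m\<close> positive when \<alpha> = \<gamma>.\<close>
    define m where "m = \<alpha> - \<gamma> + 1"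
    have m: "m > 0" using sorted[OF ij] by (simp add: m_def \<alpha>_def \<gamma>_def)
    define x where "x = \<beta> / m"
    define r where "r = sqrt (1 + x\<^sup>2)"
    have r: "r\<^sup>2 = 1 + x\<^sup>2" "r > 0" using zero_le_power2[of x] by (auto simp: r_def add_pos_nonneg)
    have "(1 / r)\<^sup>2 + (x / r)\<^sup>2 = 1"
    proof -
      have "(1 / r)\<^sup>2 + (x / r)\<^sup>2 = (1 + x\<^sup>2) / r\<^sup>2" by (simp add: power_divide add_divide_distrib)
      also have "\<dots> = 1" unfolding r(1)[symmetric] using r(2) by simp
      finally show ?thesis .
    qed
    from rot[OF ij this] have "(1 / r)\<^sup>2 * \<alpha> + 2 * (1 / r) * (x / r) * \<beta> + (x / r)\<^sup>2 * \<gamma> \<le> \<alpha>"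
      by (simp add: \<alpha>_def \<beta>_def \<gamma>_def)
    then have "((1 / r)\<^sup>2 * \<alpha> + 2 * (1 / r) * (x / r) * \<beta> + (x / r)\<^sup>2 * \<gamma>) * r\<^sup>2 \<le> \<alpha> * r\<^sup>2"
      by (rule mult_right_mono) simp
    moreover have "((1 / r)\<^sup>2 * \<alpha> + 2 * (1 / r) * (x / r) * \<beta> + (x / r)\<^sup>2 * \<gamma>) * r\<^sup>2 = \<alpha> + 2 * x * \<beta> + x\<^sup>2 * \<gamma>"
      using r(2) by (simp add: field_simps power2_eq_square)
    ultimately have "2 * x * \<beta> \<le> x\<^sup>2 * (\<alpha> - \<gamma>)" unfolding r(1) by (simp add: algebra_simps)
    also have "\<alpha> - \<gamma> = m - 1" by (simp add: m_def)
    finally have "2 * x * \<beta> * m\<^sup>2 \<le> x\<^sup>2 * (m - 1) * m\<^sup>2" by (rule mult_right_mono) simp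
    moreover have xm: "x * m = \<beta>" using m by (simp add: x_def)
    have "2 * x * \<beta> * m\<^sup>2 = 2 * \<beta>\<^sup>2 * m" "x\<^sup>2 * (m - 1) * m\<^sup>2 = \<beta>\<^sup>2 * (m - 1)"
      unfolding xm[symmetric] by (simp_all add: power2_eq_square mult_ac)
    ultimately have "2 * \<beta>\<^sup>2 * m \<le> \<beta>\<^sup>2 * (m - 1)" by simp
    then have "\<beta>\<^sup>2 * (m + 1) \<le> 0" by (simp add: algebra_simps)
    then show False using \<beta> m by (simp add: mult_le_0_iff)
  qed
  have Bsym: "B x y = B y x" for x y by (simp add: B_def mult_ac)
  have off: "B (v $ i) (v $ j) = 0" if "i \<noteq> j" for i j
    using that offdiag[of i j] offdiag[of j i] Bsym by (metis neqE)
  have Bpos: "0 \<le> B x x" for x unfolding B_def using w by (auto intro!: sum_nonneg simp: mult.assoc)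
  define s :: "(real, 'm) vec" where "s = (\<chi> i. sqrt (B (v $ i) (v $ i)))"
  have s2: "(s $ i)\<^sup>2 = B (v $ i) (v $ i)" for i using Bpos by (simp add: s_def)
  have "s \<in> Delta" unfolding Delta_def
  proof (intro CollectI conjI allI impI)
    show "s $ j \<le> s $ i" if "i \<le> j" for i j
      using sorted[of i j] that by (cases "i = j") (auto simp: s_def)
  qed (simp add: s_def Bpos)
  moreover have "(\<Sum>k<N. w * (x \<bullet> X k)\<^sup>2) = (\<Sum>i\<in>UNIV. (s $ i * (v *v x) $ i)\<^sup>2)" for x
  proof -
    define z where "z = v *v x"
    have zi: "z $ i = v $ i \<bullet> x" for i by (simp add: z_def matrix_vector_mult_def inner_vec_def)
    have "x = transpose v *v z" using v(1) unfolding z_def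
      by (simp only: matrix_vector_mul_assoc O_fin_iff matrix_vector_mul_lid)
    then have "x \<bullet> y = z \<bullet> (v *v y)" for y by (simp add: dot_lmul_matrix)
    then have xy: "x \<bullet> y = (\<Sum>i\<in>UNIV. z $ i * (v $ i \<bullet> y))" for y
      by (simp add: inner_vec_def matrix_vector_mult_def)
    have "(\<Sum>k<N. w * (x \<bullet> X k)\<^sup>2) = (\<Sum>k<N. \<Sum>i\<in>UNIV. \<Sum>j\<in>UNIV. z $ i * z $ j * (w * (v $ i \<bullet> X k) * (v $ j \<bullet> X k)))"
    proof (rule sum.cong[OF refl])
      fix k
      show "w * (x \<bullet> X k)\<^sup>2 = (\<Sum>i\<in>UNIV. \<Sum>j\<in>UNIV. z $ i * z $ j * (w * (v $ i \<bullet> X k) * (v $ j \<bullet> X k)))"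
        unfolding xy power2_eq_square sum_product by (subst sum_distrib_left) (simp only: sum_distrib_left mult_ac)
    qed
    also have "\<dots> = (\<Sum>i\<in>UNIV. \<Sum>j\<in>UNIV. z $ i * z $ j * B (v $ i) (v $ j))"
      unfolding B_def sum_distrib_left by (subst sum.swap) (subst sum.swap[of _ UNIV "{..<N}"], rule refl)
    also have "\<dots> = (\<Sum>i\<in>UNIV. \<Sum>j\<in>UNIV. if j = i then z $ i * z $ i * B (v $ i) (v $ i) else 0)"
      by (intro sum.cong refl) (auto simp: off)
    also have "\<dots> = (\<Sum>i\<in>UNIV. (s $ i * z $ i)\<^sup>2)"
      by (simp add: power_mult_distrib s2 power2_eq_square[of "z $ _"] mult_ac)
    finally show ?thesis by (simp add: z_def)
  qed
  ultimately show ?thesis using v(1) by blast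
qed

text \<open>The R(N, T) of the overview.\<close>

definition stat_avg :: "nat \<Rightarrow> nat \<Rightarrow> 'm::finite imat \<Rightarrow> 'm imat \<Rightarrow> real" where
  "stat_avg N n T X = (\<integral>v. (\<Prod>a<n. gauss_stat {..<N} (v *v T a) X) \<partial>haar_O)"

text \<open>In principal axes the exponent of the product at \<open>q\<close> is the energy at
  \<open>v ** q\<close>, and \<open>v\<close> disappears by left invariance. One \<open>s\<close>
  serves all \<open>n\<close> and \<open>T\<close>, since the axes depend only on \<open>N\<close>
  and \<open>X\<close>.\<close>

lemma stat_avg_eq_Phi:
  fixes X :: "'m::{finite,linorder} imat"
  shows "\<exists>s\<in>Delta. \<forall>n T. stat_avg N n T X = Phi s n T"
proof -
  obtain v s where v: "v \<in> O_fin" and s: "s \<in> Delta"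
    and vs: "\<And>x. (\<Sum>k<N. 1 / real N * (x \<bullet> X k)\<^sup>2) = (\<Sum>i\<in>UNIV. (s $ i * (v *v x) $ i)\<^sup>2)"
    using sorted_principal_axes[where w = "1 / real N" and N = N and X = X] by auto
  have "stat_avg N n T X = Phi s n T" for n T
  proof -
    have "(\<Prod>a<n. gauss_stat {..<N} (q *v T a) X) = exp (- energy s n T (v ** q) / 2)" for q
      unfolding gauss_stat_def card_lessThan vs energy_def matrix_vector_mul_assoc
      by (simp only: exp_sum[OF finite_lessThan, symmetric]) (simp add: sum_negf sum_divide_distrib)
    then have "stat_avg N n T X = (\<integral>q. exp (- energy s n T (v ** q) / 2) \<partial>haar_O)"
      by (simp add: stat_avg_def)
    also have "\<dots> = Phi s n T"
      unfolding Phi_def using v by (intro integral_haar_left) auto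
    finally show ?thesis .
  qed
  then show ?thesis using s by blast
qed

section \<open>Convergence under ergodic measures\<close>

text \<open>The transposes give the inverse action. It is needed because
  \<open>invariant_set\<close> speaks of images, while invariant functions produce
  preimages.\<close>

lemma act_inverse:
  assumes u: "u \<in> O_inf" and v: "v \<in> O_fin"
  shows "(\<lambda>i j. u j i) \<in> O_inf" and "act u v (act (\<lambda>i j. u j i) (transpose v) X) = X"
proof -
  from u obtain N0 where N0: "\<And>i j. N0 \<le> i + j \<Longrightarrow> u i j = (if i = j then 1 else 0)"
    and orth: "\<And>i j. (\<Sum>k | u i k \<noteq> 0. u i k * u j k) = (if i = j then 1 else 0)"
    and orth': "\<And>i j. (\<Sum>k | u k i \<noteq> 0. u k i * u k j) = (if i = j then 1 else 0)"
    by (auto simp: O_inf_def)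
  have "\<forall>i j. N0 \<le> i + j \<longrightarrow> u j i = (if i = j then 1 else 0)"
    using N0 by (auto simp: add.commute)
  then show "(\<lambda>i j. u j i) \<in> O_inf"
    unfolding O_inf_def mem_Collect_eq using orth orth' by (intro conjI exI[of _ N0]) auto
  show "act u v (act (\<lambda>i j. u j i) (transpose v) X) = X"
  proof
    fix i
    \<comment> \<open>Nonzero entries of \<open>u\<close> in a row or column below \<open>N\<close>
      also lie below \<open>N\<close>, so all sums run over a finite orthogonal block, which
      contains row \<open>i\<close>.\<close>
    define N where "N = max N0 (Suc i)"
    have iN: "i < N" by (simp add: N_def)
    have sub: "{k. u a k \<noteq> 0} \<subseteq> {..<N}" "{k. u k a \<noteq> 0} \<subseteq> {..<N}" if "a < N" for a
    proof -
      show "{k. u a k \<noteq> 0} \<subseteq> {..<N}"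
      proof
        fix k assume "k \<in> {k. u a k \<noteq> 0}"
        then show "k \<in> {..<N}" using N0[of a k] that by (cases "N0 \<le> a + k") (auto simp: N_def split: if_splits)
      qed
      show "{k. u k a \<noteq> 0} \<subseteq> {..<N}"
      proof
        fix k assume "k \<in> {k. u k a \<noteq> 0}"
        then show "k \<in> {..<N}" using N0[of k a] that by (cases "N0 \<le> k + a") (auto simp: N_def split: if_splits)
      qed
    qed
    have row: "(\<Sum>k | u a k \<noteq> 0. u a k *\<^sub>R Y k) = (\<Sum>k<N. u a k *\<^sub>R Y k)"
      and col: "(\<Sum>k | u k a \<noteq> 0. u k a *\<^sub>R Y k) = (\<Sum>k<N. u k a *\<^sub>R Y k)" if "a < N" for a and Y :: "'a imat"
      using sub[OF that] by (auto intro!: sum.mono_neutral_left)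
    have orthN: "(\<Sum>k<N. u i k * u l k) = (if i = l then 1 else 0)" for l
      using orth[of i l] sub(1)[OF iN] by (subst sum.mono_neutral_right[of "{..<N}" "{k. u i k \<noteq> 0}"]) auto
    have tv: "transpose v \<in> O_fin" using v by simp
    have vv: "v *v (transpose v *v x) = x" for x
      using v by (simp only: matrix_vector_mul_assoc O_fin_iff matrix_vector_mul_lid)
    have "act u v (act (\<lambda>i j. u j i) (transpose v) X) i = v *v (\<Sum>k<N. u i k *\<^sub>R act (\<lambda>i j. u j i) (transpose v) X k)"
      unfolding act_eq[OF v, of u] by (subst row[OF iN]) (rule refl)
    also have "\<dots> = v *v (\<Sum>k<N. u i k *\<^sub>R (transpose v *v (\<Sum>l<N. u l k *\<^sub>R X l)))"
      by (intro arg_cong[where f = "\<lambda>x. v *v x"] sum.cong refl) (simp only: act_eq[OF tv] col lessThan_iff)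
    also have "\<dots> = v *v (transpose v *v (\<Sum>k<N. u i k *\<^sub>R (\<Sum>l<N. u l k *\<^sub>R X l)))"
      by (simp only: linear_sum[OF matrix_vector_mul_linear] matrix_vector_mult_scaleR)
    also have "\<dots> = (\<Sum>k<N. \<Sum>l<N. (u i k * u l k) *\<^sub>R X l)"
      by (simp only: vv scaleR_sum_right scaleR_scaleR)
    also have "\<dots> = (\<Sum>l<N. (\<Sum>k<N. u i k * u l k) *\<^sub>R X l)"
      unfolding scaleR_sum_left by (rule sum.swap)
    also have "\<dots> = X i"
      using iN by (simp add: orthN if_distrib[of "\<lambda>a. a *\<^sub>R _"] cong: if_cong)
    finally show "act u v (act (\<lambda>i j. u j i) (transpose v) X) i = X i" .
  qed
qed

lemma gauss_stat_rotate:
  "v \<in> O_fin \<Longrightarrow> gauss_stat K (v *v t) X = gauss_stat K t (act id_mat (transpose v) X)"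
  by (simp add: gauss_stat_def act_id_mat inner_commute[of "v *v t"] dot_lmul_matrix inner_commute[of t])

lemma gauss_stat_haar_measurable [measurable]:
  "(\<lambda>v. gauss_stat K (v *v t) X) \<in> borel_measurable borel"
  "(\<lambda>(X, v). gauss_stat K (v *v t) X) \<in> borel_measurable (borel \<Otimes>\<^sub>M borel)"
  unfolding gauss_stat_def case_prod_beta by measurable

lemma prod_gauss_stat_bounds:
  "0 \<le> (\<Prod>a<n. gauss_stat K (t a) X)" "(\<Prod>a<n. gauss_stat K (t a) X) \<le> 1"
  by (auto intro!: prod_nonneg prod_le_1 less_imp_le[OF gauss_stat_bounds(1)] gauss_stat_bounds(2))

lemma stat_avg_integrable: "integrable haar_O (\<lambda>v. \<Prod>a<n. gauss_stat K (v *v T a) X)"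
  by (intro haar.integrable_const_bound[where B = 1])
    (auto simp: abs_prod intro!: prod_gauss_stat_bounds)

lemma stat_avg_bounds:
  fixes X :: "'m::finite imat"
  shows "0 \<le> stat_avg N n T X" "stat_avg N n T X \<le> 1"
proof -
  show "0 \<le> stat_avg N n T X" unfolding stat_avg_def
    by (intro Bochner_Integration.integral_nonneg prod_gauss_stat_bounds)
  have "stat_avg N n T X \<le> (\<integral>v. 1 \<partial>(haar_O :: (real^'m^'m) measure))" unfolding stat_avg_def
    by (intro integral_mono stat_avg_integrable prod_gauss_stat_bounds) auto
  then show "stat_avg N n T X \<le> 1" by (simp add: )
qed

lemma stat_avg_measurable [measurable]: "stat_avg N n T \<in> borel_measurable borel"
  unfolding stat_avg_def by measurable

text \<open>Once \<open>N\<close> exceeds the nontrivial block of \<open>u\<close>, the first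
  \<open>N\<close> rows are mixed by an orthogonal matrix, which preserves the sum of squares in the
  exponent; \<open>v\<close> is absorbed by Haar measure. The threshold depends on \<open>u\<close>
  alone.\<close>

lemma stat_avg_act:
  assumes u: "u \<in> O_inf"
  shows "\<exists>N0. \<forall>N\<ge>N0. \<forall>v\<in>O_fin. \<forall>n T X. stat_avg N n T (act u v X) = stat_avg N n T X"
proof -
  from u obtain N0 where N0: "\<And>i j. N0 \<le> i + j \<Longrightarrow> u i j = (if i = j then 1 else 0)"
    and orth: "\<And>i j. (\<Sum>k | u k i \<noteq> 0. u k i * u k j) = (if i = j then 1 else 0)"
    by (auto simp: O_inf_def)
  have "stat_avg N n T (act u v X) = stat_avg N n T X" if N: "N0 \<le> N" and v: "v \<in> O_fin"
    for N v n and T :: "'a imat" and X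
  proof -
    have sub: "{k. u i k \<noteq> 0} \<subseteq> {..<N}" "{k. u k i \<noteq> 0} \<subseteq> {..<N}" if "i < N" for i
    proof -
      show "{k. u i k \<noteq> 0} \<subseteq> {..<N}"
      proof
        fix k assume "k \<in> {k. u i k \<noteq> 0}"
        then show "k \<in> {..<N}" using N0[of i k] that N by (cases "N0 \<le> i + k") (auto split: if_splits)
      qed
      show "{k. u k i \<noteq> 0} \<subseteq> {..<N}"
      proof
        fix k assume "k \<in> {k. u k i \<noteq> 0}"
        then show "k \<in> {..<N}" using N0[of k i] that N by (cases "N0 \<le> k + i") (auto split: if_splits)
      qed
    qed
    have row: "(\<Sum>k | u i k \<noteq> 0. u i k *\<^sub>R X k) = (\<Sum>k<N. u i k *\<^sub>R X k)" if "i < N" for i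
      using sub[OF that] by (intro sum.mono_neutral_left) auto
    have orth': "(\<Sum>k<N. u k i * u k j) = (if i = j then 1 else 0)" if "i < N" for i j
      using orth[of i j] sub(2)[OF that] by (subst sum.mono_neutral_right[of "{..<N}" "{k. u k i \<noteq> 0}"]) auto
    have stat: "gauss_stat {..<N} t (act u v X) = gauss_stat {..<N} (transpose v *v t) X" for t
    proof -
      define z where "z k = (transpose v *v t) \<bullet> X k" for k
      have "t \<bullet> act u v X i = (\<Sum>k<N. u i k * z k)" if "i < N" for i
      proof -
        have "t \<bullet> act u v X i = (transpose v *v t) \<bullet> (\<Sum>k<N. u i k *\<^sub>R X k)"
          unfolding act_eq[OF v] row[OF that] by (simp add: dot_lmul_matrix)
        then show ?thesis by (simp only: inner_sum_right inner_scaleR_right z_def)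
      qed
      then have "(\<Sum>i<N. (t \<bullet> act u v X i)\<^sup>2) = (\<Sum>i<N. (\<Sum>k<N. u i k * z k)\<^sup>2)" by simp
      also have "\<dots> = (\<Sum>i<N. \<Sum>k<N. \<Sum>l<N. z k * z l * (u i k * u i l))"
        by (simp add: power2_eq_square sum_product mult_ac)
      also have "\<dots> = (\<Sum>k<N. \<Sum>i<N. \<Sum>l<N. z k * z l * (u i k * u i l))" by (rule sum.swap)
      also have "\<dots> = (\<Sum>k<N. \<Sum>l<N. \<Sum>i<N. z k * z l * (u i k * u i l))"
        by (intro sum.cong[OF refl] sum.swap)
      also have "\<dots> = (\<Sum>k<N. \<Sum>l<N. z k * z l * (\<Sum>i<N. u i k * u i l))"
        by (simp only: sum_distrib_left)
      also have "\<dots> = (\<Sum>k<N. \<Sum>l<N. z k * z l * (if k = l then 1 else 0))"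
        by (intro sum.cong refl) (simp only: orth' lessThan_iff)
      also have "\<dots> = (\<Sum>k<N. (z k)\<^sup>2)"
        by (simp add: if_distrib power2_eq_square cong: if_cong)
      finally show ?thesis by (simp add: gauss_stat_def z_def sum_distrib_left[symmetric] sum_divide_distrib[symmetric] del: transpose_matrix_vector)
    qed
    have "stat_avg N n T (act u v X) = (\<integral>w. (\<Prod>a<n. gauss_stat {..<N} ((transpose v ** w) *v T a) X) \<partial>haar_O)"
      unfolding stat_avg_def stat matrix_vector_mul_assoc ..
    also have "\<dots> = stat_avg N n T X"
      unfolding stat_avg_def using v by (intro integral_haar_left) auto
    finally show ?thesis .
  qed
  then show ?thesis by blast
qed

lemma
  fixes \<mu> :: "'m::finite imat measure"
  assumes \<mu>: "\<mu> \<in> borel_probs"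
  shows integrable_stat_avg: "integrable \<mu> (stat_avg N n T)"
    and expectation_stat_avg: "(\<integral>X. stat_avg N n T X \<partial>\<mu>) = (\<integral>v. \<integral>X. (\<Prod>a<n. gauss_stat {..<N} (v *v T a) X) \<partial>\<mu> \<partial>haar_O)"
proof -
  interpret prob_space \<mu> using \<mu> by (simp add: borel_probs_def)
  have [measurable_cong]: "sets \<mu> = sets borel" using \<mu> by (simp add: borel_probs_def)
  interpret P: pair_prob_space \<mu> haar_O ..
  show "integrable \<mu> (stat_avg N n T)"
    by (intro integrable_const_bound[where B = 1]) (auto simp: stat_avg_bounds)
  have "integrable (\<mu> \<Otimes>\<^sub>M haar_O) (\<lambda>(X, v). \<Prod>a<n. gauss_stat {..<N} (v *v T a) X)"
    by (intro P.integrable_const_bound[where B = 1])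
      (auto simp: abs_prod intro!: prod_gauss_stat_bounds)
  from P.Fubini_integral[OF this]
  show "(\<integral>X. stat_avg N n T X \<partial>\<mu>) = (\<integral>v. \<integral>X. (\<Prod>a<n. gauss_stat {..<N} (v *v T a) X) \<partial>\<mu> \<partial>haar_O)"
    unfolding stat_avg_def ..
qed

lemma expectation_rotate:
  fixes t :: "'m::finite imat"
  assumes \<mu>: "\<mu> \<in> P_inv" and v: "v \<in> O_fin"
  shows "(\<integral>X. (\<Prod>a<n. gauss_stat K (v *v t a) X) \<partial>\<mu>) = (\<integral>X. (\<Prod>a<n. gauss_stat K (t a) X) \<partial>\<mu>)"
    and "(\<integral>X. \<bar>gauss_stat K (v *v s) X - gauss_stat L (v *v s) X\<bar> \<partial>\<mu>) = (\<integral>X. \<bar>gauss_stat K s X - gauss_stat L s X\<bar> \<partial>\<mu>)"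
  using P_inv_integral[OF \<mu> id_mat_O_inf, of "transpose v" "\<lambda>X. \<Prod>a<n. gauss_stat K (t a) X"]
    P_inv_integral[OF \<mu> id_mat_O_inf, of "transpose v" "\<lambda>X. \<bar>gauss_stat K s X - gauss_stat L s X\<bar>"] v
  by (simp_all add: gauss_stat_rotate)

text \<open>By invariance of \<mu> every \<open>v\<close> in the average contributes the same mean,
  so averaging over O(m) leaves expectations unchanged.\<close>

lemma expectation_stat_avg_tendsto:
  fixes T :: "'m::finite imat"
  assumes \<mu>: "\<mu> \<in> P_inv"
  shows "(\<lambda>N. \<integral>X. stat_avg N n T X \<partial>\<mu>) \<longlonglongrightarrow> cf \<mu> 0 n T"
proof -
  have "(\<integral>X. stat_avg N n T X \<partial>\<mu>) = (\<integral>X. (\<Prod>a<n. gauss_stat {..<N} (T a) X) \<partial>\<mu>)" for N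
  proof -
    have "(\<integral>X. stat_avg N n T X \<partial>\<mu>) = (\<integral>v. (\<integral>X. (\<Prod>a<n. gauss_stat {..<N} (T a) X) \<partial>\<mu>) \<partial>(haar_O :: (real^'m^'m) measure))"
      unfolding expectation_stat_avg[OF P_inv_probs[OF \<mu>]]
    proof (rule integral_cong_AE)
      interpret prob_space \<mu> using \<mu> by (rule P_inv_prob_space)
      note [measurable_cong] = P_inv_sets[OF \<mu>]
      show "(\<lambda>v. \<integral>X. (\<Prod>a<n. gauss_stat {..<N} (v *v T a) X) \<partial>\<mu>) \<in> borel_measurable haar_O"
        by measurable
      show "AE v in haar_O. (\<integral>X. (\<Prod>a<n. gauss_stat {..<N} (v *v T a) X) \<partial>\<mu>) = (\<integral>X. (\<Prod>a<n. gauss_stat {..<N} (T a) X) \<partial>\<mu>)"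
        using AE_haar_O by eventually_elim (rule expectation_rotate(1)[OF \<mu>])
    qed simp
    then show ?thesis by (simp add: )
  qed
  then show ?thesis using gauss_stat_prod_tendsto[OF \<mu>] by simp
qed

text \<open>Invariance of \<mu> makes the mean distance of the rotated statistics independent of
  \<open>v\<close>, so the bound at \<open>T\<close> is uniform over O(m) and can be integrated by
  Fubini.\<close>

lemma stat_avg_Cauchy:
  fixes T :: "'m::finite imat"
  assumes \<mu>: "\<mu> \<in> P_inv" and "0 < \<epsilon>"
  shows "\<exists>N0. \<forall>N\<ge>N0. \<forall>N'\<ge>N0. (\<integral>X. \<bar>stat_avg N n T X - stat_avg N' n T X\<bar> \<partial>\<mu>) < \<epsilon>"
proof -
  interpret prob_space \<mu> using \<mu> by (rule P_inv_prob_space)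
  note sets [measurable_cong] = P_inv_sets[OF \<mu>]
  note \<mu>b = P_inv_probs[OF \<mu>]
  interpret P: pair_prob_space \<mu> haar_O ..
  define e where "e = \<epsilon> / Suc n"
  have e: "0 < e" using \<open>0 < \<epsilon>\<close> by (simp add: e_def)
  from gauss_stat_close_family[OF \<mu> e, of n T]
  obtain N0 where N0: "\<forall>b<n. \<forall>K L. finite K \<longrightarrow> finite L \<longrightarrow> N0 \<le> card K \<longrightarrow> N0 \<le> card L \<longrightarrow>
    (\<integral>X. \<bar>gauss_stat K (T b) X - gauss_stat L (T b) X\<bar> \<partial>\<mu>) < e" ..
  have "(\<integral>X. \<bar>stat_avg N n T X - stat_avg N' n T X\<bar> \<partial>\<mu>) < \<epsilon>" if N: "N0 \<le> N" "N0 \<le> N'" for N N'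
  proof -
    define d where "d a v X = \<bar>gauss_stat {..<N} (v *v T a) X - gauss_stat {..<N'} (v *v T a) X\<bar>" for a and v :: "real^'m^'m" and X :: "'m imat"
    have dm [measurable]: "(\<lambda>(X, v). d a v X) \<in> borel_measurable (borel \<Otimes>\<^sub>M borel)" for a
      unfolding d_def by measurable
    have d1: "\<bar>d a v X\<bar> \<le> 1" for a v X
      using gauss_stat_bounds[of "{..<N}" "v *v T a" X] gauss_stat_bounds[of "{..<N'}" "v *v T a" X]
      unfolding d_def by (simp add: abs_le_iff)
    have di: "integrable (\<mu> \<Otimes>\<^sub>M haar_O) (\<lambda>(X, v). \<Sum>a<n. d a v X)"
    proof -
      have "integrable (\<mu> \<Otimes>\<^sub>M haar_O) (\<lambda>z. \<Sum>a<n. (case z of (X, v) \<Rightarrow> d a v X))"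
        by (intro Bochner_Integration.integrable_sum P.integrable_const_bound[where B = 1])
          (use d1 in auto)
      then show ?thesis by (simp add: case_prod_beta')
    qed
    have dX: "integrable \<mu> (\<lambda>X. d a v X)" and dv: "integrable haar_O (\<lambda>v. d a v X)" for a v X
      using d1 by (auto intro!: integrable_const_bound[where B = 1] haar.integrable_const_bound[where B = 1])
    have pw: "\<bar>stat_avg N n T X - stat_avg N' n T X\<bar> \<le> (\<integral>v. (\<Sum>a<n. d a v X) \<partial>haar_O)" for X
    proof -
      have "\<bar>stat_avg N n T X - stat_avg N' n T X\<bar> = \<bar>\<integral>v. (\<Prod>a<n. gauss_stat {..<N} (v *v T a) X) - (\<Prod>a<n. gauss_stat {..<N'} (v *v T a) X) \<partial>haar_O\<bar>"
        unfolding stat_avg_def by (subst Bochner_Integration.integral_diff[OF stat_avg_integrable stat_avg_integrable]) (rule refl)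
      also have "\<dots> \<le> (\<integral>v. \<bar>(\<Prod>a<n. gauss_stat {..<N} (v *v T a) X) - (\<Prod>a<n. gauss_stat {..<N'} (v *v T a) X)\<bar> \<partial>haar_O)"
        by (rule integral_abs_bound)
      also have "\<dots> \<le> (\<integral>v. (\<Sum>a<n. d a v X) \<partial>haar_O)"
        unfolding d_def[abs_def]
        by (intro integral_mono integrable_abs Bochner_Integration.integrable_diff stat_avg_integrable Bochner_Integration.integrable_sum
             dv[unfolded d_def] gauss_stat_prod_diff[where t = "\<lambda>a. _ *v T a"])
      finally show ?thesis .
    qed
    have "(\<integral>X. \<bar>stat_avg N n T X - stat_avg N' n T X\<bar> \<partial>\<mu>) \<le> (\<integral>X. \<integral>v. (\<Sum>a<n. d a v X) \<partial>haar_O \<partial>\<mu>)"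
      using P.integrable_fst'[OF di]
      by (intro integral_mono integrable_abs Bochner_Integration.integrable_diff integrable_stat_avg \<mu>b pw) simp
    also have "\<dots> = (\<integral>v. \<integral>X. (\<Sum>a<n. d a v X) \<partial>\<mu> \<partial>haar_O)"
      using P.Fubini_integral[OF di] by simp
    also have "\<dots> \<le> (\<integral>v. (\<Sum>a<n. e) \<partial>(haar_O :: (real^'m^'m) measure))"
    proof (rule integral_mono_AE)
      show "integrable haar_O (\<lambda>v. \<integral>X. (\<Sum>a<n. d a v X) \<partial>\<mu>)"
        using P.integrable_snd[of "\<lambda>X v. \<Sum>a<n. d a v X"] di by simp
      show "AE v in haar_O. (\<integral>X. (\<Sum>a<n. d a v X) \<partial>\<mu>) \<le> (\<Sum>a<n. e)"
        using AE_haar_O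
      proof eventually_elim
        fix v :: "real^'m^'m" assume v: "v \<in> O_fin"
        have "(\<integral>X. (\<Sum>a<n. d a v X) \<partial>\<mu>) = (\<Sum>a<n. \<integral>X. d a v X \<partial>\<mu>)"
          by (intro Bochner_Integration.integral_sum dX)
        also have "\<dots> \<le> (\<Sum>a<n. e)"
        proof (intro sum_mono less_imp_le)
          fix a assume "a \<in> {..<n}"
          have "(\<integral>X. d a v X \<partial>\<mu>) = (\<integral>X. \<bar>gauss_stat {..<N} (T a) X - gauss_stat {..<N'} (T a) X\<bar> \<partial>\<mu>)"
            unfolding d_def by (rule expectation_rotate(2)[OF \<mu> v])
          also have "\<dots> < e"
            using N \<open>a \<in> _\<close> by (intro N0[rule_format]) auto
          finally show "(\<integral>X. d a v X \<partial>\<mu>) < e" .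
        qed
        finally show "(\<integral>X. (\<Sum>a<n. d a v X) \<partial>\<mu>) \<le> (\<Sum>a<n. e)" .
      qed
    qed simp
    also have "\<dots> = n * e" by (simp add: )
    also have "\<dots> < \<epsilon>" using \<open>0 < \<epsilon>\<close> by (simp add: e_def field_simps)
    finally show ?thesis .
  qed
  then show ?thesis by blast
qed

text \<open>Along a subsequence with increments below 2^(-k) in mean, the sum of the absolute
  increments has finite integral, hence is finite almost everywhere.\<close>

lemma L1_Cauchy_AE_subseq:
  fixes R :: "nat \<Rightarrow> 'a \<Rightarrow> real"
  assumes "\<And>N. integrable M (R N)"
    and "\<And>\<epsilon>. 0 < \<epsilon> \<Longrightarrow> \<exists>N0. \<forall>N\<ge>N0. \<forall>N'\<ge>N0. (\<integral>X. \<bar>R N X - R N' X\<bar> \<partial>M) < \<epsilon>"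
  shows "\<exists>r :: nat \<Rightarrow> nat. (\<forall>k. k \<le> r k) \<and> (AE X in M. convergent (\<lambda>k. R (r k) X))"
proof -
  have "\<forall>k. \<exists>N0. \<forall>N\<ge>N0. \<forall>N'\<ge>N0. (\<integral>X. \<bar>R N X - R N' X\<bar> \<partial>M) < (1/2)^k" for k :: nat
    by (intro allI assms(2)) simp
  from choice[OF this] obtain K where
    K: "\<forall>k. \<forall>N\<ge>K k. \<forall>N'\<ge>K k. (\<integral>X. \<bar>R N X - R N' X\<bar> \<partial>M) < (1/2)^k" ..
  \<comment> \<open>Summing all earlier thresholds makes \<open>r\<close> monotone and at least
    \<open>K k\<close>; the extra \<open>k\<close> forces it to infinity.\<close>
  define r where "r k = k + (\<Sum>i\<le>k. K i)" for k
  have rK: "K k \<le> r k" "k \<le> r k" "r k \<le> r (Suc k)" for k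
    using member_le_sum[of k "{..k}" K] by (auto simp: r_def)
  have step: "(\<integral>X. \<bar>R (r k) X - R (r (Suc k)) X\<bar> \<partial>M) < (1/2)^k" for k
    using K rK(1)[of k] rK(3)[of k] by (meson order_trans)
  define D where "D k X = R (r (Suc k)) X - R (r k) X" for k X
  have Dint: "integrable M (D k)" for k unfolding D_def by (simp add: assms(1))
  then have [measurable]: "D k \<in> borel_measurable M" for k by (rule borel_measurable_integrable)
  have "AE X in M. summable (\<lambda>k. \<bar>D k X\<bar>)"
  proof -
    have "(\<integral>\<^sup>+X. (\<Sum>k. ennreal \<bar>D k X\<bar>) \<partial>M) = (\<Sum>k. \<integral>\<^sup>+X. ennreal \<bar>D k X\<bar> \<partial>M)"
      by (intro nn_integral_suminf) measurable
    also have "\<dots> \<le> (\<Sum>k. ennreal ((1/2)^k))"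
    proof (intro suminf_le allI)
      fix k
      have "(\<integral>\<^sup>+X. ennreal \<bar>D k X\<bar> \<partial>M) = ennreal (\<integral>X. \<bar>D k X\<bar> \<partial>M)"
        by (intro nn_integral_eq_integral integrable_abs Dint) auto
      also have "\<dots> \<le> ennreal ((1/2)^k)"
        using step[of k] by (intro ennreal_leI) (simp add: D_def abs_minus_commute)
      finally show "(\<integral>\<^sup>+X. ennreal \<bar>D k X\<bar> \<partial>M) \<le> ennreal ((1/2)^k)" .
    qed auto
    also have "\<dots> = ennreal (\<Sum>k. (1/2)^k)"
      by (intro suminf_ennreal2 summable_geometric) auto
    also have "\<dots> < \<infinity>" by simp
    finally have "AE X in M. (\<Sum>k. ennreal \<bar>D k X\<bar>) \<noteq> \<infinity>"
      by (intro nn_integral_PInf_AE) auto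
    then show ?thesis
    proof eventually_elim
      fix X assume "(\<Sum>k. ennreal \<bar>D k X\<bar>) \<noteq> \<infinity>"
      then show "summable (\<lambda>k. \<bar>D k X\<bar>)"
        by (intro summable_suminf_not_top) (auto simp: top_unique)
    qed
  qed
  then have "AE X in M. convergent (\<lambda>k. R (r k) X)"
  proof eventually_elim
    fix X assume "summable (\<lambda>k. \<bar>D k X\<bar>)"
    then have "summable (\<lambda>k. D k X)" by (rule summable_rabs_cancel)
    then have "convergent (\<lambda>m. \<Sum>k<m. D k X)" by (simp add: summable_iff_convergent)
    then have "convergent (\<lambda>m. R (r m) X - R (r 0) X)" unfolding D_def sum_lessThan_telescope[of "\<lambda>k. R (r k) X"] .
    then have "convergent (\<lambda>m. R (r m) X - R (r 0) X + R (r 0) X)" by (rule convergent_add) (rule convergent_const)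
    then show "convergent (\<lambda>k. R (r k) X)" by simp
  qed
  then show ?thesis using rK(2) by (intro exI[of _ r]) simp
qed

text \<open>
  Along a fast subsequence the averages converge almost everywhere, and the limit is an invariant
  function since each average is eventually unchanged by a given group element.
\<close>

proposition ergodic_stat_avg:
  fixes T :: "'m::finite imat"
  assumes \<mu>e: "\<mu> \<in> P_erg"
  shows "(\<lambda>N. \<integral>X. \<bar>stat_avg N n T X - cf \<mu> 0 n T\<bar> \<partial>\<mu>) \<longlonglongrightarrow> 0"
proof -
  have \<mu>: "\<mu> \<in> P_inv" using \<mu>e by (simp add: P_erg_def)
  interpret prob_space \<mu> using \<mu> by (rule P_inv_prob_space)
  note sets [measurable_cong, simp] = P_inv_sets[OF \<mu>]
  have [simp]: "space \<mu> = UNIV" using sets_eq_imp_space_eq[OF sets] by simp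
  note \<mu>b = P_inv_probs[OF \<mu>]
  define c where "c = cf \<mu> 0 n T"
  define R where "R N = stat_avg N n T" for N
  have R [measurable]: "R N \<in> borel_measurable borel" for N unfolding R_def by measurable
  have Rb: "\<bar>R N X\<bar> \<le> 1" for N X using stat_avg_bounds[of N n T X] by (simp add: R_def)
  have Ri [simp]: "integrable \<mu> (R N)" for N unfolding R_def using \<mu>b by (rule integrable_stat_avg)
  have Cau: "\<exists>N0. \<forall>N\<ge>N0. \<forall>N'\<ge>N0. (\<integral>X. \<bar>R N X - R N' X\<bar> \<partial>\<mu>) < \<epsilon>" if "0 < \<epsilon>" for \<epsilon>
    unfolding R_def using stat_avg_Cauchy[OF \<mu> that] .
  have "\<exists>r :: nat \<Rightarrow> nat. (\<forall>k. k \<le> r k) \<and> (AE X in \<mu>. convergent (\<lambda>k. R (r k) X))"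
    by (rule L1_Cauchy_AE_subseq[OF Ri]) (rule Cau)
  then obtain r :: "nat \<Rightarrow> nat" where r': "\<forall>k. k \<le> r k" and conv: "AE X in \<mu>. convergent (\<lambda>k. R (r k) X)"
    by (elim exE conjE)
  note r = r'[rule_format]
  define f where "f X = lim (\<lambda>k. R (r k) X)" for X
  have [measurable]: "f \<in> borel_measurable borel" unfolding f_def by measurable
  have lim: "AE X in \<mu>. (\<lambda>k. R (r k) X) \<longlonglongrightarrow> f X"
    using conv by eventually_elim (simp add: f_def convergent_LIMSEQ_iff)
  have finv: "f (act u v X) = f X" if uv: "u \<in> O_inf" "v \<in> O_fin" for u v X
  proof -
    from stat_avg_act[OF uv(1)] obtain N0 where N0: "\<And>N. N0 \<le> N \<Longrightarrow> R N (act u v X) = R N X"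
      using uv(2) unfolding R_def by blast
    have "\<forall>\<^sub>F k in sequentially. R (r k) (act u v X) = R (r k) X"
      using eventually_ge_at_top[of N0] by eventually_elim (rule N0[OF order_trans[OF _ r]])
    then have "((\<lambda>k. R (r k) (act u v X)) \<longlonglongrightarrow> L) = ((\<lambda>k. R (r k) X) \<longlonglongrightarrow> L)" for L
      by (rule tendsto_cong)
    \<comment> \<open>\<open>lim\<close> is a description in terms of the set of limits, so
      invariance holds at every point, also where the sequence diverges; strict invariance is what
      \<open>invariant_set\<close> demands.\<close>
    then show ?thesis by (simp add: f_def lim_def)
  qed
  have fi: "integrable \<mu> f" and fc: "(\<integral>X. f X \<partial>\<mu>) = c"
  proof -
    have meas: "f \<in> borel_measurable \<mu>" "\<And>k. R (r k) \<in> borel_measurable \<mu>" by measurable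
    have one: "integrable \<mu> (\<lambda>_. 1 :: real)" by simp
    have bd: "AE X in \<mu>. norm (R (r k) X) \<le> 1" for k
      unfolding real_norm_def by (rule AE_I2) (rule Rb)
    note * = integral_dominated_convergence[OF meas one lim bd] integrable_dominated_convergence[OF meas one lim bd]
    have "filterlim r at_top sequentially"
      by (rule filterlim_at_top_mono[OF filterlim_ident]) (use r in auto)
    from filterlim_compose[OF expectation_stat_avg_tendsto[OF \<mu>, of n T] this]
    have "(\<lambda>k. \<integral>X. R (r k) X \<partial>\<mu>) \<longlonglongrightarrow> c" by (simp add: R_def c_def)
    with *(1) show "(\<integral>X. f X \<partial>\<mu>) = c" by (rule LIMSEQ_unique)
    show "integrable \<mu> f" by fact
  qed
  have img: "act u v ` {X. P (f X)} = {X. P (f X)}" if uv: "u \<in> O_inf" "v \<in> O_fin" for u v P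
  proof (intro equalityI subsetI)
    fix X assume "X \<in> act u v ` {X. P (f X)}"
    then show "X \<in> {X. P (f X)}" using finv[OF uv] by auto
  next
    fix X assume "X \<in> {X. P (f X)}"
    moreover have "f (act (\<lambda>i j. u j i) (transpose v) X) = f X"
      using act_inverse(1)[OF uv] uv by (intro finv) auto
    ultimately show "X \<in> act u v ` {X. P (f X)}"
      using act_inverse(2)[OF uv, of X] by (intro image_eqI[of _ _ "act (\<lambda>i j. u j i) (transpose v) X"]) auto
  qed
  have erg: "emeasure \<mu> {X. P (f X)} = 0 \<or> emeasure \<mu> (- {X. P (f X)}) = 0" if "{X. P (f X)} \<in> sets borel" for P
  proof -
    have "invariant_set {X. P (f X)}"
      unfolding invariant_set_def by (intro ballI img)
    moreover have "\<forall>A\<in>sets borel. invariant_set A \<longrightarrow> emeasure \<mu> A = 0 \<or> emeasure \<mu> (- A) = 0"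
      using \<mu>e by (simp add: P_erg_def)
    ultimately show ?thesis using that by blast
  qed
  \<comment> \<open>Used for \<open>\<sigma>\<close> = 1 and -1: \<sigma> (f - c) has mean 0, so it
    cannot be positive almost everywhere, and ergodicity leaves only a null set where it is
    positive.\<close>
  have one_sided: "AE X in \<mu>. \<sigma> * (f X - c) \<le> 0" for \<sigma> :: real
  proof -
    define A where "A = {X. 0 < \<sigma> * (f X - c)}"
    have A [measurable]: "A \<in> sets borel" unfolding A_def by measurable
    have "emeasure \<mu> (- A) \<noteq> 0"
    proof
      assume "emeasure \<mu> (- A) = 0"
      then have "AE X in \<mu>. X \<notin> - A" using A by (intro AE_not_in) (auto simp: null_sets_def)
      then have pos: "AE X in \<mu>. 0 < \<sigma> * (f X - c)" by eventually_elim (simp add: A_def)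
      have "(\<integral>X. \<sigma> * (f X - c) \<partial>\<mu>) = 0" using fi fc prob_space by simp
      then have "AE X in \<mu>. \<sigma> * (f X - c) = 0"
        using pos fi by (subst integral_nonneg_eq_0_iff_AE[symmetric]) (auto elim: eventually_mono)
      with pos have "AE X in \<mu>. False" by eventually_elim simp
      then show False by simp
    qed
    then have "emeasure \<mu> A = 0" using erg[of "\<lambda>y. 0 < \<sigma> * (y - c)"] A by (auto simp: A_def)
    then have "AE X in \<mu>. X \<notin> A" using A by (intro AE_not_in) (auto simp: null_sets_def)
    then show ?thesis by eventually_elim (simp add: A_def not_less)
  qed
  have fAE: "AE X in \<mu>. f X = c"
    using one_sided[of 1] one_sided[of "-1"] by eventually_elim simp
  have sub: "(\<lambda>k. \<integral>X. \<bar>R (r k) X - c\<bar> \<partial>\<mu>) \<longlonglongrightarrow> (\<integral>X. 0 \<partial>\<mu>)"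
  proof (rule integral_dominated_convergence[where w = "\<lambda>_. 1 + \<bar>c\<bar>"])
    show "AE X in \<mu>. (\<lambda>k. \<bar>R (r k) X - c\<bar>) \<longlonglongrightarrow> 0"
      using lim fAE by eventually_elim (auto intro!: tendsto_rabs_zero LIM_zero)
    show "AE X in \<mu>. norm \<bar>R (r k) X - c\<bar> \<le> 1 + \<bar>c\<bar>" for k
    proof (rule AE_I2)
      fix X
      show "norm \<bar>R (r k) X - c\<bar> \<le> 1 + \<bar>c\<bar>" using Rb[of "r k" X] by simp
    qed
  qed auto
  show ?thesis unfolding c_def[symmetric] R_def[symmetric]
  proof (rule LIMSEQ_I)
    fix \<epsilon> :: real assume "0 < \<epsilon>"
    then obtain N0 where N0: "\<And>N N'. N0 \<le> N \<Longrightarrow> N0 \<le> N' \<Longrightarrow> (\<integral>X. \<bar>R N X - R N' X\<bar> \<partial>\<mu>) < \<epsilon> / 2"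
      using Cau[of "\<epsilon> / 2"] by auto
    from LIMSEQ_D[OF sub, of "\<epsilon> / 2"] \<open>0 < \<epsilon>\<close> obtain k0 where
      k0: "\<And>k. k0 \<le> k \<Longrightarrow> \<bar>\<integral>X. \<bar>R (r k) X - c\<bar> \<partial>\<mu>\<bar> < \<epsilon> / 2" by auto
    \<comment> \<open>The Cauchy property carries the limit from the subsequence \<open>r\<close> to
      the whole sequence, with half of \<epsilon> spent on each part.\<close>
    define k where "k = max k0 N0"
    have k: "k0 \<le> k" "N0 \<le> r k" using r[of k] by (auto simp: k_def)
    show "\<exists>N0. \<forall>N\<ge>N0. norm ((\<integral>X. \<bar>R N X - c\<bar> \<partial>\<mu>) - 0) < \<epsilon>"
    proof (intro exI allI impI)
      fix N assume "N0 \<le> N"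
      have i: "integrable \<mu> (\<lambda>X. \<bar>R N X - R N' X\<bar>)" "integrable \<mu> (\<lambda>X. \<bar>R N X - c\<bar>)" for N N'
        by (intro integrable_abs Bochner_Integration.integrable_diff Ri integrable_const)+
      have "(\<integral>X. \<bar>R N X - c\<bar> \<partial>\<mu>) \<le> (\<integral>X. \<bar>R N X - R (r k) X\<bar> + \<bar>R (r k) X - c\<bar> \<partial>\<mu>)"
        by (intro integral_mono i Bochner_Integration.integrable_add) linarith
      also have "\<dots> = (\<integral>X. \<bar>R N X - R (r k) X\<bar> \<partial>\<mu>) + (\<integral>X. \<bar>R (r k) X - c\<bar> \<partial>\<mu>)"
        by (intro Bochner_Integration.integral_add i)
      also have "\<dots> < \<epsilon>" using N0[OF \<open>N0 \<le> N\<close> k(2)] k0[OF k(1)] by linarith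
      finally show "norm ((\<integral>X. \<bar>R N X - c\<bar> \<partial>\<mu>) - 0) < \<epsilon>" by simp
    qed
  qed
qed

section \<open>The parameter of an ergodic measure\<close>

lemma continuous_diag_mat [continuous_intros]:
  fixes f :: "'a::topological_space \<Rightarrow> real^'m"
  assumes "continuous_on S f"
  shows "continuous_on S (\<lambda>x. diag_mat (f x))"
  unfolding diag_mat_def
proof (intro continuous_on_vec_lambda)
  fix i j
  show "continuous_on S (\<lambda>x. if i = j then f x $ i else 0)"
    using assms by (cases "i = j") (auto intro!: continuous_intros)
qed

lemma continuous_sample: "continuous_on UNIV (\<lambda>s. sample s z)"
proof -
  obtain g q where z: "z = (g, q)" by (cases z)
  have "continuous_on UNIV (\<lambda>s. (\<chi> j. g (i, j)) v* (diag_mat s ** q))" for i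
    unfolding vector_matrix_mult_def by (intro continuous_intros)
  then show ?thesis
    unfolding z sample_def prod.case by (intro continuous_on_coordinatewise_then_product)
qed

text \<open>All \<open>mu s\<close> are laws of functions of the same random pair, and
  \<open>sample s z\<close> is continuous in \<open>s\<close>; dominated convergence does the
  rest.\<close>

lemma continuous_mu_integral:
  fixes f :: "'m::finite imat \<Rightarrow> real"
  assumes f: "continuous_on UNIV f" and b: "bounded (range f)"
  shows "continuous_on UNIV (\<lambda>s. integral\<^sup>L (mu s) f)"
proof (rule continuous_on_sequentiallyI)
  fix u and a :: "real^'m" assume u: "u \<longlonglongrightarrow> a"
  from b obtain B where B: "\<And>X. norm (f X) \<le> B" by (auto simp: bounded_iff)
  have [measurable]: "f \<in> borel_measurable borel" using f by (rule borel_measurable_continuous_onI)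
  have e: "integral\<^sup>L (mu s) f = (\<integral>z. f (sample s z) \<partial>(gauss \<Otimes>\<^sub>M haar_O))" for s
    unfolding mu_eq by (subst integral_distr) auto
  show "(\<lambda>k. integral\<^sup>L (mu (u k)) f) \<longlonglongrightarrow> integral\<^sup>L (mu a) f"
    unfolding e
  proof (rule integral_dominated_convergence[where w = "\<lambda>_. B"])
    show "AE z in gauss \<Otimes>\<^sub>M haar_O. (\<lambda>k. f (sample (u k) z)) \<longlonglongrightarrow> f (sample a z)"
    proof (rule AE_I2)
      fix z
      have "continuous_on UNIV (\<lambda>s. f (sample s z))"
        using f continuous_sample[of z] by (rule continuous_on_compose2) auto
      then show "(\<lambda>k. f (sample (u k) z)) \<longlonglongrightarrow> f (sample a z)"
        using u by (rule continuous_on_tendsto_compose) auto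
    qed
    show "AE z in gauss \<Otimes>\<^sub>M haar_O. norm (f (sample (u k) z)) \<le> B" for k by (rule AE_I2) (rule B)
  qed auto
qed

lemma bounded_continuous_cos_lin:
  fixes T :: "'m::finite imat"
  shows "continuous_on UNIV (\<lambda>X. cos (\<theta> + (\<Sum>i<n. T i \<bullet> X i)))" "bounded (range (\<lambda>X. cos (\<theta> + (\<Sum>i<n. T i \<bullet> X i))))"
proof -
  show "continuous_on UNIV (\<lambda>X. cos (\<theta> + (\<Sum>i<n. T i \<bullet> X i)))"
    by (intro continuous_intros continuous_on_product_coordinates)
  show "bounded (range (\<lambda>X. cos (\<theta> + (\<Sum>i<n. T i \<bullet> X i))))"
    by (rule boundedI[of _ 1]) auto
qed

lemma continuous_Phi: "continuous_on UNIV (\<lambda>s. Phi s n T)"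
proof -
  have "continuous_on UNIV (\<lambda>s. cf (mu s) 0 n T)"
    unfolding cf_def by (intro continuous_mu_integral bounded_continuous_cos_lin)
  then show ?thesis by (simp add: cf_mu)
qed

definition enum_index :: "nat \<Rightarrow> 'm::finite" where
  "enum_index = (SOME h. bij_betw h {..<CARD('m)} UNIV)"

lemma enum_index: "bij_betw (enum_index :: nat \<Rightarrow> 'm::finite) {..<CARD('m)} UNIV"
proof -
  obtain h where "bij_betw h {0..<CARD('m)} (UNIV :: 'm set)"
    using ex_bij_betw_nat_finite[OF finite[of "UNIV :: 'm set"]] by blast
  then show ?thesis unfolding enum_index_def atLeast0LessThan
    by (rule someI[where P = "\<lambda>h. bij_betw h {..<CARD('m)} UNIV"])
qed

text \<open>The first CARD('m) rows have Gram matrix \<open>x\<close> times the coordinate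
  projection onto \<open>J\<close>; \<open>enum_index\<close> merely transfers an arbitrary
  enumeration of the columns to row numbers.\<close>

definition test_rows :: "'m set \<Rightarrow> real \<Rightarrow> 'm::finite imat" where
  "test_rows J x i = (if enum_index i \<in> J then sqrt x *\<^sub>R axis (enum_index i) 1 else 0)"

lemma energy_test_rows:
  fixes s :: "real^'m::finite"
  assumes "0 \<le> x"
  shows "energy s CARD('m) (test_rows J x) q = x * (\<Sum>j\<in>UNIV. (s $ j)\<^sup>2 * (\<Sum>a\<in>J. (q $ j $ a)\<^sup>2))"
proof -
  have "(q *v test_rows J x i) $ j = (if enum_index i \<in> J then sqrt x * q $ j $ enum_index i else 0)" for i j
    by (simp add: test_rows_def matrix_vector_mult_scaleR matrix_vector_mul_component inner_axis)
  then have "energy s CARD('m) (test_rows J x) q = (\<Sum>i<CARD('m). \<Sum>j\<in>UNIV. if enum_index i \<in> J then x * ((s $ j)\<^sup>2 * (q $ j $ enum_index i)\<^sup>2) else 0)"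
    unfolding energy_def using assms by (intro sum.cong refl) (simp add: power_mult_distrib)
  also have "\<dots> = (\<Sum>a\<in>UNIV. \<Sum>j\<in>UNIV. if a \<in> J then x * ((s $ j)\<^sup>2 * (q $ j $ a)\<^sup>2) else 0)"
    by (rule sum.reindex_bij_betw[OF enum_index])
  also have "\<dots> = (\<Sum>j\<in>UNIV. \<Sum>a\<in>UNIV. if a \<in> J then x * ((s $ j)\<^sup>2 * (q $ j $ a)\<^sup>2) else 0)"
    by (rule sum.swap)
  also have "\<dots> = (\<Sum>j\<in>UNIV. \<Sum>a\<in>J. x * ((s $ j)\<^sup>2 * (q $ j $ a)\<^sup>2))"
    by (intro sum.cong refl sum.mono_neutral_cong_right) auto
  finally show ?thesis by (simp add: sum_distrib_left)
qed

lemma O_fin_row_sum: "q \<in> O_fin \<Longrightarrow> (\<Sum>a\<in>UNIV. (q $ j $ a)\<^sup>2) = 1"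
  using O_fin_iff_rows[of q] by (auto simp: inner_vec_def power2_eq_square)

lemma O_fin_column_sum:
  assumes "q \<in> O_fin" shows "(\<Sum>j\<in>UNIV. (q $ j $ a)\<^sup>2) = 1"
proof -
  have "transpose q \<in> O_fin" using assms by simp
  from O_fin_row_sum[OF this, of a] show ?thesis by (simp add: transpose_def)
qed

text \<open>Rows of an orthogonal matrix are unit vectors, so the energy does not depend on
  \<open>q\<close>. This value bounds the norm of \<open>s\<close> in the compactness
  argument.\<close>

lemma Phi_test_rows_UNIV:
  fixes s :: "real^'m::finite"
  assumes "0 \<le> x"
  shows "Phi s CARD('m) (test_rows UNIV x) = exp (- x * (norm s)\<^sup>2 / 2)"
proof -
  have "Phi s CARD('m) (test_rows UNIV x) = (\<integral>q. exp (- x * (norm s)\<^sup>2 / 2) \<partial>(haar_O :: (real^'m^'m) measure))"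
    unfolding Phi_def
  proof (rule integral_cong_AE)
    show "AE q in haar_O. exp (- energy s CARD('m) (test_rows UNIV x) q / 2) = exp (- x * (norm s)\<^sup>2 / 2)"
      using AE_haar_O
    proof eventually_elim
      fix q :: "real^'m^'m" assume "q \<in> O_fin"
      then have "energy s CARD('m) (test_rows UNIV x) q = x * (norm s)\<^sup>2"
        using assms by (simp add: energy_test_rows O_fin_row_sum norm_vec_def L2_set_def sum_nonneg)
      then show "exp (- energy s CARD('m) (test_rows UNIV x) q / 2) = exp (- x * (norm s)\<^sup>2 / 2)" by simp
    qed
  qed auto
  then show ?thesis by (simp add: )
qed

text \<open>Ky Fan's inequality for a diagonal matrix: the weights \<open>p\<close> have total mass \<open>card J\<close>.\<close>

lemma sum_smallest_le:
  fixes s :: "(real, 'm::{finite,linorder}) vec"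
  assumes s: "s \<in> Delta" and J: "\<And>i j. i \<in> J \<Longrightarrow> i \<le> j \<Longrightarrow> j \<in> J" and q: "q \<in> O_fin"
  shows "(\<Sum>j\<in>J. (s $ j)\<^sup>2) \<le> (\<Sum>j\<in>UNIV. (s $ j)\<^sup>2 * (\<Sum>a\<in>J. (q $ j $ a)\<^sup>2))"
proof (cases "J = {}")
  case False
  define p where "p j = (\<Sum>a\<in>J. (q $ j $ a)\<^sup>2)" for j
  have p0: "0 \<le> p j" for j by (simp add: p_def sum_nonneg)
  have p1: "p j \<le> 1" for j
    unfolding p_def O_fin_row_sum[OF q, of j, symmetric] by (rule sum_mono2) auto
  have psum: "(\<Sum>j\<in>UNIV. p j) = card J"
    unfolding p_def by (subst sum.swap) (simp add: O_fin_column_sum[OF q])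
  \<comment> \<open>On the final segment \<open>J\<close> the squares are at most the one at
    \<open>k\<close>, outside \<open>J\<close> at least that one; this value separates the two
    sums.\<close>
  define k where "k = Min J"
  have k: "k \<in> J" "\<And>j. j \<in> J \<Longrightarrow> k \<le> j" using False by (auto simp: k_def)
  have le: "(s $ j)\<^sup>2 \<le> (s $ i)\<^sup>2" if "i \<le> j" for i j
    using s that by (auto simp: Delta_def intro!: power_mono)
  have in_J: "(s $ j)\<^sup>2 \<le> (s $ k)\<^sup>2" if "j \<in> J" for j using le k(2) that by blast
  have out_J: "(s $ k)\<^sup>2 \<le> (s $ i)\<^sup>2" if "i \<notin> J" for i
    using le[of i k] J[OF k(1), of i] that by (meson linear)
  have split: "(\<Sum>j\<in>UNIV. f j) = (\<Sum>j\<in>J. f j) + (\<Sum>i\<in>- J. f i)" for f :: "'m \<Rightarrow> real"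
    using sum.union_disjoint[of J "- J" f] by (simp add: Compl_partition)
  have "(\<Sum>j\<in>J. (s $ j)\<^sup>2 * (1 - p j)) \<le> (\<Sum>j\<in>J. (s $ k)\<^sup>2 * (1 - p j))"
    using in_J p1 by (intro sum_mono mult_right_mono) auto
  also have "\<dots> = (s $ k)\<^sup>2 * (card J - (\<Sum>j\<in>J. p j))"
    by (simp add: sum_distrib_left[symmetric] sum_subtractf)
  also have "\<dots> = (\<Sum>i\<in>- J. (s $ k)\<^sup>2 * p i)"
    using psum unfolding split[of p] by (simp add: sum_distrib_left[symmetric])
  also have "\<dots> \<le> (\<Sum>i\<in>- J. (s $ i)\<^sup>2 * p i)"
    using out_J p0 by (intro sum_mono mult_right_mono) auto
  finally have "(\<Sum>j\<in>J. (s $ j)\<^sup>2) - (\<Sum>j\<in>J. (s $ j)\<^sup>2 * p j) \<le> (\<Sum>i\<in>- J. (s $ i)\<^sup>2 * p i)"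
    by (simp add: right_diff_distrib sum_subtractf)
  then show ?thesis unfolding p_def[symmetric] split[of "\<lambda>j. (s $ j)\<^sup>2 * p j"] by simp
qed simp

text \<open>Laplace's method: as \<open>x\<close> grows, \<open>Phi\<close> at \<open>test_rows J x\<close> decays at the rate given by the minimum of the energy.\<close>

lemma Phi_le_imp_sum_le:
  fixes s s' :: "(real, 'm::{finite,linorder}) vec"
  assumes s': "s' \<in> Delta" and J: "\<And>i j. i \<in> J \<Longrightarrow> i \<le> j \<Longrightarrow> j \<in> J"
    and eq: "\<And>n T. Phi s n T \<le> Phi s' n T"
  shows "(\<Sum>j\<in>J. (s' $ j)\<^sup>2) \<le> (\<Sum>j\<in>J. (s $ j)\<^sup>2)"
proof (rule ccontr)
  define \<alpha> \<alpha>' where "\<alpha> = (\<Sum>j\<in>J. (s $ j)\<^sup>2)" and "\<alpha>' = (\<Sum>j\<in>J. (s' $ j)\<^sup>2)"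
  assume "\<not> ?thesis"
  then have "\<alpha> < \<alpha>'" by (simp add: \<alpha>_def \<alpha>'_def)
  define \<delta> where "\<delta> = (\<alpha>' - \<alpha>) / 2"
  have \<delta>: "0 < \<delta>" "\<alpha> + \<delta> + \<delta> = \<alpha>'" using \<open>\<alpha> < \<alpha>'\<close> by (simp_all add: \<delta>_def)
  define e where "e q = (\<Sum>j\<in>UNIV. (s $ j)\<^sup>2 * (\<Sum>a\<in>J. (q $ j $ a)\<^sup>2))" for q :: "((real, 'm) vec, 'm) vec"
  define W where "W = {q. e q < \<alpha> + \<delta>}"
  have "open W" unfolding W_def e_def by (intro open_Collect_less continuous_intros)
  then have [measurable]: "W \<in> sets borel" by simp
  have "e (mat 1) = \<alpha>"
  proof -
    have "(\<Sum>a\<in>J. (mat 1 $ j $ a :: real)\<^sup>2) = (if j \<in> J then 1 else 0)" for j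
      by (simp add: mat_def if_distrib[of "\<lambda>x. x\<^sup>2"] cong: if_cong)
    then show ?thesis by (simp add: e_def \<alpha>_def if_distrib[of "\<lambda>x. _ * x"] sum.If_cases cong: if_cong)
  qed
  then have "mat 1 \<in> W" using \<delta> by (simp add: W_def)
  define c where "c = measure haar_O W"
  have c: "0 < c" unfolding c_def using haar_nhd_pos[OF \<open>open W\<close> \<open>mat 1 \<in> W\<close>] .
  \<comment> \<open>With this \<open>x\<close> the comparison of the two bounds reads c \<le> exp (-
    1 / c), which is false because exp (1 / c) > 1 / c.\<close>
  define x where "x = 2 / (\<delta> * c)"
  have x: "0 < x" using \<delta> c by (simp add: x_def)
  have "c * exp (- x * (\<alpha> + \<delta>) / 2) = (\<integral>q. indicator W q * exp (- x * (\<alpha> + \<delta>) / 2) \<partial>haar_O)"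
    by (simp add: c_def)
  also have "\<dots> \<le> Phi s CARD('m) (test_rows J x)"
    unfolding Phi_def
  proof (rule integral_mono)
    show "integrable haar_O (\<lambda>q. indicator W q * exp (- x * (\<alpha> + \<delta>) / 2))"
      by (intro integrable_mult_left) (auto simp: integrable_indicator_iff less_top[symmetric])
    fix q
    show "indicator W q * exp (- x * (\<alpha> + \<delta>) / 2) \<le> exp (- energy s CARD('m) (test_rows J x) q / 2)"
    proof (cases "q \<in> W")
      case True
      then have "x * e q \<le> x * (\<alpha> + \<delta>)" using x by (intro mult_left_mono) (auto simp: W_def)
      then show ?thesis using x True by (simp add: energy_test_rows e_def)
    qed simp
  qed (rule integrable_exp_energy)
  also have "\<dots> \<le> Phi s' CARD('m) (test_rows J x)" by (rule eq)
  also have "\<dots> \<le> (\<integral>q. exp (- x * \<alpha>' / 2) \<partial>(haar_O :: ((real, 'm) vec, 'm) vec measure))"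
    unfolding Phi_def
  proof (rule integral_mono_AE[OF integrable_exp_energy])
    show "AE q in haar_O. exp (- energy s' CARD('m) (test_rows J x) q / 2) \<le> exp (- x * \<alpha>' / 2)"
      using AE_haar_O
    proof eventually_elim
      fix q :: "((real, 'm) vec, 'm) vec" assume "q \<in> O_fin"
      from sum_smallest_le[OF s' J this]
      have "x * \<alpha>' \<le> energy s' CARD('m) (test_rows J x) q"
        using x by (simp add: energy_test_rows \<alpha>'_def)
      then show "exp (- energy s' CARD('m) (test_rows J x) q / 2) \<le> exp (- x * \<alpha>' / 2)" by simp
    qed
  qed simp
  also have "\<dots> = exp (- x * \<alpha>' / 2)" by (simp add: )
  also have "\<dots> = exp (- x * \<delta> / 2) * exp (- x * (\<alpha> + \<delta>) / 2)"
    unfolding \<delta>(2)[symmetric] by (simp add: exp_add[symmetric] algebra_simps add_divide_distrib diff_divide_distrib)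
  finally have "c \<le> exp (- x * \<delta> / 2)" by simp
  also have "x * \<delta> / 2 = 1 / c" using \<delta> c by (simp add: x_def)
  then have "exp (- x * \<delta> / 2) = 1 / exp (1 / c)" by (simp add: exp_minus inverse_eq_divide)
  also have "\<dots> < 1 / (1 / c)"
  proof -
    have "1 / c < exp (1 / c)" using exp_ge_add_one_self[of "1 / c"] by linarith
    then show ?thesis using c by (intro divide_strict_left_mono) auto
  qed
  finally show False by simp
qed

text \<open>\<open>Phi\<close> determines the sums of squares over all final segments; those from
  \<open>j\<close> on and strictly after \<open>j\<close> differ by the square of the
  \<open>j\<close>-th entry, which is nonnegative.\<close>

lemma Phi_inj:
  fixes s s' :: "(real, 'm::{finite,linorder}) vec"
  assumes s: "s \<in> Delta" "s' \<in> Delta" and eq: "\<And>n T. Phi s n T = Phi s' n T"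
  shows "s = s'"
proof -
  have sums: "(\<Sum>j\<in>J. (s' $ j)\<^sup>2) = (\<Sum>j\<in>J. (s $ j)\<^sup>2)" if J: "\<And>i j. i \<in> J \<Longrightarrow> i \<le> j \<Longrightarrow> j \<in> J" for J
  proof (rule antisym)
    show "(\<Sum>j\<in>J. (s' $ j)\<^sup>2) \<le> (\<Sum>j\<in>J. (s $ j)\<^sup>2)"
      by (rule Phi_le_imp_sum_le[OF s(2) J]) (simp_all add: eq)
    show "(\<Sum>j\<in>J. (s $ j)\<^sup>2) \<le> (\<Sum>j\<in>J. (s' $ j)\<^sup>2)"
      by (rule Phi_le_imp_sum_le[OF s(1) J]) (simp_all add: eq)
  qed
  have "s $ j = s' $ j" for j
  proof -
    have ins: "{j..} = insert j {j<..}" by auto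
    have split: "(\<Sum>k\<in>{j..}. (t $ k)\<^sup>2) = (t $ j)\<^sup>2 + (\<Sum>k\<in>{j<..}. (t $ k)\<^sup>2)" for t :: "(real, 'm) vec"
      unfolding ins by (subst sum.insert) auto
    have "(\<Sum>k\<in>{j..}. (s' $ k)\<^sup>2) = (\<Sum>k\<in>{j..}. (s $ k)\<^sup>2)"
      by (rule sums) auto
    moreover have "(\<Sum>k\<in>{j<..}. (s' $ k)\<^sup>2) = (\<Sum>k\<in>{j<..}. (s $ k)\<^sup>2)"
      by (rule sums) (auto intro: less_le_trans)
    ultimately have "(s $ j)\<^sup>2 = (s' $ j)\<^sup>2" unfolding split by linarith
    then show ?thesis using s by (auto simp: Delta_def power2_eq_iff_nonneg)
  qed
  then show ?thesis by (simp add: vec_eq_iff)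
qed

lemma closed_Delta: "closed (Delta :: (real, 'm::{finite,linorder}) vec set)"
proof -
  have "Delta = (\<Inter>i. \<Inter>j\<in>{i..}. {s :: (real, 'm) vec. s $ j \<le> s $ i}) \<inter> (\<Inter>i. {s. 0 \<le> s $ i})"
    by (auto simp: Delta_def)
  also have "closed \<dots>"
    by (intro closed_Int closed_INT ballI closed_Collect_le continuous_intros)
  finally show ?thesis .
qed

text \<open>The finite intersection property for the closed conditions \<open>A i\<close> inside
  \<open>K\<close>. Closeness to the positive value at \<open>test_rows UNIV x\<close> bounds
  \<open>K\<close>, although \<open>C\<close> may be unbounded. Applied with
  \<open>C = Delta\<close> to find \<open>s\<close>, and with \<open>C\<close> the complement in
  \<open>Delta\<close> of an open set to show that \<open>mu\<close> is open.\<close>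

lemma Phi_limit_compact:
  fixes C :: "(real, 'm::{finite,linorder}) vec set" and c :: "nat \<Rightarrow> 'm imat \<Rightarrow> real"
  assumes C: "closed C" and x: "0 < x" and pos: "0 < c CARD('m) (test_rows UNIV x)"
    and approx: "\<And>F \<epsilon>. finite F \<Longrightarrow> 0 < \<epsilon> \<Longrightarrow> \<exists>s\<in>C. \<forall>(n, T)\<in>F. \<bar>Phi s n T - c n T\<bar> < \<epsilon>"
  shows "\<exists>s\<in>C. \<forall>n T. Phi s n T = c n T"
proof -
  define T0 :: "'m imat" where "T0 = test_rows UNIV x"
  define c0 where "c0 = c CARD('m) T0"
  have c0: "0 < c0" using pos by (simp add: c0_def T0_def)
  define A where "A = (\<lambda>(n, T, k::nat). {s. \<bar>Phi s n T - c n T\<bar> \<le> 1 / Suc k})"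
  define K where "K = {s. \<bar>Phi s CARD('m) T0 - c0\<bar> \<le> c0 / 2} \<inter> C"
  have closed: "closed {s. \<bar>Phi s n T - c n T\<bar> \<le> r}" for n T r
    by (intro closed_Collect_le continuous_intros continuous_Phi)
  have "compact K"
    unfolding compact_eq_bounded_closed
  proof
    show "closed K" unfolding K_def c0_def by (intro closed_Int closed C)
    show "bounded K" unfolding bounded_iff
    proof (intro exI ballI)
      fix s assume "s \<in> K"
      then have "\<bar>Phi s CARD('m) T0 - c0\<bar> \<le> c0 / 2" by (simp add: K_def)
      then have "c0 / 2 \<le> Phi s CARD('m) T0" by linarith
      then have "c0 / 2 \<le> exp (- x * (norm s)\<^sup>2 / 2)"
        using x by (simp add: T0_def Phi_test_rows_UNIV)
      then have "ln (c0 / 2) \<le> - x * (norm s)\<^sup>2 / 2"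
      proof -
        assume "c0 / 2 \<le> exp (- x * (norm s)\<^sup>2 / 2)"
        then have "ln (c0 / 2) \<le> ln (exp (- x * (norm s)\<^sup>2 / 2))"
          using c0 by (subst ln_le_cancel_iff) auto
        then show ?thesis unfolding ln_exp .
      qed
      then have "(norm s)\<^sup>2 \<le> - 2 * ln (c0 / 2) / x" using x by (simp add: field_simps)
      then show "norm s \<le> sqrt (- 2 * ln (c0 / 2) / x)" by (rule real_le_rsqrt)
    qed
  qed
  have clA: "closed (A i)" for i by (cases i) (simp add: A_def closed)
  have fip: "K \<inter> \<Inter>(A ` I) \<noteq> {}" if I: "finite I" for I
  proof -
    define F where "F = insert (CARD('m), T0) ((\<lambda>(n, T, k). (n, T)) ` I)"
    \<comment> \<open>The smallest of finitely many tolerances; \<open>c0 / 2\<close> is included to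
      put the approximating point into \<open>K\<close>.\<close>
    define \<epsilon> where "\<epsilon> = Min (insert (c0 / 2) ((\<lambda>(n, T, k). 1 / Suc k) ` I))"
    have "finite F" "0 < \<epsilon>" using I c0 by (auto simp: F_def \<epsilon>_def)
    from approx[OF this] obtain s where s1: "s \<in> C" and s2: "\<forall>(n, T)\<in>F. \<bar>Phi s n T - c n T\<bar> < \<epsilon>" by (elim bexE)
    have s: "s \<in> C" "\<bar>Phi s n T - c n T\<bar> < \<epsilon>" if "(n, T) \<in> F" for n T
      using s1 bspec[OF s2 that] by simp_all
    have "\<epsilon> \<le> c0 / 2" unfolding \<epsilon>_def using I by (intro Min_le) auto
    moreover have "\<bar>Phi s CARD('m) T0 - c0\<bar> < \<epsilon>"
      unfolding c0_def by (rule s(2)) (simp add: F_def)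
    ultimately have "s \<in> K" using s1 by (simp add: K_def)
    moreover have "s \<in> A i" if "i \<in> I" for i
    proof -
      obtain n T k where i: "i = (n, T, k)" by (cases i)
      have "(n, T) \<in> F" using imageI[OF that, of "\<lambda>(n, T, k). (n, T)"] by (simp add: F_def i)
      then have "\<bar>Phi s n T - c n T\<bar> < \<epsilon>" by (rule s(2))
      also have "\<epsilon> \<le> 1 / Suc k"
        unfolding \<epsilon>_def using I imageI[OF that, of "\<lambda>(n, T, k). 1 / real (Suc k)"] by (intro Min_le) (simp_all add: i)
      finally show ?thesis by (simp add: A_def i)
    qed
    ultimately have "s \<in> K \<inter> \<Inter>(A ` I)" by blast
    then show ?thesis by blast
  qed
  have "K \<inter> \<Inter>(A ` UNIV) \<noteq> {}"
    by (rule compact_imp_fip_image[OF \<open>compact K\<close> clA fip])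
  then obtain s where s: "s \<in> K" "\<And>i. s \<in> A i" by blast
  have "Phi s n T = c n T" for n T
  proof (rule ccontr)
    assume "Phi s n T \<noteq> c n T"
    then have "0 < \<bar>Phi s n T - c n T\<bar>" by simp
    from reals_Archimedean[OF this] obtain k where "inverse (real (Suc k)) < \<bar>Phi s n T - c n T\<bar>" ..
    then show False using s(2)[of "(n, T, k)"] by (auto simp: A_def inverse_eq_divide)
  qed
  then show ?thesis using s by (auto simp: K_def)
qed

text \<open>For finitely many \<open>(n, T)\<close> a single matrix \<open>X\<close> has all its
  averages near the constants \<open>cf \<mu> 0 n T\<close>, and by \<open>stat_avg_eq_Phi\<close>
  these averages are values of one \<open>Phi s\<close>.\<close>

lemma P_erg_imp_mu:
  fixes \<mu> :: "'m::{finite,linorder} imat measure"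
  assumes \<mu>e: "\<mu> \<in> P_erg"
  shows "\<exists>s\<in>Delta. mu s = \<mu>"
proof -
  have \<mu>: "\<mu> \<in> P_inv" using \<mu>e by (simp add: P_erg_def)
  interpret prob_space \<mu> using \<mu> by (rule P_inv_prob_space)
  note sets [measurable_cong] = P_inv_sets[OF \<mu>]
  note \<mu>b = P_inv_probs[OF \<mu>]
  \<comment> \<open>\<open>cf\<close> is continuous and equals 1 at frequency 0, so a small
    \<open>x\<close> gives the positive value required by \<open>Phi_limit_compact\<close>.\<close>
  have "\<exists>x>0. 0 < cf \<mu> 0 CARD('m) (test_rows UNIV x)"
  proof -
    have "(\<lambda>k. cf \<mu> 0 CARD('m) (test_rows UNIV (inverse (real (Suc k))))) \<longlonglongrightarrow> cf \<mu> 0 CARD('m) (\<lambda>_. 0)"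
    proof (rule cf_tendsto[OF \<mu>b])
      fix i
      have "(\<lambda>k. sqrt (inverse (real (Suc k))) *\<^sub>R axis (enum_index i) 1 :: (real, 'm) vec) \<longlonglongrightarrow> sqrt 0 *\<^sub>R axis (enum_index i) 1"
        by (intro tendsto_intros LIMSEQ_inverse_real_of_nat)
      then show "(\<lambda>k. test_rows UNIV (inverse (real (Suc k))) i :: (real, 'm) vec) \<longlonglongrightarrow> 0"
        by (simp add: test_rows_def)
    qed
    moreover have "0 < cf \<mu> 0 CARD('m) (\<lambda>_. 0)" by (simp add: cf_def prob_space)
    ultimately have "\<forall>\<^sub>F k in sequentially. 0 < cf \<mu> 0 CARD('m) (test_rows UNIV (inverse (real (Suc k))))"
      by (rule order_tendstoD(1))
    then obtain k where "0 < cf \<mu> 0 CARD('m) (test_rows UNIV (inverse (real (Suc k))))"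
      using eventually_happens'[OF sequentially_bot] by blast
    then show ?thesis by (intro exI[of _ "inverse (real (Suc k))"]) simp
  qed
  then obtain x where x: "0 < x" "0 < cf \<mu> 0 CARD('m) (test_rows UNIV x)" by blast
  have "\<exists>s\<in>Delta. \<forall>n T. Phi s n T = cf \<mu> 0 n T"
  proof (rule Phi_limit_compact[where c = "cf \<mu> 0", OF closed_Delta x])
    fix F :: "(nat \<times> 'm imat) set" and \<epsilon> :: real assume F: "finite F" and "0 < \<epsilon>"
    define d where "d N p X = \<bar>stat_avg N (fst p) (snd p) X - cf \<mu> 0 (fst p) (snd p)\<bar>" for N p X
    have di: "integrable \<mu> (d N p)" for N p
      unfolding d_def by (intro integrable_abs Bochner_Integration.integrable_diff integrable_stat_avg \<mu>b) simp
    have "(\<lambda>N. \<Sum>p\<in>F. \<integral>X. d N p X \<partial>\<mu>) \<longlonglongrightarrow> (\<Sum>p\<in>F. 0)"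
      unfolding d_def by (intro tendsto_sum ergodic_stat_avg[OF \<mu>e])
    then have "\<forall>\<^sub>F N in sequentially. (\<Sum>p\<in>F. \<integral>X. d N p X \<partial>\<mu>) < \<epsilon>"
      by (rule order_tendstoD(2)) (use \<open>0 < \<epsilon>\<close> in simp)
    then obtain N where N: "(\<Sum>p\<in>F. \<integral>X. d N p X \<partial>\<mu>) < \<epsilon>"
      using eventually_happens'[OF sequentially_bot] by blast
    \<comment> \<open>A function with mean below \<epsilon> takes a value below \<epsilon>.\<close>
    have "\<exists>X. (\<Sum>p\<in>F. d N p X) < \<epsilon>"
    proof (rule ccontr)
      assume "\<nexists>X. (\<Sum>p\<in>F. d N p X) < \<epsilon>"
      then have "(\<integral>X. \<epsilon> \<partial>\<mu>) \<le> (\<integral>X. (\<Sum>p\<in>F. d N p X) \<partial>\<mu>)"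
        by (intro integral_mono Bochner_Integration.integrable_sum di) (auto simp: not_less)
      also have "\<dots> = (\<Sum>p\<in>F. \<integral>X. d N p X \<partial>\<mu>)" by (intro Bochner_Integration.integral_sum di)
      finally show False using N by (simp add: prob_space)
    qed
    then obtain X where X: "(\<Sum>p\<in>F. d N p X) < \<epsilon>" by blast
    obtain s where s: "s \<in> Delta" "\<And>n T. stat_avg N n T X = Phi s n T" using stat_avg_eq_Phi[of N X] by blast
    have "d N p X < \<epsilon>" if "p \<in> F" for p
      using member_le_sum[OF that, of "\<lambda>p. d N p X"] F X by (simp add: d_def)
    then show "\<exists>s\<in>Delta. \<forall>(n, T)\<in>F. \<bar>Phi s n T - cf \<mu> 0 n T\<bar> < \<epsilon>"
      using s by (intro bexI[of _ s]) (auto simp: d_def)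
  qed
  then obtain s where s: "s \<in> Delta" "\<And>n T. Phi s n T = cf \<mu> 0 n T" by blast
  have "mu s = \<mu>"
    by (rule cf_eqI[OF mu_probs \<mu>b]) (simp only: cf_mu s(2) P_inv_cf_phase[OF \<mu>, symmetric])
  then show ?thesis using s by blast
qed

section \<open>Ergodicity of \<open>mu s\<close> and the topology\<close>

text \<open>Valid for every \<open>N\<close>, in contrast to \<open>stat_avg_act\<close>, since the
  rows are not mixed.\<close>

lemma stat_avg_rotate:
  assumes "v \<in> O_fin"
  shows "stat_avg N n T (act id_mat (transpose v) X) = stat_avg N n T X"
proof -
  have "stat_avg N n T (act id_mat (transpose v) X) = (\<integral>w. (\<Prod>a<n. gauss_stat {..<N} ((v ** w) *v T a) X) \<partial>haar_O)"
    unfolding stat_avg_def gauss_stat_rotate[OF assms, symmetric] matrix_vector_mul_assoc ..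
  also have "\<dots> = stat_avg N n T X"
    unfolding stat_avg_def using assms by (intro integral_haar_left) auto
  finally show ?thesis .
qed

text \<open>Stacking turns a product of two statistics into one statistic of the longer frequency
  matrix, to which the limit theorem for products applies.\<close>

definition append_rows :: "nat \<Rightarrow> 'm::finite imat \<Rightarrow> 'm imat \<Rightarrow> 'm imat" where
  "append_rows n T T' i = (if i < n then T i else T' (i - n))"

lemma lessThan_append: "{..<n + k} = {..<n} \<union> (\<lambda>i. n + i) ` {..<k}" for n k :: nat
proof (intro equalityI subsetI)
  fix i assume "i \<in> {..<n + k}"
  then show "i \<in> {..<n} \<union> (\<lambda>i. n + i) ` {..<k}"
    by (cases "i < n") (auto intro!: image_eqI[of _ _ "i - n"])
qed auto

lemma prod_append_rows:
  fixes f :: "real^'m::finite \<Rightarrow> real"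
  shows "(\<Prod>a<n + k. f (append_rows n T T' a)) = (\<Prod>a<n. f (T a)) * (\<Prod>b<k. f (T' b))"
  unfolding lessThan_append
  by (subst prod.union_disjoint) (auto simp: prod.reindex append_rows_def)

lemma energy_append_rows:
  "energy s (n + k) (append_rows n T (\<lambda>b. w *v T' b)) q = energy s n T q + energy s k T' (q ** w)"
  unfolding energy_def lessThan_append
  by (subst sum.union_disjoint) (auto simp: sum.reindex append_rows_def matrix_vector_mul_assoc)

text \<open>The square is a double average over O(m). By invariance of \<mu> only the relative
  rotation \<open>w\<close> matters, so one of the two frequency matrices can be left
  unrotated.\<close>

lemma expectation_stat_avg_square:
  fixes \<mu> :: "'m::finite imat measure"
  assumes \<mu>: "\<mu> \<in> P_inv"
  shows "(\<integral>X. (stat_avg N n T X)\<^sup>2 \<partial>\<mu>) =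
    (\<integral>w. \<integral>X. (\<Prod>a<n + n. gauss_stat {..<N} (append_rows n T (\<lambda>b. w *v T b) a) X) \<partial>\<mu> \<partial>haar_O)"
proof -
  interpret prob_space \<mu> using \<mu> by (rule P_inv_prob_space)
  note [measurable_cong] = P_inv_sets[OF \<mu>]
  interpret P: pair_prob_space \<mu> haar_O ..
  define g where "g w X = (\<Prod>a<n. gauss_stat {..<N} (w *v T a) X)" for w :: "real^'m^'m" and X
  have g01: "0 \<le> g w X" "g w X \<le> 1" for w X unfolding g_def by (rule prod_gauss_stat_bounds)+
  have gm [measurable]: "(\<lambda>(X, w). g w X) \<in> borel_measurable (borel \<Otimes>\<^sub>M borel)"
    unfolding g_def by measurable
  have R: "stat_avg N n T X = (\<integral>w. g w X \<partial>haar_O)" for X by (simp add: stat_avg_def g_def)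
  have i: "integrable (\<mu> \<Otimes>\<^sub>M haar_O) (\<lambda>(X, w). h X * g w X)"
    if [measurable]: "h \<in> borel_measurable borel" and "\<And>X. 0 \<le> h X" "\<And>X. h X \<le> 1" for h
  proof -
    have "\<bar>h X * g w X\<bar> \<le> 1" for X w
      using that(2,3)[of X] g01[of w X] by (simp add: abs_mult mult_le_one)
    then show ?thesis by (intro P.integrable_const_bound[where B = 1]) auto
  qed
  have swap: "(\<integral>X. h X * stat_avg N n T X \<partial>\<mu>) = (\<integral>w. \<integral>X. h X * g w X \<partial>\<mu> \<partial>haar_O)"
    if "h \<in> borel_measurable borel" "\<And>X. 0 \<le> h X" "\<And>X. h X \<le> 1" for h
    using P.Fubini_integral[OF i[OF that]] by (simp add: R)
  have "(\<integral>X. (stat_avg N n T X)\<^sup>2 \<partial>\<mu>) = (\<integral>w. \<integral>X. stat_avg N n T X * g w X \<partial>\<mu> \<partial>haar_O)"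
    unfolding power2_eq_square by (rule swap) (auto simp: stat_avg_bounds)
  \<comment> \<open>Rotating \<open>X\<close> by the transpose of \<open>w\<close> fixes
    \<open>stat_avg\<close> and turns \<open>g w\<close> into \<open>g (mat 1)\<close>.\<close>
  also have "\<dots> = (\<integral>w. (\<integral>X. stat_avg N n T X * g (mat 1) X \<partial>\<mu>) \<partial>(haar_O :: (real^'m^'m) measure))"
  proof (rule integral_cong_AE)
    show "AE w in haar_O. (\<integral>X. stat_avg N n T X * g w X \<partial>\<mu>) = (\<integral>X. stat_avg N n T X * g (mat 1) X \<partial>\<mu>)"
      using AE_haar_O
    proof eventually_elim
      fix w :: "real^'m^'m" assume w: "w \<in> O_fin"
      have "stat_avg N n T X * g w X = stat_avg N n T (act id_mat (transpose w) X) * g (mat 1) (act id_mat (transpose w) X)" for X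
        unfolding g_def stat_avg_rotate[OF w] matrix_vector_mul_lid gauss_stat_rotate[OF w] ..
      then show "(\<integral>X. stat_avg N n T X * g w X \<partial>\<mu>) = (\<integral>X. stat_avg N n T X * g (mat 1) X \<partial>\<mu>)"
        using P_inv_integral[OF \<mu> id_mat_O_inf, of "transpose w" "\<lambda>X. stat_avg N n T X * g (mat 1) X"] w by simp
    qed
  qed measurable
  also have "\<dots> = (\<integral>X. g (mat 1) X * stat_avg N n T X \<partial>\<mu>)"
    by (simp add: mult.commute)
  also have "\<dots> = (\<integral>w. \<integral>X. g (mat 1) X * g w X \<partial>\<mu> \<partial>haar_O)"
    by (rule swap) (auto simp: g01)
  also have "\<dots> = (\<integral>w. \<integral>X. (\<Prod>a<n + n. gauss_stat {..<N} (append_rows n T (\<lambda>b. w *v T b) a) X) \<partial>\<mu> \<partial>haar_O)"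
    unfolding prod_append_rows[where f = "\<lambda>t. gauss_stat {..<N} t _"] g_def matrix_vector_mul_lid ..
  finally show ?thesis .
qed

text \<open>The second-moment method: the mean tends to \<open>Phi s n T\<close>, and the mean
  square to its square because the limiting double Haar integral factorises.\<close>

lemma stat_avg_L2_mu:
  fixes s :: "real^'m::finite"
  shows "(\<lambda>N. \<integral>X. (stat_avg N n T X - Phi s n T)\<^sup>2 \<partial>mu s) \<longlonglongrightarrow> 0"
proof -
  note \<mu> = mu_P_inv[of s]
  note \<mu>b = mu_probs[of s]
  interpret prob_space "mu s" using \<mu> by (rule P_inv_prob_space)
  note [measurable_cong] = P_inv_sets[OF \<mu>]
  interpret HH: pair_prob_space haar_O haar_O ..
  define E where "E q = exp (- energy s n T q / 2)" for q
  have [measurable]: "E \<in> borel_measurable borel" unfolding E_def by measurable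
  have E01: "0 \<le> E q" "E q \<le> 1" for q by (simp_all add: E_def energy_nonneg)
  define A where "A w = append_rows n T (\<lambda>b. w *v T b)" for w
  define P where "P N w = (\<integral>X. (\<Prod>a<n + n. gauss_stat {..<N} (A w a) X) \<partial>mu s)" for N w
  have "(\<lambda>N. \<integral>X. (stat_avg N n T X)\<^sup>2 \<partial>mu s) \<longlonglongrightarrow> (\<integral>w. Phi s (n + n) (A w) \<partial>haar_O)"
    unfolding expectation_stat_avg_square[OF \<mu>] A_def[symmetric] P_def[symmetric]
  proof (rule integral_dominated_convergence[where w = "\<lambda>_. 1"])
    show "(\<lambda>w. P N w) \<in> borel_measurable haar_O" for N
      unfolding P_def A_def prod_append_rows[where f = "\<lambda>t. gauss_stat {..<N} t _"] by measurable
    have "(\<lambda>N. P N w)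
        \<longlonglongrightarrow> Phi s (n + n) (A w)" for w
      using gauss_stat_prod_tendsto[OF \<mu>, where n = "n + n" and t = "A w"] by (simp add: cf_mu P_def)
    then show "AE w in haar_O. (\<lambda>N. P N w)
        \<longlonglongrightarrow> Phi s (n + n) (A w)" by (rule AE_I2)
    show "AE w in haar_O. norm (P N w) \<le> 1" for N
    proof (rule AE_I2)
      fix w :: "real^'m^'m"
      have b: "0 \<le> P N w"
        unfolding P_def by (intro Bochner_Integration.integral_nonneg prod_gauss_stat_bounds)
      have "P N w \<le> (\<integral>X. 1 \<partial>mu s)"
        unfolding P_def by (intro integral_mono gauss_stat_integrable[OF \<mu>b] prod_gauss_stat_bounds) simp
      then show "norm (P N w) \<le> 1"
        using b by (simp add: prob_space)
    qed
    show "(\<lambda>w. Phi s (n + n) (A w)) \<in> borel_measurable haar_O"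
      unfolding Phi_def A_def energy_append_rows by measurable
  qed simp
  \<comment> \<open>Energies of stacked rows add, so the exponential splits into the factors at
    \<open>q\<close> and at \<open>q ** w\<close>.\<close>
  also have "(\<integral>w. Phi s (n + n) (A w) \<partial>haar_O) = (\<integral>w. \<integral>q. E q * E (q ** w) \<partial>haar_O \<partial>haar_O)"
    unfolding Phi_def A_def energy_append_rows E_def
    by (simp add: exp_add[symmetric] add_divide_distrib diff_divide_distrib)
  also have "\<dots> = (\<integral>q. \<integral>w. E q * E (q ** w) \<partial>haar_O \<partial>haar_O)"
  proof -
    have "integrable (haar_O \<Otimes>\<^sub>M haar_O) (\<lambda>(q, w). E q * E (q ** w))"
    proof (rule HH.integrable_const_bound[where B = 1])
      show "AE z in haar_O \<Otimes>\<^sub>M haar_O. norm (case z of (q, w) \<Rightarrow> E q * E (q ** w)) \<le> 1"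
        using E01 by (intro AE_I2) (auto simp: abs_mult intro!: mult_le_one)
    qed measurable
    from HH.Fubini_integral[OF this] show ?thesis .
  qed
  \<comment> \<open>Left invariance removes \<open>q\<close> from the inner integral and decouples
    the two factors.\<close>
  also have "\<dots> = (\<integral>q. E q * Phi s n T \<partial>haar_O)"
  proof (rule integral_cong_AE)
    show "AE q in haar_O. (\<integral>w. E q * E (q ** w) \<partial>haar_O) = E q * Phi s n T"
      using AE_haar_O
    proof eventually_elim
      fix q :: "real^'m^'m" assume "q \<in> O_fin"
      then have "(\<integral>w. E (q ** w) \<partial>haar_O) = Phi s n T"
        by (subst integral_haar_left) (auto simp: Phi_def E_def[abs_def])
      then show "(\<integral>w. E q * E (q ** w) \<partial>haar_O) = E q * Phi s n T" by simp
    qed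
  qed measurable
  also have "\<dots> = (Phi s n T)\<^sup>2" by (simp add: Phi_def E_def power2_eq_square)
  finally have sq: "(\<lambda>N. \<integral>X. (stat_avg N n T X)\<^sup>2 \<partial>mu s) \<longlonglongrightarrow> (Phi s n T)\<^sup>2" .
  have mean: "(\<lambda>N. \<integral>X. stat_avg N n T X \<partial>mu s) \<longlonglongrightarrow> Phi s n T"
    using expectation_stat_avg_tendsto[OF \<mu>, of n T] by (simp add: cf_mu)
  have int2: "integrable (mu s) (\<lambda>X. (stat_avg N n T X)\<^sup>2)" for N
    by (intro integrable_const_bound[where B = 1]) (auto simp: power_le_one stat_avg_bounds)
  have "(\<integral>X. (stat_avg N n T X - Phi s n T)\<^sup>2 \<partial>mu s)
     = (\<integral>X. (stat_avg N n T X)\<^sup>2 \<partial>mu s) - 2 * Phi s n T * (\<integral>X. stat_avg N n T X \<partial>mu s) + (Phi s n T)\<^sup>2" for N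
  proof -
    have "(\<integral>X. (stat_avg N n T X - Phi s n T)\<^sup>2 \<partial>mu s) = (\<integral>X. (stat_avg N n T X)\<^sup>2 - 2 * Phi s n T * stat_avg N n T X + (Phi s n T)\<^sup>2 \<partial>mu s)"
      by (simp add: power2_diff algebra_simps)
    then show ?thesis using int2 integrable_stat_avg[OF \<mu>b] by (simp add: prob_space)
  qed
  moreover have "(\<lambda>N. (\<integral>X. (stat_avg N n T X)\<^sup>2 \<partial>mu s) - 2 * Phi s n T * (\<integral>X. stat_avg N n T X \<partial>mu s) + (Phi s n T)\<^sup>2)
     \<longlonglongrightarrow> (Phi s n T)\<^sup>2 - 2 * Phi s n T * Phi s n T + (Phi s n T)\<^sup>2"
    by (intro tendsto_intros sq mean)
  ultimately show ?thesis by (simp add: power2_eq_square)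
qed

text \<open>
  Conditioning \<open>mu s\<close> on an invariant event keeps it invariant, and \<open>stat_avg\<close> converges to the same constants
  under the conditioned law, so that law is again \<open>mu s\<close>.
\<close>

lemma mu_P_erg: "mu s \<in> (P_erg :: 'm::finite imat measure set)"
  unfolding P_erg_def
proof (intro CollectI conjI mu_P_inv ballI impI)
  note \<mu> = mu_P_inv[of s]
  note \<mu>b = mu_probs[of s]
  interpret prob_space "mu s" using \<mu> by (rule P_inv_prob_space)
  note sets [measurable_cong, simp] = P_inv_sets[OF \<mu>]
  have [simp]: "space (mu s) = UNIV" using sets_eq_imp_space_eq[OF sets] by simp
  fix A :: "'m imat set" assume [measurable]: "A \<in> sets borel" and inv: "invariant_set A"
  show "emeasure (mu s) A = 0 \<or> emeasure (mu s) (- A) = 0"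
  proof (cases "emeasure (mu s) A = 0")
    case False
    define p where "p = measure (mu s) A"
    have p: "0 < p" using False by (simp add: p_def emeasure_eq_measure zero_less_measure_iff)
    \<comment> \<open>The density of the conditional law. It is bounded by 1 / \<open>p\<close>, so
      mean-square convergence under \<open>mu s\<close> passes to \<nu>.\<close>
    define d where "d X = indicator A X / p" for X
    have [measurable]: "d \<in> borel_measurable borel" unfolding d_def by measurable
    have d0: "0 \<le> d X" for X using p by (simp add: d_def)
    define \<nu> where "\<nu> = density (mu s) (\<lambda>X. ennreal (d X))"
    have [measurable_cong, simp]: "sets \<nu> = sets borel" by (simp add: \<nu>_def)
    have di: "integrable (mu s) d" unfolding d_def
      by (intro integrable_divide) (simp add: integrable_indicator_iff emeasure_eq_measure)
    have d1: "(\<integral>X. d X \<partial>mu s) = 1" using p by (simp add: d_def p_def)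
    have "(\<integral>\<^sup>+X. ennreal (d X) \<partial>mu s) = 1"
      using nn_integral_eq_integral[OF di] d0 d1 by simp
    then have "prob_space \<nu>" by (intro prob_spaceI) (simp add: \<nu>_def emeasure_density)
    then have \<nu>b: "\<nu> \<in> borel_probs" by (simp add: borel_probs_def)
    interpret N: prob_space \<nu> by fact
    have dinv: "d (act u v X) = d X" if uv: "u \<in> O_inf" "v \<in> O_fin" for u v X
    proof -
      have img: "act u' v' ` A = A" if "u' \<in> O_inf" "v' \<in> O_fin" for u' v'
        using inv that unfolding invariant_set_def by (elim ballE) auto
      have u': "(\<lambda>i j. u j i) \<in> O_inf" and v': "transpose v \<in> O_fin"
        using act_inverse(1)[OF uv] uv(2) by simp_all
      have "act u v X \<in> A \<longleftrightarrow> X \<in> A"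
      proof
        assume "X \<in> A"
        then have "act u v X \<in> act u v ` A" by (rule imageI)
        then show "act u v X \<in> A" unfolding img[OF uv] .
      next
        assume "act u v X \<in> A"
        then have "act (\<lambda>i j. u j i) (transpose v) (act u v X) \<in> act (\<lambda>i j. u j i) (transpose v) ` A"
          by (rule imageI)
        moreover have "act (\<lambda>i j. u j i) (transpose v) (act u v X) = X"
          using act_inverse(2)[OF u' v', of X] unfolding transpose_transpose .
        ultimately show "X \<in> A" unfolding img[OF u' v'] by simp
      qed
      then show ?thesis by (simp add: d_def indicator_def)
    qed
    have "\<nu> \<in> P_inv"
      unfolding P_inv_def
    proof (intro CollectI conjI ballI \<nu>b)
      fix u and v :: "real^'m^'m" assume uv: "u \<in> O_inf" "v \<in> O_fin"
      show "distr \<nu> borel (act u v) = \<nu>"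
      proof (rule measure_eqI)
        fix B assume "B \<in> sets (distr \<nu> borel (act u v))"
        then have [measurable]: "B \<in> sets borel" by simp
        have "emeasure (distr \<nu> borel (act u v)) B = (\<integral>\<^sup>+X. indicator B (act u v X) \<partial>\<nu>)"
          by (simp add: nn_integral_distr flip: nn_integral_indicator)
        also have "\<dots> = (\<integral>\<^sup>+X. ennreal (d (act u v X)) * indicator B (act u v X) \<partial>mu s)"
          unfolding \<nu>_def dinv[OF uv] by (subst nn_integral_density) auto
        also have "\<dots> = (\<integral>\<^sup>+X. ennreal (d X) * indicator B X \<partial>distr (mu s) borel (act u v))"
          by (simp add: nn_integral_distr)
        also have "\<dots> = (\<integral>\<^sup>+X. ennreal (d X) * indicator B X \<partial>mu s)"
          using \<mu> uv by (simp add: P_inv_def)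
        also have "\<dots> = emeasure \<nu> B" by (simp add: \<nu>_def emeasure_density)
        finally show "emeasure (distr \<nu> borel (act u v)) B = emeasure \<nu> B" .
      qed simp
    qed
    have cf: "cf \<nu> 0 n T = Phi s n T" for n T
    proof -
      define h where "h N X = stat_avg N n T X - Phi s n T" for N X
      have [measurable]: "h N \<in> borel_measurable borel" for N unfolding h_def by measurable
      have hi: "integrable \<nu> (h N)" for N
        unfolding h_def by (intro Bochner_Integration.integrable_diff integrable_stat_avg \<nu>b) simp
      have Phi1: "\<bar>Phi s n T\<bar> \<le> 1" using cf_bound[OF prob_space_axioms, of 0 n T] by (simp add: cf_mu)
      have hb: "(h N X)\<^sup>2 \<le> 4" for N X
      proof -
        have "\<bar>h N X\<bar> \<le> 2" using Phi1 stat_avg_bounds[of N n T X] unfolding h_def by linarith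
        then show ?thesis using power_mono[of "\<bar>h N X\<bar>" 2 2] by simp
      qed
      have h2: "integrable \<nu> (\<lambda>X. (h N X)\<^sup>2)" "integrable (mu s) (\<lambda>X. (h N X)\<^sup>2)" for N
        using hb by (auto intro!: N.integrable_const_bound[where B = 4] integrable_const_bound[where B = 4])
      \<comment> \<open>Jensen's inequality, in the form that the variance is nonnegative, followed
        by the bound 1 / \<open>p\<close> on the density.\<close>
      have le: "(\<integral>X. h N X \<partial>\<nu>)\<^sup>2 \<le> (\<integral>X. (h N X)\<^sup>2 \<partial>mu s) / p" for N
      proof -
        have "0 \<le> N.variance (h N)" by (rule N.variance_positive)
        then have "(\<integral>X. h N X \<partial>\<nu>)\<^sup>2 \<le> (\<integral>X. (h N X)\<^sup>2 \<partial>\<nu>)"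
          using N.variance_eq[OF hi h2(1)] by simp
        also have "\<dots> = (\<integral>X. d X * (h N X)\<^sup>2 \<partial>mu s)"
          unfolding \<nu>_def by (subst integral_density) (auto simp: d0)
        also have "\<dots> \<le> (\<integral>X. (h N X)\<^sup>2 / p \<partial>mu s)"
        proof (rule integral_mono')
          show "integrable (mu s) (\<lambda>X. (h N X)\<^sup>2 / p)" using h2(2) by simp
          fix X
          show "d X * (h N X)\<^sup>2 \<le> (h N X)\<^sup>2 / p" using p by (simp add: d_def indicator_def)
          show "0 \<le> (h N X)\<^sup>2 / p" using p by simp
        qed
        finally show ?thesis by simp
      qed
      have "(\<lambda>N. (\<integral>X. (h N X)\<^sup>2 \<partial>mu s) / p) \<longlonglongrightarrow> 0 / p"
        unfolding h_def using p by (intro tendsto_divide stat_avg_L2_mu tendsto_const) simp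
      then have lim0: "(\<lambda>N. (\<integral>X. (h N X)\<^sup>2 \<partial>mu s) / p) \<longlonglongrightarrow> 0" by simp
      have "(\<lambda>N. (\<integral>X. h N X \<partial>\<nu>)\<^sup>2) \<longlonglongrightarrow> 0"
      proof (rule Lim_null_comparison[OF always_eventually lim0], intro allI)
        fix N
        show "norm ((\<integral>X. h N X \<partial>\<nu>)\<^sup>2) \<le> (\<integral>X. (h N X)\<^sup>2 \<partial>mu s) / p" using le[of N] by simp
      qed
      moreover have "(\<lambda>N. (\<integral>X. h N X \<partial>\<nu>)\<^sup>2) \<longlonglongrightarrow> (cf \<nu> 0 n T - Phi s n T)\<^sup>2"
      proof -
        have "(\<integral>X. h N X \<partial>\<nu>) = (\<integral>X. stat_avg N n T X \<partial>\<nu>) - Phi s n T" for N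
          unfolding h_def using integrable_stat_avg[OF \<nu>b] by (simp add: N.prob_space)
        then show ?thesis
          using expectation_stat_avg_tendsto[OF \<open>\<nu> \<in> P_inv\<close>, of n T] by (auto intro!: tendsto_intros)
      qed
      ultimately have "(cf \<nu> 0 n T - Phi s n T)\<^sup>2 = 0" by (rule LIMSEQ_unique[rotated])
      then show ?thesis by simp
    qed
    have "\<nu> = mu s"
      by (rule cf_eqI[OF \<nu>b \<mu>b]) (simp only: cf_mu cf[symmetric] P_inv_cf_phase[OF \<open>\<nu> \<in> P_inv\<close>, symmetric])
    moreover have "emeasure \<nu> (- A) = 0"
    proof -
      have "emeasure \<nu> (- A) = (\<integral>\<^sup>+X. ennreal (d X) * indicator (- A) X \<partial>mu s)"
        unfolding \<nu>_def by (rule emeasure_density) auto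
      also have "\<dots> = (\<integral>\<^sup>+X. 0 \<partial>mu s)" by (intro nn_integral_cong) (simp add: d_def indicator_def)
      finally show ?thesis by simp
    qed
    ultimately show ?thesis by simp
  qed simp
qed

section \<open>The weak topology on the ergodic measures\<close>

lemma topspace_P_erg: "topspace (subtopology weak_topology P_erg) = P_erg"
  by (auto simp: topspace_weak_topology P_erg_def P_inv_def)

lemma continuous_map_mu:
  "continuous_map (top_of_set S) weak_topology (mu :: real^'m::finite \<Rightarrow> 'm imat measure)"
  unfolding weak_topology_def
proof (rule continuous_on_generated_topo)
  fix V assume "V \<in> {{\<mu> \<in> borel_probs. integral\<^sup>L \<mu> f \<in> U} | (f :: 'm imat \<Rightarrow> real) U.
        continuous_on UNIV f \<and> bounded (range f) \<and> open U}"
  then obtain f :: "'m imat \<Rightarrow> real" and U where V: "V = {\<mu> \<in> borel_probs. integral\<^sup>L \<mu> f \<in> U}"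
    and f: "continuous_on UNIV f" "bounded (range f)" and U: "open U" by blast
  have "open ((\<lambda>s. integral\<^sup>L (mu s) f) -` U)"
    by (intro open_vimage U continuous_mu_integral f)
  then have "openin (top_of_set S) (S \<inter> ((\<lambda>s. integral\<^sup>L (mu s) f) -` U))" by (rule openin_open_Int)
  also have "S \<inter> ((\<lambda>s. integral\<^sup>L (mu s) f) -` U) = mu -` V \<inter> topspace (top_of_set S)"
    using mu_probs by (auto simp: V)
  finally show "openin (top_of_set S) (mu -` V \<inter> topspace (top_of_set S))" .
next
  have "mu s \<in> topspace weak_topology" for s :: "real^'m" by (simp add: topspace_weak_topology mu_probs)
  then show "mu ` topspace (top_of_set S) \<subseteq> \<Union> {{\<mu> \<in> borel_probs. integral\<^sup>L \<mu> f \<in> U} | (f :: 'm imat \<Rightarrow> real) U.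
        continuous_on UNIV f \<and> bounded (range f) \<and> open U}"
    unfolding weak_topology_def topology_generated_by_topspace by blast
qed

lemma openin_weak_cf:
  fixes T :: "'m::finite imat"
  assumes "open U"
  shows "openin weak_topology {\<mu> \<in> borel_probs. cf \<mu> \<theta> n T \<in> U}"
  unfolding weak_topology_def cf_def
proof (rule topology_generated_by_Basis)
  show "{\<mu> \<in> borel_probs. (\<integral>X. cos (\<theta> + (\<Sum>i<n. T i \<bullet> X i)) \<partial>\<mu>) \<in> U} \<in>
     {{\<mu> \<in> borel_probs. integral\<^sup>L \<mu> f \<in> U} | (f :: 'm imat \<Rightarrow> real) U.
        continuous_on UNIV f \<and> bounded (range f) \<and> open U}"
    using assms bounded_continuous_cos_lin by blast
qed

text \<open>No point of the closed set \<open>C\<close> has the same \<open>Phi\<close> as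
  \<open>s\<close>, so by compactness finitely many values of \<open>Phi\<close> keep all of
  \<open>C\<close> away from \<open>s\<close> by some \<epsilon>. These values are \<open>cf\<close>
  at phase 0, hence define a weak neighbourhood of \<open>mu s\<close>.\<close>

lemma open_map_mu:
  "open_map (top_of_set (Delta :: (real, 'm::{finite,linorder}) vec set)) (subtopology weak_topology P_erg) mu"
  unfolding open_map_def
proof (intro allI impI)
  fix U assume "openin (top_of_set (Delta :: (real, 'm) vec set)) U"
  then obtain W where W: "open W" "U = Delta \<inter> W" by (auto simp: openin_open)
  define C where "C = Delta - W"
  have "closed C" unfolding C_def by (rule closed_Diff[OF closed_Delta W(1)])
  show "openin (subtopology weak_topology P_erg) (mu ` U)"
    unfolding openin_subopen[of _ "mu ` U"]
  proof
    fix \<mu> assume "\<mu> \<in> mu ` U"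
    then obtain s where s: "s \<in> U" "\<mu> = mu s" by blast
    then have sD: "s \<in> Delta" using W by blast
    have "\<exists>F \<epsilon>. finite F \<and> 0 < \<epsilon> \<and> \<not> (\<exists>t\<in>C. \<forall>(n, T)\<in>F. \<bar>Phi t n T - Phi s n T\<bar> < \<epsilon>)"
    proof (rule ccontr)
      assume no: "\<not> ?thesis"
      have "\<exists>t\<in>C. \<forall>n T. Phi t n T = Phi s n T"
      proof (rule Phi_limit_compact[where c = "Phi s", OF \<open>closed C\<close> zero_less_one])
        show "0 < Phi s CARD('m) (test_rows UNIV 1)" by (simp add: Phi_test_rows_UNIV)
      qed (use no in blast)
      then obtain t where t: "t \<in> C" "\<And>n T. Phi t n T = Phi s n T" by blast
      then have "t = s" using sD by (intro Phi_inj) (auto simp: C_def)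
      then show False using t(1) s W by (simp add: C_def)
    qed
    then obtain F \<epsilon> where F: "finite F" "0 < \<epsilon>" and no: "\<And>t. t \<in> C \<Longrightarrow> \<exists>(n, T)\<in>F. \<not> \<bar>Phi t n T - Phi s n T\<bar> < \<epsilon>"
      by (auto simp: case_prod_beta)
    \<comment> \<open>Intersecting with the whole space gives an open set also when \<open>F\<close>
      is empty.\<close>
    define V where "V = topspace weak_topology \<inter> (\<Inter>p\<in>F. {\<mu> \<in> borel_probs. cf \<mu> 0 (fst p) (snd p) \<in> ball (Phi s (fst p) (snd p)) \<epsilon>})"
    have "openin weak_topology V"
      unfolding V_def using F(1)
    proof (induction F rule: finite_induct)
      case (insert p F)
      let ?B = "\<lambda>p. {\<mu> \<in> borel_probs. cf \<mu> 0 (fst p) (snd p) \<in> ball (Phi s (fst p) (snd p)) \<epsilon>}"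
      have "openin weak_topology (?B p \<inter> (topspace weak_topology \<inter> (\<Inter>p\<in>F. ?B p)))"
        by (rule openin_Int[OF openin_weak_cf[OF open_ball] insert.IH])
      also have "?B p \<inter> (topspace weak_topology \<inter> (\<Inter>p\<in>F. ?B p)) = topspace weak_topology \<inter> (\<Inter>p\<in>insert p F. ?B p)"
        by auto
      finally show ?case .
    qed simp
    then have "openin (subtopology weak_topology P_erg) (V \<inter> P_erg)" by (auto simp: openin_subtopology)
    moreover have "\<mu> \<in> V \<inter> P_erg"
      using F(2) by (auto simp: V_def s(2) topspace_weak_topology mu_probs mu_P_erg cf_mu)
    moreover have "V \<inter> P_erg \<subseteq> mu ` U"
    proof
      fix \<nu> assume \<nu>: "\<nu> \<in> V \<inter> P_erg"
      then obtain t where t: "t \<in> Delta" "mu t = \<nu>" using P_erg_imp_mu by blast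
      have "t \<notin> C"
      proof
        assume "t \<in> C"
        from no[OF this] obtain p where "p \<in> F" "\<not> \<bar>Phi t (fst p) (snd p) - Phi s (fst p) (snd p)\<bar> < \<epsilon>" by auto
        then show False using \<nu> t(2) by (auto simp: V_def cf_mu dist_real_def abs_minus_commute)
      qed
      then show "\<nu> \<in> mu ` U" using t W by (auto simp: C_def)
    qed
    ultimately show "\<exists>T. openin (subtopology weak_topology P_erg) T \<and> \<mu> \<in> T \<and> T \<subseteq> mu ` U" by blast
  qed
qed

theorem theorem1p1:
  shows "(\<forall>s \<in> (Delta :: (real ^ 'm::{finite,linorder}) set). mu s \<in> P_erg) \<and>
    homeomorphic_map (top_of_set (Delta :: (real ^ 'm::{finite,linorder}) set))
      (subtopology weak_topology P_erg) mu"
proof (intro conjI ballI mu_P_erg bijective_open_imp_homeomorphic_map open_map_mu)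
  show "continuous_map (top_of_set (Delta :: (real, 'm) vec set)) (subtopology weak_topology P_erg) mu"
    by (auto simp: continuous_map_in_subtopology continuous_map_mu mu_P_erg)
  show "mu ` topspace (top_of_set (Delta :: (real, 'm) vec set)) = topspace (subtopology weak_topology P_erg)"
    unfolding topspace_P_erg using mu_P_erg P_erg_imp_mu by auto
  show "inj_on mu (topspace (top_of_set (Delta :: (real, 'm) vec set)))"
  proof (rule inj_onI)
    fix s t :: "(real, 'm) vec"
    assume st: "s \<in> topspace (top_of_set (Delta :: (real, 'm) vec set))" "t \<in> topspace (top_of_set (Delta :: (real, 'm) vec set))" and eq: "mu s = mu t"
    have "Phi s n T = Phi t n T" for n T using cf_mu[of s 0 n T] cf_mu[of t 0 n T] eq by simp
    then show "s = t" using st by (intro Phi_inj) auto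
  qed
qed

end
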